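(* Let $B=\mathbb{C}(t_1,d_1,\dots,t_4,d_4)$ and let $F=\mathbb{C}(u_5,v_5,u_6,v_6,u_7,v_7)^{S_3}$ be the field of rational functions on $(\mathbb{C}^2)^3$ invariant under the action of $S_3$ permuting the three pairs $(u_j,v_j)$. (i) For every $\sigma\in F$ there exists a nonzero (monic) polynomial $h_\sigma\in B[x]$ of degree at most four such that every $f\in E^{(4)}$ satisfies $$h_\sigma|_{(t_1,d_1,\dots,t_4,d_4)}\big(\sigma(u_5,v_5,u_6,v_6,u_7,v_7)\big)=0,$$ where $(t_i,d_i)$ and $(u_j,v_j)$ are the spectral data of $f$ (whenever the coefficients of $h_\sigma$ and $\sigma$ are defined at these values). (ii) For each of the functions $e_{1,0}=u_5+u_6+u_7$, $e_{3,0}=u_5u_6u_7$, $e_{0,1}=v_5+v_6+v_7$, $e_{1,1}=u_5v_6+u_5v_7+u_6v_7+u_6v_5+u_7v_5+u_7v_6$, the corresponding relation $h_\sigma(\sigma)=0$ is algebraically independent of (i.e. not a consequence of) the known relations $$\sum_{i=1}^7\frac{1}{u_iv_i}=1,\quad \sum_{i=1}^7\frac{u_i+v_i}{u_iv_i}=4,\quad \sum_{i=1}^7\frac{(u_i+v_i)^2}{u_iv_i}=16,\quad \sum_{i=5}^7\frac1{u_i}=1,\quad \sum_{i=5}^7\frac{v_i}{u_i}=1,$$ where for $i=1,\dots,4$, $u_i,v_i$ denote the eigenvalues of $\mathbf{I}-Df|_{p_i}$ (so $u_i+v_i=t_i$, $u_iv_i=d_i$).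
   Context: Fix a line $\ell\subset\mathbb{P}^2$. $E^{(4)}$ is the variety of holomorphic quadratic self-maps $f$ of $\mathbb{P}^2$ (given by three homogeneous quadratic polynomials without common nontrivial zeros) with $f(\ell)\subset\ell$, all of whose fixed points are isolated and non-degenerate ($\det(\mathbf{I}-Df|_p)\ne0$), with the four fixed points off $\ell$ marked and ordered $p_1,\dots,p_4$. The three fixed points on $\ell$ are denoted $p_5,p_6,p_7$ (in any order). For $i=1,\dots,4$, $t_i,d_i$ are the trace and determinant of $\mathbf{I}-Df|_{p_i}$. For $j=5,6,7$, $u_j,v_j$ are the two eigenvalues of $\mathbf{I}-Df|_{p_j}$, with $u_j$ the one associated to the eigendirection tangent to $\ell$ (i.e. $u_j=1-(f|_\ell)'(p_j)$). *)

theory Defs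
  imports Complex_Main
begin

text \<open>Points of P^2 are represented by nonzero vectors in C^3 (functions on indices 0,1,2).
  A quadratic self-map is given by coefficients a i j k: F_i(x) = sum_{j,k<3} a i j k x_j x_k.
  A line is given by a nonzero linear form c: the line is the set of points with c.x = 0.\<close>

type_synonym vec3 = "nat \<Rightarrow> complex"
type_synonym qmap = "nat \<Rightarrow> nat \<Rightarrow> nat \<Rightarrow> complex"

definition qeval :: "qmap \<Rightarrow> vec3 \<Rightarrow> vec3" where
  "qeval a x = (\<lambda>i. \<Sum>j<3. \<Sum>k<3. a i j k * x j * x k)"

definition jac :: "qmap \<Rightarrow> vec3 \<Rightarrow> nat \<Rightarrow> nat \<Rightarrow> complex" where
  "jac a x = (\<lambda>i j. \<Sum>k<3. (a i j k + a i k j) * x k)"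

definition nonzero3 :: "vec3 \<Rightarrow> bool" where
  "nonzero3 x \<longleftrightarrow> (\<exists>i<3. x i \<noteq> 0)"

text \<open>y is a scalar multiple of x (for nonzero vectors: same point of P^2).\<close>
definition in_span :: "vec3 \<Rightarrow> vec3 \<Rightarrow> bool" where
  "in_span y x \<longleftrightarrow> (\<exists>s. \<forall>i<3. y i = s * x i)"

definition lin :: "vec3 \<Rightarrow> vec3 \<Rightarrow> complex" where
  "lin c x = (\<Sum>i<3. c i * x i)"

definition no_common_zero :: "qmap \<Rightarrow> bool" where
  "no_common_zero a \<longleftrightarrow> (\<forall>x. (\<forall>i<3. qeval a x i = 0) \<longrightarrow> \<not> nonzero3 x)"

definition preserves_line :: "qmap \<Rightarrow> vec3 \<Rightarrow> bool" where
  "preserves_line a c \<longleftrightarrow> (\<forall>x. lin c x = 0 \<longrightarrow> lin c (qeval a x) = 0)"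

definition fixed_point :: "qmap \<Rightarrow> vec3 \<Rightarrow> bool" where
  "fixed_point a x \<longleftrightarrow> nonzero3 x \<and> (\<exists>lam. \<forall>i<3. qeval a x i = lam * x i)"

definition fp_mult :: "qmap \<Rightarrow> vec3 \<Rightarrow> complex" where
  "fp_mult a x = (THE lam. \<forall>i<3. qeval a x i = lam * x i)"

text \<open>M = DF(x)/lam. The derivative Df_p of f at p=[x] is the map induced by M on
  C^3 / span x (= T_p P^2); moreover M x = 2 x (Euler), so
  det(s I - M) = (s - 2) det(s I - Df_p).\<close>
definition dmat :: "qmap \<Rightarrow> vec3 \<Rightarrow> nat \<Rightarrow> nat \<Rightarrow> complex" where
  "dmat a x = (\<lambda>i j. jac a x i j / fp_mult a x)"

definition tr3 :: "(nat \<Rightarrow> nat \<Rightarrow> complex) \<Rightarrow> complex" where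
  "tr3 M = M 0 0 + M 1 1 + M 2 2"

definition det3 :: "(nat \<Rightarrow> nat \<Rightarrow> complex) \<Rightarrow> complex" where
  "det3 M = M 0 0 * (M 1 1 * M 2 2 - M 1 2 * M 2 1)
          - M 0 1 * (M 1 0 * M 2 2 - M 1 2 * M 2 0)
          + M 0 2 * (M 1 0 * M 2 1 - M 1 1 * M 2 0)"

text \<open>trace(I - Df_p) = 2 - tr(Df_p) = 2 - (tr M - 2).\<close>
definition trace_IDf :: "qmap \<Rightarrow> vec3 \<Rightarrow> complex" where
  "trace_IDf a x = 4 - tr3 (dmat a x)"

text \<open>det(I - Df_p) = det(I - M) / (1 - 2).\<close>
definition det_IDf :: "qmap \<Rightarrow> vec3 \<Rightarrow> complex" where
  "det_IDf a x = - det3 (\<lambda>i j. (if i = j then 1 else 0) - dmat a x i j)"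

text \<open>For a fixed point p=[x] on the invariant line {c.y = 0}: the eigenvalue of Df_p on
  T_p l = {c.y=0}/span x is the scalar mu with M y = mu y (mod span x) for y in the
  line's plane, y not in span x; then u = 1 - mu, and v is the other eigenvalue of
  I - Df_p, i.e. u + v = trace(I - Df_p).\<close>
definition tangent_eig :: "qmap \<Rightarrow> vec3 \<Rightarrow> vec3 \<Rightarrow> complex" where
  "tangent_eig a c x = (THE mu. \<exists>y. lin c y = 0 \<and> \<not> in_span y x \<and>
      in_span (\<lambda>i. (\<Sum>j<3. dmat a x i j * y j) - mu * y i) x)"

definition u_val :: "qmap \<Rightarrow> vec3 \<Rightarrow> vec3 \<Rightarrow> complex" where
  "u_val a c x = 1 - tangent_eig a c x"

definition v_val :: "qmap \<Rightarrow> vec3 \<Rightarrow> vec3 \<Rightarrow> complex" where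
  "v_val a c x = trace_IDf a x - u_val a c x"

definition E4 :: "vec3 \<Rightarrow> qmap \<Rightarrow> (nat \<Rightarrow> vec3) \<Rightarrow> bool" where
  "E4 c a pt \<longleftrightarrow>
     nonzero3 c \<and> no_common_zero a \<and> preserves_line a c \<and>
     (\<forall>x. fixed_point a x \<longrightarrow> det_IDf a x \<noteq> 0) \<and>
     (\<forall>i\<in>{1..7}. fixed_point a (pt i)) \<and>
     (\<forall>i\<in>{1..7}. \<forall>j\<in>{1..7}. i \<noteq> j \<longrightarrow> \<not> in_span (pt i) (pt j)) \<and>
     (\<forall>i\<in>{1..4}. lin c (pt i) \<noteq> 0) \<and> (\<forall>j\<in>{5..7}. lin c (pt j) = 0) \<and>
     (\<forall>x. fixed_point a x \<longrightarrow> (\<exists>i\<in>{1..7}. in_span x (pt i)))"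

text \<open>Spectral data: (t1,d1,...,t4,d4) at indices 0..7, (u5,v5,u6,v6,u7,v7) at 0..5.\<close>
definition specB :: "qmap \<Rightarrow> (nat \<Rightarrow> vec3) \<Rightarrow> nat \<Rightarrow> complex" where
  "specB a pt k = (if even k then trace_IDf a (pt (k div 2 + 1)) else det_IDf a (pt (k div 2 + 1)))"

definition specF :: "vec3 \<Rightarrow> qmap \<Rightarrow> (nat \<Rightarrow> vec3) \<Rightarrow> nat \<Rightarrow> complex" where
  "specF c a pt k = (if even k then u_val a c (pt (k div 2 + 5)) else v_val a c (pt (k div 2 + 5)))"

inductive_set polyfun :: "nat \<Rightarrow> ((nat \<Rightarrow> complex) \<Rightarrow> complex) set" for n :: nat where
  const: "(\<lambda>_. c) \<in> polyfun n"
| var: "i < n \<Longrightarrow> (\<lambda>x. x i) \<in> polyfun n"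
| add: "p \<in> polyfun n \<Longrightarrow> q \<in> polyfun n \<Longrightarrow> (\<lambda>x. p x + q x) \<in> polyfun n"
| mult: "p \<in> polyfun n \<Longrightarrow> q \<in> polyfun n \<Longrightarrow> (\<lambda>x. p x * q x) \<in> polyfun n"

definition ratfun :: "nat \<Rightarrow> ((nat \<Rightarrow> complex) \<Rightarrow> complex) \<Rightarrow> ((nat \<Rightarrow> complex) \<Rightarrow> complex) \<Rightarrow> bool" where
  "ratfun n p q \<longleftrightarrow> p \<in> polyfun n \<and> q \<in> polyfun n \<and> (\<exists>x. q x \<noteq> 0)"

definition pair_perm :: "(nat \<Rightarrow> nat) \<Rightarrow> (nat \<Rightarrow> complex) \<Rightarrow> nat \<Rightarrow> complex" where
  "pair_perm \<pi> w = (\<lambda>k. if k < 6 then w (2 * \<pi> (k div 2) + k mod 2) else w k)"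

definition in_F :: "((nat \<Rightarrow> complex) \<Rightarrow> complex) \<Rightarrow> ((nat \<Rightarrow> complex) \<Rightarrow> complex) \<Rightarrow> bool" where
  "in_F p q \<longleftrightarrow> ratfun 6 p q \<and>
     (\<forall>\<pi>. bij_betw \<pi> {..<3} {..<3} \<longrightarrow>
        (\<forall>w. p w * q (pair_perm \<pi> w) = q w * p (pair_perm \<pi> w)))"

definition hval :: "nat \<Rightarrow> (nat \<Rightarrow> (nat \<Rightarrow> complex) \<Rightarrow> complex) \<Rightarrow> (nat \<Rightarrow> (nat \<Rightarrow> complex) \<Rightarrow> complex)
     \<Rightarrow> (nat \<Rightarrow> complex) \<Rightarrow> complex \<Rightarrow> complex" where
  "hval m P Q b s = s ^ m + (\<Sum>k<m. P k b / Q k b * s ^ k)"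

definition annih :: "nat \<Rightarrow> (nat \<Rightarrow> (nat \<Rightarrow> complex) \<Rightarrow> complex) \<Rightarrow> (nat \<Rightarrow> (nat \<Rightarrow> complex) \<Rightarrow> complex)
     \<Rightarrow> ((nat \<Rightarrow> complex) \<Rightarrow> complex) \<Rightarrow> ((nat \<Rightarrow> complex) \<Rightarrow> complex) \<Rightarrow> bool" where
  "annih m P Q p q \<longleftrightarrow> m \<le> 4 \<and> (\<forall>k<m. ratfun 8 (P k) (Q k)) \<and>
     (\<forall>c a pt. E4 c a pt \<longrightarrow>
        (\<forall>k<m. Q k (specB a pt) \<noteq> 0) \<longrightarrow> q (specF c a pt) \<noteq> 0 \<longrightarrow>
        hval m P Q (specB a pt) (p (specF c a pt) / q (specF c a pt)) = 0)"

definition e10 :: "(nat \<Rightarrow> complex) \<Rightarrow> complex" where "e10 w = w 0 + w 2 + w 4"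
definition e30 :: "(nat \<Rightarrow> complex) \<Rightarrow> complex" where "e30 w = w 0 * w 2 * w 4"
definition e01 :: "(nat \<Rightarrow> complex) \<Rightarrow> complex" where "e01 w = w 1 + w 3 + w 5"
definition e11 :: "(nat \<Rightarrow> complex) \<Rightarrow> complex" where
  "e11 w = w 0 * w 3 + w 0 * w 5 + w 2 * w 5 + w 2 * w 1 + w 4 * w 1 + w 4 * w 3"

text \<open>b = (t1,d1,...,t4,d4), w = (u5,v5,u6,v6,u7,v7); for i \<le> 4, u_i+v_i = t_i, u_i v_i = d_i.\<close>
definition known_rel :: "(nat \<Rightarrow> complex) \<Rightarrow> (nat \<Rightarrow> complex) \<Rightarrow> bool" where
  "known_rel b w \<longleftrightarrow>
     (\<forall>i<4. b (2*i+1) \<noteq> 0) \<and> (\<forall>j<3. w (2*j) \<noteq> 0 \<and> w (2*j+1) \<noteq> 0) \<and>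
     (\<Sum>i<4. 1 / b (2*i+1)) + (\<Sum>j<3. 1 / (w (2*j) * w (2*j+1))) = 1 \<and>
     (\<Sum>i<4. b (2*i) / b (2*i+1)) + (\<Sum>j<3. (w (2*j) + w (2*j+1)) / (w (2*j) * w (2*j+1))) = 4 \<and>
     (\<Sum>i<4. b (2*i) ^ 2 / b (2*i+1)) + (\<Sum>j<3. (w (2*j) + w (2*j+1)) ^ 2 / (w (2*j) * w (2*j+1))) = 16 \<and>
     (\<Sum>j<3. 1 / w (2*j)) = 1 \<and>
     (\<Sum>j<3. w (2*j+1) / w (2*j)) = 1"

end

theory Submission
  imports Defs "HOL-Computational_Algebra.Polynomial"
begin

text \<open>Since the line \<open>c = 0\<close> is invariant, \<open>c \<circ> F = c \<cdot> m\<close> for a linear form \<open>m\<close>, and \<open>G = F - m \<cdot> id\<close> takes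
  values in \<open>c = 0\<close> and vanishes at the four fixed points off the line. No three of these are
  collinear, so there are coordinates in which they are \<open>(\<plusminus>1, \<plusminus>1, \<plusminus>1)\<close> and \<open>G\<close> is a linear function
  \<open>g\<close> of the squares of the coordinates. The values \<open>\<mu> i\<close> of \<open>m\<close> there satisfy
  \<open>\<Sum> \<mu> i = \<Sum> t i \<mu> i = \<Sum> d i (\<mu> i)^2 = 0\<close>, which has two solutions up to scaling; each of them determines
  \<open>m\<close>, the diagonal and the principal minors of \<open>g\<close>, and then \<open>g\<close> up to one more quadratic
  equation. The fixed points on the line are the roots of a cubic whose coefficients lie in this
  extension of degree four, so invariant functions of their eigenvalues satisfy relations of
  degree at most four. On the other hand, for given \<open>(t, d)\<close> the known relations leave a curve of possible
  \<open>(u, v)\<close>, on which the four functions are unbounded.\<close>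

subsection \<open>Polynomial functions\<close>

text \<open>The three sums vanish for one reason: \<open>\<mu> i\<close>,
  \<open>t i * \<mu> i\<close> and \<open>d i * (\<mu> i)^2\<close> are the values at
  \<open>sg i\<close> of linear forms (\<open>m\<close>, -2 times the diagonal of \<open>g\<close>,
  4 times its principal minors), and the four sign vectors add up to zero. The last equation uses
  that the principal minors are both a left kernel vector of \<open>g\<close> and the equation of
  the line. The relation has to hold at every map where its coefficients are defined, not just
  generically. Hence polynomial functions, which can be evaluated anywhere, take the place of field
  extensions: the linear dependence among five elements of a module of rank four is found without
  division, and degenerate spectral data are absorbed by a factor \<open>generic\<close> in the
  denominators. The parameters \<open>r\<close>, \<open>al\<close>, \<open>be\<close> keep the chart
  and the symmetrised denominator nondegenerate; they are specialised only after the relation is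
  known to hold identically in them. For independence, only the shape of the relation is used: monic
  with rational coefficients. At fixed \<open>b\<close> its roots are bounded, and \<open>b\<close>
  is perturbed off the poles of the coefficients.\<close>

lemma sum3: "(\<Sum>j<3. f j) = f 0 + f 1 + f (2::nat)"
  by (simp add: eval_nat_numeral)

lemma sum4: "(\<Sum>i<4. f i) = f 0 + f 1 + f 2 + f (3::nat)"
  by (simp add: eval_nat_numeral)

lemma polyfun_mono: "p \<in> polyfun n \<Longrightarrow> n \<le> m \<Longrightarrow> p \<in> polyfun m"
  by (induction rule: polyfun.induct) (auto intro: polyfun.intros)

lemma polyfun_uminus: "p \<in> polyfun n \<Longrightarrow> (\<lambda>x. - p x) \<in> polyfun n"
  using polyfun.mult[OF polyfun.const[of "-1"]] by fastforce

lemma polyfun_diff: "p \<in> polyfun n \<Longrightarrow> q \<in> polyfun n \<Longrightarrow> (\<lambda>x. p x - q x) \<in> polyfun n"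
  using polyfun.add[OF _ polyfun_uminus] by fastforce

lemma polyfun_power: "p \<in> polyfun n \<Longrightarrow> (\<lambda>x. p x ^ k) \<in> polyfun n"
  by (induction k) (auto intro: polyfun.intros)

lemma polyfun_sum:
  "finite J \<Longrightarrow> (\<And>j. j \<in> J \<Longrightarrow> f j \<in> polyfun n) \<Longrightarrow> (\<lambda>x. \<Sum>j\<in>J. f j x) \<in> polyfun n"
  by (induction J rule: finite_induct) (auto intro: polyfun.intros)

lemma polyfun_prod:
  "finite J \<Longrightarrow> (\<And>j. j \<in> J \<Longrightarrow> f j \<in> polyfun n) \<Longrightarrow> (\<lambda>x. \<Prod>j\<in>J. f j x) \<in> polyfun n"
  by (induction J rule: finite_induct) (auto intro: polyfun.intros)

lemma polyfun_divide_const: "p \<in> polyfun n \<Longrightarrow> (\<lambda>x. p x / c) \<in> polyfun n"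
  using polyfun.mult[OF _ polyfun.const[of "inverse c"], of p n] by (simp add: field_simps)

lemmas polyfun_intros = polyfun.intros polyfun_uminus polyfun_diff polyfun_power
  polyfun_divide_const

lemma polyfun_cong: "p \<in> polyfun n \<Longrightarrow> (\<And>i. i < n \<Longrightarrow> x i = y i) \<Longrightarrow> p x = p y"
  by (induction rule: polyfun.induct) auto

lemma polyfun_compose:
  "p \<in> polyfun n \<Longrightarrow> (\<And>i. i < n \<Longrightarrow> (\<lambda>x. f x i) \<in> polyfun m) \<Longrightarrow> (\<lambda>x. p (f x)) \<in> polyfun m"
  by (induction rule: polyfun.induct) (auto intro: polyfun.intros)

text \<open>Restriction to a line gives a univariate \<open>poly\<close>, for which being nonzero
  means having finitely many zeros. The absence of zero divisors and the density of nonzeros both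
  reduce to this.\<close>

lemma polyfun_line: "p \<in> polyfun n \<Longrightarrow> \<exists>P. \<forall>s. p (\<lambda>i. x i + s * (y i - x i)) = poly P s"
proof (induction rule: polyfun.induct)
  case (const c)
  show ?case by (rule exI[of _ "[:c:]"]) simp
next
  case (var i)
  show ?case by (rule exI[of _ "[:x i, y i - x i:]"]) simp
next
  case (add p q)
  then obtain P Q where "\<forall>s. p (\<lambda>i. x i + s * (y i - x i)) = poly P s"
    "\<forall>s. q (\<lambda>i. x i + s * (y i - x i)) = poly Q s" by blast
  then show ?case by (intro exI[of _ "P + Q"]) simp
next
  case (mult p q)
  then obtain P Q where "\<forall>s. p (\<lambda>i. x i + s * (y i - x i)) = poly P s"
    "\<forall>s. q (\<lambda>i. x i + s * (y i - x i)) = poly Q s" by blast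
  then show ?case by (intro exI[of _ "P * Q"]) simp
qed

lemma polyfun_no_zero_divisors:
  assumes "p \<in> polyfun n" "q \<in> polyfun n" "p x \<noteq> 0" "q y \<noteq> 0"
  shows "\<exists>z. p z * q z \<noteq> 0"
proof -
  obtain P Q where P: "\<forall>s. p (\<lambda>i. x i + s * (y i - x i)) = poly P s"
    and Q: "\<forall>s. q (\<lambda>i. x i + s * (y i - x i)) = poly Q s"
    using polyfun_line assms(1,2) by meson
  have "poly P 0 \<noteq> 0" "poly Q 1 \<noteq> 0"
    using P[rule_format, of 0] Q[rule_format, of 1] assms(3,4) by simp_all
  then have "P * Q \<noteq> 0" by auto
  then obtain s where "poly (P * Q) s \<noteq> 0"
    using poly_all_0_iff_0 by blast
  then have "p (\<lambda>i. x i + s * (y i - x i)) * q (\<lambda>i. x i + s * (y i - x i)) \<noteq> 0"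
    using P Q by simp
  then show ?thesis by (rule exI[where x = "\<lambda>i. x i + s * (y i - x i)"])
qed

lemma polyfun_prod_nonzero:
  assumes "finite J" "\<And>j. j \<in> J \<Longrightarrow> f j \<in> polyfun n" "\<And>j. j \<in> J \<Longrightarrow> \<exists>x. f j x \<noteq> 0"
  shows "\<exists>x. (\<Prod>j\<in>J. f j x) \<noteq> 0"
  using assms
proof (induction J rule: finite_induct)
  case empty
  then show ?case by simp
next
  case (insert j J)
  then obtain x y where "f j x \<noteq> 0" "(\<Prod>j\<in>J. f j y) \<noteq> 0" by (metis insertCI)
  moreover have "(\<lambda>x. \<Prod>j\<in>J. f j x) \<in> polyfun n" using insert by (intro polyfun_prod) auto
  ultimately obtain z where "f j z * (\<Prod>j\<in>J. f j z) \<noteq> 0"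
    using polyfun_no_zero_divisors[of "f j" n "\<lambda>x. \<Prod>j\<in>J. f j x" x y] insert.prems by auto
  then show ?case using insert by auto
qed

text \<open>Fraction-free Gaussian elimination over the integral domain of polynomial functions.\<close>

lemma polyfun_dependent:
  assumes "finite J" "card J = Suc N" "\<And>j i. j \<in> J \<Longrightarrow> i < N \<Longrightarrow> f j i \<in> polyfun n"
  shows "\<exists>\<beta>. (\<forall>j\<in>J. \<beta> j \<in> polyfun n) \<and> (\<exists>j\<in>J. \<exists>x. \<beta> j x \<noteq> 0) \<and>
           (\<forall>i<N. \<forall>x. (\<Sum>j\<in>J. \<beta> j x * f j i x) = 0)"
  using assms
proof (induction N arbitrary: J f)
  case 0
  then have "J \<noteq> {}" by auto
  then show ?case by (intro exI[of _ "\<lambda>_ _. 1"]) (auto intro: polyfun.intros)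
next
  case (Suc N)
  show ?case
  proof (cases "\<exists>j0\<in>J. \<exists>x. f j0 N x \<noteq> 0")
    \<comment> \<open>Column \<open>N\<close> is identically zero and imposes no condition, so any
      one row may be dropped and given coefficient 0.\<close>
    case False
    obtain j0 where j0: "j0 \<in> J" using Suc.prems by fastforce
    have c: "card (J - {j0}) = Suc N" "finite (J - {j0})" using Suc.prems j0 by auto
    obtain \<beta> where \<beta>: "\<forall>j\<in>J - {j0}. \<beta> j \<in> polyfun n" "\<exists>j\<in>J - {j0}. \<exists>x. \<beta> j x \<noteq> 0"
      "\<forall>i<N. \<forall>x. (\<Sum>j\<in>J - {j0}. \<beta> j x * f j i x) = 0"
      using Suc.IH[OF c(2,1), of f] Suc.prems by auto
    define \<beta>' where "\<beta>' = \<beta>(j0 := \<lambda>_. 0)"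
    have "(\<Sum>j\<in>J. \<beta>' j x * f j i x) = (\<Sum>j\<in>J - {j0}. \<beta> j x * f j i x)" for i x
      using Suc.prems(1) j0 by (simp add: sum.remove[of J j0] \<beta>'_def)
    moreover have "(\<Sum>j\<in>J. \<beta>' j x * f j N x) = 0" for x using False by (intro sum.neutral) auto
    ultimately have "\<forall>i<Suc N. \<forall>x. (\<Sum>j\<in>J. \<beta>' j x * f j i x) = 0"
      using \<beta>(3) by (simp add: less_Suc_eq)
    moreover have "\<forall>j\<in>J. \<beta>' j \<in> polyfun n" using \<beta>(1) by (auto simp: \<beta>'_def intro: polyfun.intros)
    moreover have "\<exists>j\<in>J. \<exists>x. \<beta>' j x \<noteq> 0" using \<beta>(2) by (auto simp: \<beta>'_def)
    ultimately show ?thesis by blast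
  next
    case True
    then obtain j0 x0 where j0: "j0 \<in> J" "f j0 N x0 \<noteq> 0" by blast
    have c: "card (J - {j0}) = Suc N" "finite (J - {j0})" using Suc.prems j0 by auto
    define f' where "f' = (\<lambda>j i x. f j0 N x * f j i x - f j N x * f j0 i x)"
    have "f' j i \<in> polyfun n" if "j \<in> J - {j0}" "i < N" for i j
      using that Suc.prems(3) j0 unfolding f'_def by (intro polyfun_intros) auto
    from Suc.IH[where J = "J - {j0}" and f = f', OF c(2,1) this] obtain \<beta> where \<beta>: "\<forall>j\<in>J - {j0}. \<beta> j \<in> polyfun n"
      "\<exists>j\<in>J - {j0}. \<exists>x. \<beta> j x \<noteq> 0" "\<forall>i<N. \<forall>x. (\<Sum>j\<in>J - {j0}. \<beta> j x * f' j i x) = 0" by blast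
    \<comment> \<open>Undoes the elimination: \<open>f'\<close> is the pivot times row
      \<open>j\<close> minus a multiple of row \<open>j0\<close>, so the other coefficients gain the
      pivot as a factor and row \<open>j0\<close> receives the collected multiples.\<close>
    define \<beta>' where "\<beta>' = (\<lambda>j x. if j = j0 then - (\<Sum>j\<in>J - {j0}. \<beta> j x * f j N x)
                              else \<beta> j x * f j0 N x)"
    have pN: "f j N \<in> polyfun n" if "j \<in> J" for j using Suc.prems(3) that by auto
    have "\<forall>j\<in>J. \<beta>' j \<in> polyfun n"
    proof
      fix j assume j: "j \<in> J"
      show "\<beta>' j \<in> polyfun n"
      proof (cases "j = j0")
        case True
        have "(\<lambda>x. - (\<Sum>j\<in>J - {j0}. \<beta> j x * f j N x)) \<in> polyfun n"
          using \<beta>(1) pN c(2) by (intro polyfun_uminus polyfun_sum polyfun.mult) auto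
        then show ?thesis unfolding \<beta>'_def using True by simp
      next
        case False
        then have "(\<lambda>x. \<beta> j x * f j0 N x) \<in> polyfun n"
          using \<beta>(1) pN j j0 by (intro polyfun.mult) auto
        then show ?thesis unfolding \<beta>'_def using False by simp
      qed
    qed
    moreover have "\<exists>j\<in>J. \<exists>x. \<beta>' j x \<noteq> 0"
    proof -
      obtain j x where j: "j \<in> J - {j0}" "\<beta> j x \<noteq> 0" using \<beta>(2) by blast
      then obtain z where "\<beta> j z * f j0 N z \<noteq> 0"
        using polyfun_no_zero_divisors[OF _ pN[OF j0(1)] _ j0(2)] \<beta>(1) by blast
      then have "\<beta>' j z \<noteq> 0" using j by (simp add: \<beta>'_def)
      then show ?thesis using j by blast
    qed
    moreover have eq: "(\<Sum>j\<in>J. \<beta>' j x * f j i x) = (\<Sum>j\<in>J - {j0}. \<beta> j x * f' j i x)" for i x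
    proof -
      have "(\<Sum>j\<in>J. \<beta>' j x * f j i x) = \<beta>' j0 x * f j0 i x + (\<Sum>j\<in>J - {j0}. \<beta>' j x * f j i x)"
        using Suc.prems(1) j0 by (simp add: sum.remove)
      also have "(\<Sum>j\<in>J - {j0}. \<beta>' j x * f j i x) = (\<Sum>j\<in>J - {j0}. \<beta> j x * f j0 N x * f j i x)"
        by (intro sum.cong) (auto simp: \<beta>'_def)
      also have "\<beta>' j0 x * f j0 i x = (\<Sum>j\<in>J - {j0}. - (\<beta> j x * f j N x * f j0 i x))"
        by (simp add: \<beta>'_def sum_negf sum_distrib_right)
      also have "(\<Sum>j\<in>J - {j0}. - (\<beta> j x * f j N x * f j0 i x)) + (\<Sum>j\<in>J - {j0}. \<beta> j x * f j0 N x * f j i x)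
        = (\<Sum>j\<in>J - {j0}. \<beta> j x * f' j i x)"
        unfolding sum.distrib[symmetric] f'_def by (intro sum.cong) (auto simp: algebra_simps)
      finally show ?thesis .
    qed
    moreover have eqN: "(\<Sum>j\<in>J - {j0}. \<beta> j x * f' j N x) = 0" for x by (simp add: f'_def)
    ultimately have "\<forall>i<Suc N. \<forall>x. (\<Sum>j\<in>J. \<beta>' j x * f j i x) = 0"
    proof (intro allI impI)
      fix i x assume "i < Suc N"
      then consider "i < N" | "i = N" by linarith
      then show "(\<Sum>j\<in>J. \<beta>' j x * f j i x) = 0"
        by cases (simp_all only: eq eqN \<beta>(3)[rule_format])
    qed
    then show ?thesis using \<open>\<forall>j\<in>J. \<beta>' j \<in> polyfun n\<close> \<open>\<exists>j\<in>J. \<exists>x. \<beta>' j x \<noteq> 0\<close> by blast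
  qed
qed

text \<open>Division with remainder by a quadratic in the last variable; as the quadratic is monic,
  no denominators arise.\<close>

lemma polyfun_reduce_quadratic:
  assumes "p \<in> polyfun (Suc n)" "e1 \<in> polyfun n" "e0 \<in> polyfun n"
  shows "\<exists>f\<in>polyfun n. \<exists>g\<in>polyfun n. \<forall>x. x n ^ 2 + e1 x * x n + e0 x = 0 \<longrightarrow> p x = f x + g x * x n"
  using assms(1)
proof (induction rule: polyfun.induct)
  case (const c)
  show ?case by (rule bexI[of _ "\<lambda>_. c"], rule bexI[of _ "\<lambda>_. 0"]) (auto intro: polyfun.intros)
next
  case (var i)
  show ?case
  proof (cases "i = n")
    case True
    show ?thesis unfolding True
      by (rule bexI[of _ "\<lambda>_. 0"], rule bexI[of _ "\<lambda>_. 1"]) (auto intro: polyfun.intros)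
  next
    case False
    with var have "i < n" by simp
    then show ?thesis
      by (intro bexI[of _ "\<lambda>x. x i"] bexI[of _ "\<lambda>_. 0"]) (auto intro: polyfun.intros)
  qed
next
  case (add p q)
  then obtain f g f' g' where *: "f \<in> polyfun n" "g \<in> polyfun n" "f' \<in> polyfun n" "g' \<in> polyfun n"
    "\<forall>x. x n ^ 2 + e1 x * x n + e0 x = 0 \<longrightarrow> p x = f x + g x * x n"
    "\<forall>x. x n ^ 2 + e1 x * x n + e0 x = 0 \<longrightarrow> q x = f' x + g' x * x n" by blast
  then show ?case
    by (intro bexI[of _ "\<lambda>x. f x + f' x"] bexI[of _ "\<lambda>x. g x + g' x"])
       (auto intro: polyfun.intros simp: algebra_simps)
next
  case (mult p q)
  then obtain f g f' g' where *: "f \<in> polyfun n" "g \<in> polyfun n" "f' \<in> polyfun n" "g' \<in> polyfun n"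
    "\<forall>x. x n ^ 2 + e1 x * x n + e0 x = 0 \<longrightarrow> p x = f x + g x * x n"
    "\<forall>x. x n ^ 2 + e1 x * x n + e0 x = 0 \<longrightarrow> q x = f' x + g' x * x n" by blast
  have "p x * q x = (f x * f' x - g x * g' x * e0 x) + (f x * g' x + g x * f' x - g x * g' x * e1 x) * x n"
    if "x n ^ 2 + e1 x * x n + e0 x = 0" for x
  proof -
    have "p x = f x + g x * x n" "q x = f' x + g' x * x n" using that * by auto
    then show ?thesis using that by algebra
  qed
  with * show ?case using assms(2,3)
    by (intro bexI[of _ "\<lambda>x. f x * f' x - g x * g' x * e0 x"]
        bexI[of _ "\<lambda>x. f x * g' x + g x * f' x - g x * g' x * e1 x"])
       (auto intro!: polyfun_intros)
qed

lemma polyfun_rational_subst: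
  assumes "p \<in> polyfun N" "\<And>i. i < N \<Longrightarrow> num i \<in> polyfun M" "d \<in> polyfun M"
  shows "\<exists>D. \<exists>R\<in>polyfun M. \<forall>x. d x \<noteq> 0 \<longrightarrow> d x ^ D * p (\<lambda>i. num i x / d x) = R x"
  using assms(1)
proof (induction rule: polyfun.induct)
  case (const c)
  show ?case by (intro exI[of _ 0] bexI[of _ "\<lambda>_. c"]) (auto intro: polyfun.intros)
next
  case (var i)
  then show ?case using assms(2) by (intro exI[of _ 1] bexI[of _ "num i"]) auto
next
  case (add p q)
  then obtain D R D' R' where *: "R \<in> polyfun M" "R' \<in> polyfun M"
    "\<forall>x. d x \<noteq> 0 \<longrightarrow> d x ^ D * p (\<lambda>i. num i x / d x) = R x"
    "\<forall>x. d x \<noteq> 0 \<longrightarrow> d x ^ D' * q (\<lambda>i. num i x / d x) = R' x" by blast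
  have "d x ^ (D + D') * (p (\<lambda>i. num i x / d x) + q (\<lambda>i. num i x / d x)) = d x ^ D' * R x + d x ^ D * R' x"
    if "d x \<noteq> 0" for x
  proof -
    have "R x = d x ^ D * p (\<lambda>i. num i x / d x)" "R' x = d x ^ D' * q (\<lambda>i. num i x / d x)"
      using * that by auto
    then show ?thesis by (simp add: power_add algebra_simps)
  qed
  then show ?case using * assms(3)
    by (intro exI[of _ "D + D'"] bexI[of _ "\<lambda>x. d x ^ D' * R x + d x ^ D * R' x"])
       (auto intro!: polyfun_intros)
next
  case (mult p q)
  then obtain D R D' R' where *: "R \<in> polyfun M" "R' \<in> polyfun M"
    "\<forall>x. d x \<noteq> 0 \<longrightarrow> d x ^ D * p (\<lambda>i. num i x / d x) = R x"
    "\<forall>x. d x \<noteq> 0 \<longrightarrow> d x ^ D' * q (\<lambda>i. num i x / d x) = R' x" by blast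
  have "d x ^ (D + D') * (p (\<lambda>i. num i x / d x) * q (\<lambda>i. num i x / d x)) = R x * R' x"
    if "d x \<noteq> 0" for x
  proof -
    have "R x = d x ^ D * p (\<lambda>i. num i x / d x)" "R' x = d x ^ D' * q (\<lambda>i. num i x / d x)"
      using * that by auto
    then show ?thesis by (simp add: power_add)
  qed
  then show ?case using *
    by (intro exI[of _ "D + D'"] bexI[of _ "\<lambda>x. R x * R' x"]) (auto intro!: polyfun_intros)
qed

subsection \<open>Symmetrising over the roots of a cubic\<close>

text \<open>Vieta's formulas say that the cubic equals
  \<open>k3 * (z - z0) * (z - z1) * (z - z2)\<close>.\<close>

definition roots3 :: "complex \<Rightarrow> complex \<Rightarrow> complex \<Rightarrow> complex \<Rightarrow> complex \<Rightarrow> complex \<Rightarrow> complex \<Rightarrow> bool" where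
  "roots3 k3 k2 k1 k0 z0 z1 z2 \<longleftrightarrow>
     k2 = - k3 * (z0 + z1 + z2) \<and> k1 = k3 * (z0 * z1 + z0 * z2 + z1 * z2) \<and> k0 = - k3 * (z0 * z1 * z2)"

lemma newton_two:
  assumes "roots3 k3 k2 k1 k0 a b c"
  shows "k3\<^sup>2 * (a\<^sup>2 + b\<^sup>2 + c\<^sup>2) = k2 * k2 - 2 * (k3 * k1)"
proof -
  have "k3\<^sup>2 * (a\<^sup>2 + b\<^sup>2 + c\<^sup>2)
    = (- k3 * (a + b + c)) * (- k3 * (a + b + c)) - 2 * (k3 * (k3 * (a * b + a * c + b * c)))"
    by (simp add: power2_eq_square algebra_simps)
  then show ?thesis using assms by (simp add: roots3_def)
qed

lemma newton_step:
  assumes "roots3 k3 k2 k1 k0 a b c"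
  shows "k3 * (a ^ (m + 3) + b ^ (m + 3) + c ^ (m + 3)) = - (k2 * (a ^ (m + 2) + b ^ (m + 2) + c ^ (m + 2))
    + k1 * (a ^ (m + 1) + b ^ (m + 1) + c ^ (m + 1)) + k0 * (a ^ m + b ^ m + c ^ m))"
proof -
  have "k3 * z ^ (m + 3) = - (k2 * z ^ (m + 2) + k1 * z ^ (m + 1) + k0 * z ^ m)" if "z \<in> {a, b, c}" for z
  proof -
    have "(z - a) * (z - b) * (z - c) = 0" using that by auto
    then have "z ^ m * (k3 * z ^ 3 + k2 * z\<^sup>2 + k1 * z + k0) = 0"
      using assms unfolding roots3_def by (intro mult_eq_0_iff[THEN iffD2] disjI2) algebra
    then show ?thesis by (simp add: power_add power2_eq_square algebra_simps eq_neg_iff_add_eq_0)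
  qed
  note * = this[of a, simplified insert_iff simp_thms] this[of b, simplified insert_iff simp_thms]
    this[of c, simplified insert_iff simp_thms]
  show ?thesis by (simp only: distrib_left *) (simp add: distrib_left)
qed

text \<open>Polynomials in the last three variables over the first \<open>n\<close>, as sums of
  monomials, so that symmetrisation can be treated one monomial at a time.\<close>

inductive_set monspan :: "nat \<Rightarrow> ((nat \<Rightarrow> complex) \<Rightarrow> complex) set" for n where
  monom: "c \<in> polyfun n \<Longrightarrow> (\<lambda>x. c x * x n ^ i * x (n + 1) ^ j * x (n + 2) ^ l) \<in> monspan n"
| add: "p \<in> monspan n \<Longrightarrow> q \<in> monspan n \<Longrightarrow> (\<lambda>x. p x + q x) \<in> monspan n"

lemma monspan_mult: "p \<in> monspan n \<Longrightarrow> q \<in> monspan n \<Longrightarrow> (\<lambda>x. p x * q x) \<in> monspan n"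
proof (induction rule: monspan.induct)
  case (monom c i j l)
  from monom(2,1) show ?case
  proof (induction rule: monspan.induct)
    case (monom c' i' j' l')
    have "(\<lambda>x. (c x * c' x) * x n ^ (i + i') * x (n + 1) ^ (j + j') * x (n + 2) ^ (l + l')) \<in> monspan n"
      using monom by (intro monspan.monom polyfun.mult)
    then show ?case by (simp add: power_add mult_ac)
  next
    case (add p q)
    then show ?case by (auto simp: distrib_left intro: monspan.add)
  qed
next
  case (add p q)
  then show ?case by (auto simp: distrib_right intro: monspan.add)
qed

lemma polyfun_monspan: "p \<in> polyfun (n + 3) \<Longrightarrow> p \<in> monspan n"
proof (induction rule: polyfun.induct)
  case (const c)
  show ?case using monspan.monom[OF polyfun.const, of c n 0 0 0] by simp
next
  case (var i)
  consider "i < n" | "i = n" | "i = n + 1" | "i = n + 2" using var by linarith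
  then show ?case
  proof cases
    case 1
    then show ?thesis using monspan.monom[OF polyfun.var, of i n 0 0 0] by simp
  next
    case 2
    then show ?thesis using monspan.monom[OF polyfun.const, of 1 n 1 0 0] by simp
  next
    case 3
    then show ?thesis using monspan.monom[OF polyfun.const, of 1 n 0 1 0] by simp
  next
    case 4
    then show ?thesis using monspan.monom[OF polyfun.const, of 1 n 0 0 1] by simp
  qed
qed (auto intro: monspan.add monspan_mult)

definition set3 :: "nat \<Rightarrow> (nat \<Rightarrow> complex) \<Rightarrow> complex \<Rightarrow> complex \<Rightarrow> complex \<Rightarrow> nat \<Rightarrow> complex" where
  "set3 n x a b c = x(n := a, n + 1 := b, n + 2 := c)"

definition symsum :: "nat \<Rightarrow> ((nat \<Rightarrow> complex) \<Rightarrow> complex) \<Rightarrow> (nat \<Rightarrow> complex) \<Rightarrow> complex \<Rightarrow> complex \<Rightarrow> complex \<Rightarrow> complex" where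
  "symsum n p x a b c = p (set3 n x a b c) + p (set3 n x a c b) + p (set3 n x b a c)
     + p (set3 n x b c a) + p (set3 n x c a b) + p (set3 n x c b a)"

lemma polyfun_set3: "p \<in> polyfun n \<Longrightarrow> p (set3 n x a b c) = p x"
  by (rule polyfun_cong) (auto simp: set3_def)

text \<open>Inclusion-exclusion: the product of three power sums runs over all triples of roots;
  triples with two coinciding entries are subtracted, which removes those with three equal entries
  too often, and these are restored twice.\<close>

lemma symmetrise_monomial:
  fixes q ai bi ci aj bj cj al bl cl :: complex
  shows "q * ai * bj * cl + q * ai * cj * bl + q * bi * aj * cl + q * bi * cj * al
      + q * ci * aj * bl + q * ci * bj * al
    = q * ((ai + bi + ci) * (aj + bj + cj) * (al + bl + cl) - (ai * aj + bi * bj + ci * cj) * (al + bl + cl)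
      - (ai * al + bi * bl + ci * cl) * (aj + bj + cj) - (aj * al + bj * bl + cj * cl) * (ai + bi + ci)
      + 2 * (ai * aj * al + bi * bj * bl + ci * cj * cl))"
  by (simp add: distrib_left distrib_right right_diff_distrib left_diff_distrib mult_ac)

context
  fixes n :: nat and k3 k2 k1 k0 :: "(nat \<Rightarrow> complex) \<Rightarrow> complex"
  assumes k: "k3 \<in> polyfun n" "k2 \<in> polyfun n" "k1 \<in> polyfun n" "k0 \<in> polyfun n"
begin

text \<open>The power of \<open>k3\<close>, uniform in the point and the roots, stands for division
  by the leading coefficient, so that \<open>T\<close> stays a polynomial.\<close>

definition vieta_fun :: "((nat \<Rightarrow> complex) \<Rightarrow> complex \<Rightarrow> complex \<Rightarrow> complex \<Rightarrow> complex) \<Rightarrow> bool" where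
  "vieta_fun \<phi> \<longleftrightarrow> (\<exists>D. \<exists>T\<in>polyfun n. \<forall>x a b c. roots3 (k3 x) (k2 x) (k1 x) (k0 x) a b c
      \<longrightarrow> k3 x ^ D * \<phi> x a b c = T x)"

lemma vieta_fun_poly: "p \<in> polyfun n \<Longrightarrow> vieta_fun (\<lambda>x a b c. p x)"
  unfolding vieta_fun_def by (intro exI[of _ 0] bexI[of _ p]) auto

lemma vieta_fun_add:
  assumes "vieta_fun \<phi>" "vieta_fun \<psi>" shows "vieta_fun (\<lambda>x a b c. \<phi> x a b c + \<psi> x a b c)"
proof -
  obtain D T D' T' where *: "T \<in> polyfun n" "T' \<in> polyfun n"
   "\<forall>x a b c. roots3 (k3 x) (k2 x) (k1 x) (k0 x) a b c \<longrightarrow> k3 x ^ D * \<phi> x a b c = T x"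
   "\<forall>x a b c. roots3 (k3 x) (k2 x) (k1 x) (k0 x) a b c \<longrightarrow> k3 x ^ D' * \<psi> x a b c = T' x"
    using assms unfolding vieta_fun_def by blast
  have "k3 x ^ (D + D') * (\<phi> x a b c + \<psi> x a b c) = k3 x ^ D' * T x + k3 x ^ D * T' x"
    if "roots3 (k3 x) (k2 x) (k1 x) (k0 x) a b c" for x a b c
  proof -
    have "T x = k3 x ^ D * \<phi> x a b c" "T' x = k3 x ^ D' * \<psi> x a b c" using * that by auto
    then show ?thesis by (simp add: power_add algebra_simps)
  qed
  then show ?thesis unfolding vieta_fun_def using * k
    by (intro exI[of _ "D + D'"] bexI[of _ "\<lambda>x. k3 x ^ D' * T x + k3 x ^ D * T' x"])
       (auto intro!: polyfun_intros)
qed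

lemma vieta_fun_mult:
  assumes "vieta_fun \<phi>" "vieta_fun \<psi>" shows "vieta_fun (\<lambda>x a b c. \<phi> x a b c * \<psi> x a b c)"
proof -
  obtain D T D' T' where *: "T \<in> polyfun n" "T' \<in> polyfun n"
   "\<forall>x a b c. roots3 (k3 x) (k2 x) (k1 x) (k0 x) a b c \<longrightarrow> k3 x ^ D * \<phi> x a b c = T x"
   "\<forall>x a b c. roots3 (k3 x) (k2 x) (k1 x) (k0 x) a b c \<longrightarrow> k3 x ^ D' * \<psi> x a b c = T' x"
    using assms unfolding vieta_fun_def by blast
  have "k3 x ^ (D + D') * (\<phi> x a b c * \<psi> x a b c) = T x * T' x"
    if "roots3 (k3 x) (k2 x) (k1 x) (k0 x) a b c" for x a b c
  proof -
    have "T x = k3 x ^ D * \<phi> x a b c" "T' x = k3 x ^ D' * \<psi> x a b c" using * that by auto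
    then show ?thesis by (simp add: power_add)
  qed
  then show ?thesis unfolding vieta_fun_def using *
    by (intro exI[of _ "D + D'"] bexI[of _ "\<lambda>x. T x * T' x"]) (auto intro!: polyfun_intros)
qed

lemma vieta_fun_diff:
  assumes "vieta_fun \<phi>" "vieta_fun \<psi>" shows "vieta_fun (\<lambda>x a b c. \<phi> x a b c - \<psi> x a b c)"
  using vieta_fun_add[OF assms(1) vieta_fun_mult[OF vieta_fun_poly[OF polyfun.const[of "-1"]] assms(2)]]
  by simp

lemma vieta_fun_cancel:
  assumes "vieta_fun \<psi>"
    and "\<And>x a b c. roots3 (k3 x) (k2 x) (k1 x) (k0 x) a b c \<Longrightarrow> k3 x ^ D * \<phi> x a b c = \<psi> x a b c"
  shows "vieta_fun \<phi>"
proof -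
  obtain D' T where *: "T \<in> polyfun n"
   "\<forall>x a b c. roots3 (k3 x) (k2 x) (k1 x) (k0 x) a b c \<longrightarrow> k3 x ^ D' * \<psi> x a b c = T x"
    using assms(1) unfolding vieta_fun_def by blast
  have "k3 x ^ (D' + D) * \<phi> x a b c = T x" if "roots3 (k3 x) (k2 x) (k1 x) (k0 x) a b c" for x a b c
    using * assms(2) that by (simp add: power_add mult.assoc)
  then show ?thesis using * unfolding vieta_fun_def by blast
qed

text \<open>Newton's identities: three initial cases and a recursion of order three.\<close>

lemma vieta_fun_power_sum: "vieta_fun (\<lambda>x a b c. a ^ i + b ^ i + c ^ i)"
proof (induction i rule: less_induct)
  case (less i)
  note kp = k[THEN vieta_fun_poly]
  consider "i = 0" | "i = 1" | "i = 2" | m where "i = m + 3"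
    by atomize_elim presburger
  then show ?case
  proof cases
    case 1
    then show ?thesis using vieta_fun_poly[OF polyfun.const[of 3]] by simp
  next
    case 2
    show ?thesis
      by (rule vieta_fun_cancel[of "\<lambda>x a b c. - k2 x" 1])
         (auto simp: 2 roots3_def intro!: vieta_fun_poly polyfun_uminus k)
  next
    case 3
    show ?thesis
      by (rule vieta_fun_cancel[of "\<lambda>x a b c. k2 x * k2 x - 2 * (k3 x * k1 x)" 2])
         (intro vieta_fun_mult vieta_fun_diff kp vieta_fun_poly polyfun.const, unfold 3, rule newton_two)
  next
    case 4
    define s where "s = (\<lambda>i (x :: nat \<Rightarrow> complex) (a :: complex) b c. a ^ i + b ^ i + c ^ i)"
    have s: "vieta_fun (s (m + 2))" "vieta_fun (s (m + 1))" "vieta_fun (s m)"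
      using 4 by (auto simp only: s_def intro!: less)
    have "vieta_fun (\<lambda>x a b c. (-1) * (k2 x * s (m + 2) x a b c + k1 x * s (m + 1) x a b c + k0 x * s m x a b c))"
      by (intro vieta_fun_mult vieta_fun_add kp vieta_fun_poly polyfun.const s)
    then show ?thesis
      by (rule vieta_fun_cancel[of _ 1]) (unfold s_def 4 power_one_right, drule newton_step[of _ _ _ _ _ _ _ m], simp only: mult_minus1)
  qed
qed

lemma vieta_fun_symsum:
  assumes "p \<in> polyfun (n + 3)"
  shows "vieta_fun (symsum n p)"
  using polyfun_monspan[OF assms]
proof (induction rule: monspan.induct)
  case (monom q i j l)
  define s where "s = (\<lambda>(i::nat) (x::nat \<Rightarrow> complex) (a::complex) b c. a ^ i + b ^ i + c ^ i)"
  have s: "vieta_fun (\<lambda>x a b c. s i x a b c)" for i unfolding s_def by (rule vieta_fun_power_sum)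
  have q: "q (x(n := a, Suc n := b, Suc (Suc n) := c)) = q x" for x a b c
    using polyfun_set3[OF monom, of x a b c] by (simp add: set3_def)
  have "symsum n (\<lambda>x. q x * x n ^ i * x (n + 1) ^ j * x (n + 2) ^ l) x a b c
    = q x * (s i x a b c * s j x a b c * s l x a b c - s (i + j) x a b c * s l x a b c
      - s (i + l) x a b c * s j x a b c - s (j + l) x a b c * s i x a b c + 2 * s (i + j + l) x a b c)"
    for x a b c
  proof -
    have "symsum n (\<lambda>x. q x * x n ^ i * x (n + 1) ^ j * x (n + 2) ^ l) x a b c
      = q x * a ^ i * b ^ j * c ^ l + q x * a ^ i * c ^ j * b ^ l + q x * b ^ i * a ^ j * c ^ l
      + q x * b ^ i * c ^ j * a ^ l + q x * c ^ i * a ^ j * b ^ l + q x * c ^ i * b ^ j * a ^ l"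
      by (simp add: symsum_def set3_def q)
    then show ?thesis unfolding s_def power_add symmetrise_monomial .
  qed
  then have "symsum n (\<lambda>x. q x * x n ^ i * x (n + 1) ^ j * x (n + 2) ^ l)
    = (\<lambda>x a b c. q x * (s i x a b c * s j x a b c * s l x a b c - s (i + j) x a b c * s l x a b c
      - s (i + l) x a b c * s j x a b c - s (j + l) x a b c * s i x a b c + 2 * s (i + j + l) x a b c))"
    by (intro ext)
  then show ?case
    by (simp only:) (intro vieta_fun_mult vieta_fun_add vieta_fun_diff s vieta_fun_poly monom polyfun.const)
next
  case (add p q)
  have "symsum n (\<lambda>x. p x + q x) = (\<lambda>x a b c. symsum n p x a b c + symsum n q x a b c)"
    by (intro ext) (simp add: symsum_def)
  then show ?case using vieta_fun_add[OF add.IH] by simp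
qed

end

subsection \<open>Elimination\<close>

lemma polyfun_poly: "i < n \<Longrightarrow> (\<lambda>x. poly P (x i)) \<in> polyfun n"
proof (induction P)
  case 0
  show ?case using polyfun.const[of 0] by simp
next
  case (pCons a P)
  then show ?case by (auto intro!: polyfun.intros)
qed

text \<open>Layout of the variables: the spectral data \<open>b\<close> have indices 0 to 7, the chart parameter is 8, two
  auxiliary parameters are 9 and 10, the unknowns of the two quadratic equations are 11 and 12, and the
  roots of the cubic equation are 13, 14 and 15.\<close>

definition params :: "(nat \<Rightarrow> complex) \<Rightarrow> complex \<Rightarrow> complex \<Rightarrow> complex \<Rightarrow> complex \<Rightarrow> complex \<Rightarrow> nat \<Rightarrow> complex" where
  "params b r al be y1 y2 = (\<lambda>i. if i < 8 then b i else if i = 8 then r else if i = 9 then al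
     else if i = 10 then be else if i = 11 then y1 else y2)"

definition spec_at :: "((nat \<Rightarrow> complex) \<Rightarrow> complex) \<Rightarrow> ((nat \<Rightarrow> complex) \<Rightarrow> complex) \<Rightarrow> ((nat \<Rightarrow> complex) \<Rightarrow> complex)
    \<Rightarrow> (nat \<Rightarrow> complex) \<Rightarrow> (nat \<Rightarrow> complex) \<Rightarrow> nat \<Rightarrow> complex \<Rightarrow> bool" where
  "spec_at L U V x w j z \<longleftrightarrow> L (x(13 := z)) \<noteq> 0 \<and>
     w (2 * j) = U (x(13 := z)) / L (x(13 := z)) \<and> w (2 * j + 1) = V (x(13 := z)) / L (x(13 := z))"

locale root_tower =
  fixes E1 E0 F1 F0 K3 K2 K1 K0 L U V :: "(nat \<Rightarrow> complex) \<Rightarrow> complex"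
  assumes E: "E1 \<in> polyfun 11" "E0 \<in> polyfun 11"
    and F: "F1 \<in> polyfun 12" "F0 \<in> polyfun 12"
    and K: "K3 \<in> polyfun 13" "K2 \<in> polyfun 13" "K1 \<in> polyfun 13" "K0 \<in> polyfun 13"
    and LUV: "L \<in> polyfun 14" "U \<in> polyfun 14" "V \<in> polyfun 14"
begin

definition quads :: "(nat \<Rightarrow> complex) \<Rightarrow> bool" where
  "quads x \<longleftrightarrow> x 11 ^ 2 + E1 x * x 11 + E0 x = 0 \<and> x 12 ^ 2 + F1 x * x 12 + F0 x = 0"

text \<open>The order of the choices matters: \<open>y1\<close> and \<open>y2\<close> do not depend
  on \<open>r\<close>, and the roots depend on \<open>r\<close> but not on \<open>al\<close> and
  \<open>be\<close>. The auxiliary parameters can therefore be set equal to roots once these are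
  known.\<close>

definition represents :: "(nat \<Rightarrow> complex) \<Rightarrow> (nat \<Rightarrow> complex) \<Rightarrow> bool" where
  "represents b w \<longleftrightarrow> (\<exists>y1 y2. \<exists>\<omega>::complex poly. \<omega> \<noteq> 0 \<and> (\<forall>r. poly \<omega> r \<noteq> 0 \<longrightarrow>
     (\<exists>z0 z1 z2. z0 \<noteq> z1 \<and> z0 \<noteq> z2 \<and> z1 \<noteq> z2 \<and> (\<forall>al be. let x = params b r al be y1 y2 in
        quads x \<and> K3 x \<noteq> 0 \<and> roots3 (K3 x) (K2 x) (K1 x) (K0 x) z0 z1 z2 \<and>
        spec_at L U V x w 0 z0 \<and> spec_at L U V x w 1 z1 \<and> spec_at L U V x w 2 z2))))"

text \<open>The origin of the degree bound four: modulo the two quadratics, \<open>1\<close>,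
  \<open>x 11\<close>, \<open>x 12\<close> and their product span all polynomials over those in the
  first eleven variables.\<close>

lemma reduce_quads:
  assumes "p \<in> polyfun 13"
  shows "\<exists>f. (\<forall>i<4::nat. f i \<in> polyfun 11) \<and>
    (\<forall>x. quads x \<longrightarrow> p x = f 0 x + f 1 x * x 11 + f 2 x * x 12 + f 3 x * (x 11 * x 12))"
proof -
  obtain g h where gh: "g \<in> polyfun 12" "h \<in> polyfun 12"
    "\<forall>x. x 12 ^ 2 + F1 x * x 12 + F0 x = 0 \<longrightarrow> p x = g x + h x * x 12"
    using polyfun_reduce_quadratic[of p 12, OF _ F] assms by auto
  obtain g0 g1 where g: "g0 \<in> polyfun 11" "g1 \<in> polyfun 11"
    "\<forall>x. x 11 ^ 2 + E1 x * x 11 + E0 x = 0 \<longrightarrow> g x = g0 x + g1 x * x 11"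
    using polyfun_reduce_quadratic[of g 11, OF _ E] gh by auto
  obtain h0 h1 where h: "h0 \<in> polyfun 11" "h1 \<in> polyfun 11"
    "\<forall>x. x 11 ^ 2 + E1 x * x 11 + E0 x = 0 \<longrightarrow> h x = h0 x + h1 x * x 11"
    using polyfun_reduce_quadratic[of h 11, OF _ E] gh by auto
  define f where "f = (\<lambda>i::nat. if i = 0 then g0 else if i = 1 then g1 else if i = 2 then h0 else h1)"
  have "p x = f 0 x + f 1 x * x 11 + f 2 x * x 12 + f 3 x * (x 11 * x 12)" if "quads x" for x
  proof -
    have "p x = g x + h x * x 12" "g x = g0 x + g1 x * x 11" "h x = h0 x + h1 x * x 11"
      using that gh(3) g(3) h(3) by (auto simp: quads_def)
    then show ?thesis by (simp add: f_def algebra_simps)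
  qed
  moreover have "\<forall>i<4. f i \<in> polyfun 11" using g h by (simp add: f_def)
  ultimately show ?thesis by blast
qed

definition root_part :: "((nat \<Rightarrow> complex) \<Rightarrow> complex) \<Rightarrow> nat \<Rightarrow> (nat \<Rightarrow> complex) \<Rightarrow> complex" where
  "root_part G j x = G (x(13 := x (13 + j)))"

lemma polyfun_root_part:
  assumes "G \<in> polyfun 14" "j < 3"
  shows "root_part G j \<in> polyfun 16"
  unfolding root_part_def[abs_def]
proof (rule polyfun_compose[OF assms(1)])
  fix i :: nat assume "i < 14"
  with assms(2) show "(\<lambda>x. (x(13 := x (13 + j))) i) \<in> polyfun 16"
    by (cases "i = 13") (auto intro!: polyfun.intros)
qed

definition den :: "(nat \<Rightarrow> complex) \<Rightarrow> complex" where
  "den x = root_part L 0 x * root_part L 1 x * root_part L 2 x"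

text \<open>All six spectral values over the single denominator \<open>den\<close>, the shape that
  \<open>polyfun_rational_subst\<close> expects.\<close>

definition num :: "nat \<Rightarrow> (nat \<Rightarrow> complex) \<Rightarrow> complex" where
  "num i x = (if i = 0 then root_part U 0 x * root_part L 1 x * root_part L 2 x
    else if i = 1 then root_part V 0 x * root_part L 1 x * root_part L 2 x
    else if i = 2 then root_part U 1 x * root_part L 0 x * root_part L 2 x
    else if i = 3 then root_part V 1 x * root_part L 0 x * root_part L 2 x
    else if i = 4 then root_part U 2 x * root_part L 0 x * root_part L 1 x
    else root_part V 2 x * root_part L 0 x * root_part L 1 x)"

lemma polyfun_den: "den \<in> polyfun 16"
  unfolding den_def[abs_def] by (intro polyfun.intros polyfun_root_part LUV) auto

lemma polyfun_num: "num i \<in> polyfun 16"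
proof -
  consider "i = 0" | "i = 1" | "i = 2" | "i = 3" | "i = 4" | "i \<ge> 5" by linarith
  then show ?thesis
    unfolding num_def[abs_def] by cases (auto intro!: polyfun.mult polyfun_root_part LUV)
qed

lemma root_part_set3:
  assumes "G \<in> polyfun 14"
  shows "root_part G 0 (set3 13 x a b c) = G (x(13 := a))"
    "root_part G 1 (set3 13 x a b c) = G (x(13 := b))"
    "root_part G 2 (set3 13 x a b c) = G (x(13 := c))"
  unfolding root_part_def by (rule polyfun_cong[OF assms]; simp add: set3_def)+

lemma spec_at_set3:
  assumes "spec_at L U V x w j0 a" "spec_at L U V x w j1 b" "spec_at L U V x w j2 c"
    and "w' 0 = w (2 * j0)" "w' 1 = w (2 * j0 + 1)" "w' 2 = w (2 * j1)" "w' 3 = w (2 * j1 + 1)"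
      "w' 4 = w (2 * j2)" "w' 5 = w (2 * j2 + 1)"
  shows "den (set3 13 x a b c) \<noteq> 0"
    and "i < 6 \<Longrightarrow> num i (set3 13 x a b c) / den (set3 13 x a b c) = w' i"
proof -
  note rp = root_part_set3[OF LUV(1), of x a b c] root_part_set3[OF LUV(2), of x a b c]
    root_part_set3[OF LUV(3), of x a b c]
  have d: "den (set3 13 x a b c) = L (x(13 := a)) * L (x(13 := b)) * L (x(13 := c))"
    by (simp only: den_def rp)
  show "den (set3 13 x a b c) \<noteq> 0"
    using assms(1-3) by (simp add: d spec_at_def)
  assume "i < 6"
  then consider "i = 0" | "i = 1" | "i = 2" | "i = 3" | "i = 4" | "i = 5" by linarith
  then show "num i (set3 13 x a b c) / den (set3 13 x a b c) = w' i"
    using assms unfolding d num_def rp spec_at_def by cases simp_all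
qed

definition swap3 :: "nat \<Rightarrow> nat \<Rightarrow> nat \<Rightarrow> nat \<Rightarrow> nat" where
  "swap3 i j k = (\<lambda>n. if n = 0 then i else if n = 1 then j else k)"

lemma in_F_swap3:
  assumes "in_F p q" "{i, j, k} = {0, 1, 2}"
  shows "p w * q (pair_perm (swap3 i j k) w) = q w * p (pair_perm (swap3 i j k) w)"
proof -
  have img: "swap3 i j k ` {..<3} = {..<3}"
    using assms(2) by (simp add: swap3_def eval_nat_numeral lessThan_Suc insert_commute)
  then have "bij_betw (swap3 i j k) {..<3} {..<3}"
    by (simp add: bij_betw_def eq_card_imp_inj_on)
  then show ?thesis using assms(1) by (auto simp: in_F_def)
qed

lemma quartic_relation:
  assumes "in_F p q"
  shows "\<exists>\<beta>. (\<forall>k\<le>4. \<beta> k \<in> polyfun 8) \<and> (\<exists>k\<le>4. \<exists>x. \<beta> k x \<noteq> 0) \<and>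
    (\<forall>b w. represents b w \<longrightarrow> q w \<noteq> 0 \<longrightarrow> (\<Sum>k\<le>(4::nat). \<beta> k b * (p w / q w) ^ k) = 0)"
proof -
  txt \<open>Invariance of \<open>p / q\<close> gives \<open>p (\<pi> w) = s * q (\<pi> w)\<close> for all permutations \<open>\<pi>\<close> and \<open>s = p w / q w\<close>,
    so \<open>s\<close> is the quotient of two symmetrised polynomials in the roots. The multiplier \<open>\<phi>\<close> prevents
    them from vanishing: if the auxiliary parameters are the first two roots, it is zero at every
    nontrivial permutation of the roots. The five products \<open>Sp^k * Sq^(4 - k)\<close> lie in a free module of
    rank four over the polynomials in the remaining variables, hence are linearly dependent.\<close>
  have pq: "p \<in> polyfun 6" "q \<in> polyfun 6" using assms by (auto simp: in_F_def ratfun_def)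
  obtain D1 R1 where R1: "R1 \<in> polyfun 16" "\<And>x. den x \<noteq> 0 \<Longrightarrow> den x ^ D1 * p (\<lambda>i. num i x / den x) = R1 x"
    using polyfun_rational_subst[where num = num, OF pq(1) polyfun_num polyfun_den] by blast
  obtain D2 R2 where R2: "R2 \<in> polyfun 16" "\<And>x. den x \<noteq> 0 \<Longrightarrow> den x ^ D2 * q (\<lambda>i. num i x / den x) = R2 x"
    using polyfun_rational_subst[where num = num, OF pq(2) polyfun_num polyfun_den] by blast
  define \<phi> :: "(nat \<Rightarrow> complex) \<Rightarrow> complex"
    where "\<phi> = (\<lambda>x. (x 9 - x 14) * (x 9 - x 15) * ((x 10 - x 13) * (x 10 - x 15)))"
  have \<phi>: "\<phi> \<in> polyfun 16" unfolding \<phi>_def by (intro polyfun_intros) auto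
  define Rp where "Rp = (\<lambda>x. (den x ^ D2 * R1 x) * \<phi> x)"
  define Rq where "Rq = (\<lambda>x. (den x ^ D1 * R2 x) * \<phi> x)"
  have R: "Rp \<in> polyfun (13 + 3)" "Rq \<in> polyfun (13 + 3)"
    unfolding Rp_def Rq_def using \<phi> R1(1) R2(1) polyfun_den by (auto intro!: polyfun_intros)
  obtain D3 Tp where Tp: "Tp \<in> polyfun 13" "\<And>x a b c. roots3 (K3 x) (K2 x) (K1 x) (K0 x) a b c \<Longrightarrow>
      K3 x ^ D3 * symsum 13 Rp x a b c = Tp x"
    using vieta_fun_symsum[OF K R(1)] unfolding vieta_fun_def[OF K] by blast
  obtain D4 Tq where Tq: "Tq \<in> polyfun 13" "\<And>x a b c. roots3 (K3 x) (K2 x) (K1 x) (K0 x) a b c \<Longrightarrow>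
      K3 x ^ D4 * symsum 13 Rq x a b c = Tq x"
    using vieta_fun_symsum[OF K R(2)] unfolding vieta_fun_def[OF K] by blast
  \<comment> \<open>The powers of \<open>K3\<close> are exchanged so that both symmetrised
    polynomials carry the same factor \<open>K3 x ^ (D4 + D3)\<close>, which cancels in their
    quotient.\<close>
  define Sp where "Sp = (\<lambda>x. K3 x ^ D4 * Tp x)"
  define Sq where "Sq = (\<lambda>x. K3 x ^ D3 * Tq x)"
  have S: "Sp \<in> polyfun 13" "Sq \<in> polyfun 13"
    unfolding Sp_def Sq_def using K Tp(1) Tq(1) by (auto intro!: polyfun_intros)
  define M where "M = (\<lambda>k x. Sp x ^ k * Sq x ^ (4 - k))"
  have "M k \<in> polyfun 13" for k unfolding M_def using S by (intro polyfun_intros)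
  then have "\<forall>k. \<exists>f. (\<forall>i<4::nat. f i \<in> polyfun 11) \<and>
    (\<forall>x. quads x \<longrightarrow> M k x = f 0 x + f 1 x * x 11 + f 2 x * x 12 + f 3 x * (x 11 * x 12))"
    using reduce_quads by blast
  from choice[OF this] obtain f where f: "\<And>k i. i < (4::nat) \<Longrightarrow> f k i \<in> polyfun 11"
    "\<And>k x. quads x \<Longrightarrow> M k x = f k 0 x + f k 1 x * x 11 + f k 2 x * x 12 + f k 3 x * (x 11 * x 12)"
    by blast
  have "\<exists>\<beta>. (\<forall>j\<in>{..4::nat}. \<beta> j \<in> polyfun 11) \<and> (\<exists>j\<in>{..4}. \<exists>x. \<beta> j x \<noteq> 0) \<and>
      (\<forall>i<4. \<forall>x. (\<Sum>j\<in>{..4}. \<beta> j x * f j i x) = 0)"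
    by (rule polyfun_dependent) (auto intro: f(1))
  then obtain \<beta> where \<beta>0: "\<forall>k\<in>{..4}. \<beta> k \<in> polyfun 11" "\<exists>k\<in>{..4}. \<exists>x. \<beta> k x \<noteq> 0"
    "\<forall>i<4. \<forall>x. (\<Sum>k\<le>(4::nat). \<beta> k x * f k i x) = 0" by blast
  have \<beta>: "\<And>k. k \<le> 4 \<Longrightarrow> \<beta> k \<in> polyfun 11" "\<exists>k\<le>4. \<exists>x. \<beta> k x \<noteq> 0"
    "\<And>i x. i < 4 \<Longrightarrow> (\<Sum>k\<le>(4::nat). \<beta> k x * f k i x) = 0"
    using \<beta>0 by auto
  have rel: "(\<Sum>k\<le>(4::nat). \<beta> k x * M k x) = 0" if "quads x" for x
  proof -
    have "(\<Sum>k\<le>(4::nat). \<beta> k x * M k x) = (\<Sum>k\<le>(4::nat). \<beta> k x * f k 0 x) + (\<Sum>k\<le>(4::nat). \<beta> k x * f k 1 x) * x 11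
        + (\<Sum>k\<le>(4::nat). \<beta> k x * f k 2 x) * x 12 + (\<Sum>k\<le>(4::nat). \<beta> k x * f k 3 x) * (x 11 * x 12)"
      by (simp add: f(2)[OF that] distrib_left sum.distrib sum_distrib_right mult.assoc)
    also have "\<dots> = 0" by (simp only: \<beta>(3)) simp
    finally show ?thesis .
  qed
  obtain k0 x0 where k0: "k0 \<le> 4" "\<beta> k0 x0 \<noteq> 0" using \<beta>(2) by (elim exE conjE)
  \<comment> \<open>The coefficients may still involve \<open>r\<close> and the auxiliary
    parameters. Freezing these at the coordinates of a point where \<open>\<beta> k0\<close> is
    nonzero keeps the relation nontrivial.\<close>
  define \<beta>' where "\<beta>' = (\<lambda>k b. \<beta> k (params b (x0 8) (x0 9) (x0 10) 0 0))"
  have "\<beta>' k \<in> polyfun 8" if "k \<le> 4" for k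
    unfolding \<beta>'_def by (rule polyfun_compose[OF \<beta>(1)[OF that]])
      (auto simp: params_def intro: polyfun.intros)
  moreover have "\<beta>' k0 x0 = \<beta> k0 x0"
    unfolding \<beta>'_def by (rule polyfun_cong[OF \<beta>(1)[OF k0(1)]])
      (auto simp: params_def eval_nat_numeral less_Suc_eq)
  moreover have "(\<Sum>k\<le>(4::nat). \<beta>' k b * (p w / q w) ^ k) = 0" if rep: "represents b w" and qw: "q w \<noteq> 0" for b w
  proof -
    define s where "s = p w / q w"
    obtain y1 y2 and \<omega> :: "complex poly" where \<omega>: "\<omega> \<noteq> 0" and
      rep': "\<And>r. poly \<omega> r \<noteq> 0 \<Longrightarrow> \<exists>z0 z1 z2. z0 \<noteq> z1 \<and> z0 \<noteq> z2 \<and> z1 \<noteq> z2 \<and>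
       (\<forall>al be. let x = params b r al be y1 y2 in
        quads x \<and> K3 x \<noteq> 0 \<and> roots3 (K3 x) (K2 x) (K1 x) (K0 x) z0 z1 z2 \<and>
        spec_at L U V x w 0 z0 \<and> spec_at L U V x w 1 z1 \<and> spec_at L U V x w 2 z2)"
      using rep unfolding represents_def by blast
    have proportional: "Sp x = s * Sq x" "\<exists>c. c \<noteq> 0 \<and> Sq x = c * symsum 13 Rq x z0 z1 z2" "quads x"
        "den (set3 13 x z0 z1 z2) ^ D1 * R2 (set3 13 x z0 z1 z2) \<noteq> 0"
      if *: "quads x \<and> K3 x \<noteq> 0 \<and> roots3 (K3 x) (K2 x) (K1 x) (K0 x) z0 z1 z2 \<and>
        spec_at L U V x w 0 z0 \<and> spec_at L U V x w 1 z1 \<and> spec_at L U V x w 2 z2" for x z0 z1 z2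
    proof -
      have step: "Rp (set3 13 x a b c) = s * Rq (set3 13 x a b c)" if "{i, j, k} = {0, 1, 2}"
        "spec_at L U V x w i a" "spec_at L U V x w j b" "spec_at L U V x w k c" for i j k a b c
      proof -
        define w' where "w' = pair_perm (swap3 i j k) w"
        have w': "w' 0 = w (2 * i)" "w' 1 = w (2 * i + 1)" "w' 2 = w (2 * j)" "w' 3 = w (2 * j + 1)"
          "w' 4 = w (2 * k)" "w' 5 = w (2 * k + 1)"
          by (simp_all add: w'_def pair_perm_def swap3_def)
        note sp = spec_at_set3[OF that(2-4) w']
        let ?x = "set3 13 x a b c"
        have "p (\<lambda>i. num i ?x / den ?x) = p w'" "q (\<lambda>i. num i ?x / den ?x) = q w'"
          by (rule polyfun_cong[OF pq(1)] polyfun_cong[OF pq(2)], erule sp(2))+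
        then have "R1 ?x = den ?x ^ D1 * p w'" "R2 ?x = den ?x ^ D2 * q w'"
          using R1(2)[OF sp(1)] R2(2)[OF sp(1)] by simp_all
        moreover have "p w' = s * q w'"
          using in_F_swap3[OF assms that(1), of w] qw by (simp add: w'_def s_def field_simps)
        ultimately show ?thesis by (simp add: Rp_def Rq_def)
      qed
      have sym: "symsum 13 Rp x z0 z1 z2 = s * symsum 13 Rq x z0 z1 z2"
        unfolding symsum_def using * step[of 0 1 2] step[of 0 2 1] step[of 1 0 2] step[of 1 2 0]
          step[of 2 0 1] step[of 2 1 0]
        by (simp add: insert_commute distrib_left)
      have "Sp x = K3 x ^ (D4 + D3) * symsum 13 Rp x z0 z1 z2"
        using Tp(2)[of x z0 z1 z2] * by (simp add: Sp_def power_add mult.assoc)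
      moreover have Sq: "Sq x = K3 x ^ (D4 + D3) * symsum 13 Rq x z0 z1 z2"
        using Tq(2)[of x z0 z1 z2] * by (simp add: Sq_def power_add mult_ac)
      ultimately show "Sp x = s * Sq x" using sym by simp
      show "\<exists>c. c \<noteq> 0 \<and> Sq x = c * symsum 13 Rq x z0 z1 z2"
        using * by (intro exI[of _ "K3 x ^ (D4 + D3)"]) (simp add: Sq)
      show "quads x" using * by simp
      let ?x = "set3 13 x z0 z1 z2"
      have sa: "spec_at L U V x w 0 z0" "spec_at L U V x w 1 z1" "spec_at L U V x w 2 z2"
        using * by simp_all
      have ws: "w 0 = w (2 * 0)" "w 1 = w (2 * 0 + 1)" "w 2 = w (2 * 1)" "w 3 = w (2 * 1 + 1)"
          "w 4 = w (2 * 2)" "w 5 = w (2 * 2 + 1)" by simp_all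
      note sp = spec_at_set3[OF sa ws]
      have "q (\<lambda>i. num i ?x / den ?x) = q w"
        by (rule polyfun_cong[OF pq(2)], erule sp(2))
      then have "R2 ?x = den ?x ^ D2 * q w" using R2(2)[OF sp(1)] by simp
      then show "den ?x ^ D1 * R2 ?x \<noteq> 0" using sp qw by simp
    qed
    define pt where "pt = (\<lambda>\<rho>::nat \<Rightarrow> complex. params b (\<rho> 0) (\<rho> 1) (\<rho> 2) y1 y2)"
    have coord: "(\<lambda>\<rho>. pt \<rho> i) \<in> polyfun 3" for i
    proof -
      consider "i < 8" | "i = 8" | "i = 9" | "i = 10" | "i = 11" | "i > 11" by linarith
      then show ?thesis by cases (simp_all add: pt_def params_def polyfun.intros)
    qed
    have pt: "(\<lambda>\<rho>. P (pt \<rho>)) \<in> polyfun 3" if "P \<in> polyfun n" for P n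
      using that coord by (rule polyfun_compose)
    define g where "g = (\<lambda>\<rho>. \<Sum>k\<le>(4::nat). \<beta> k (pt \<rho>) * s ^ k)"
    have g: "g \<in> polyfun 3" unfolding g_def
      by (intro polyfun_sum polyfun.mult polyfun.const pt) (auto intro: \<beta>(1))
    have vanish: "poly \<omega> (\<rho> 0) * Sq (pt \<rho>) * g \<rho> = 0" for \<rho>
    proof (cases "poly \<omega> (\<rho> 0) = 0")
      case False
      obtain z0 z1 z2 where
        "\<forall>al be. let x = params b (\<rho> 0) al be y1 y2 in
          quads x \<and> K3 x \<noteq> 0 \<and> roots3 (K3 x) (K2 x) (K1 x) (K0 x) z0 z1 z2 \<and>
          spec_at L U V x w 0 z0 \<and> spec_at L U V x w 1 z1 \<and> spec_at L U V x w 2 z2"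
        using rep'[OF False] by blast
      from this[rule_format, of "\<rho> 1" "\<rho> 2", unfolded Let_def]
      have *: "Sp (pt \<rho>) = s * Sq (pt \<rho>)" "quads (pt \<rho>)"
        unfolding pt_def by (rule proportional(1), rule proportional(3))
      have "(\<Sum>k\<le>(4::nat). \<beta> k (pt \<rho>) * M k (pt \<rho>)) = Sq (pt \<rho>) ^ 4 * g \<rho>"
        unfolding g_def sum_distrib_left M_def *(1) power_mult_distrib
      proof (rule sum.cong)
        fix k :: nat assume "k \<in> {..4}"
        then have "Sq (pt \<rho>) ^ 4 = Sq (pt \<rho>) ^ k * Sq (pt \<rho>) ^ (4 - k)"
          by (simp add: power_add[symmetric])
        then show "\<beta> k (pt \<rho>) * (s ^ k * Sq (pt \<rho>) ^ k * Sq (pt \<rho>) ^ (4 - k))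
            = Sq (pt \<rho>) ^ 4 * (\<beta> k (pt \<rho>) * s ^ k)" by simp
      qed simp
      then show ?thesis using rel[OF *(2)] by auto
    qed simp
    have "g \<rho> = 0" for \<rho>
    proof (rule ccontr)
      assume "g \<rho> \<noteq> 0"
      obtain r where r: "poly \<omega> r \<noteq> 0" using \<omega> poly_all_0_iff_0 by blast
      obtain z0 z1 z2 where z: "z0 \<noteq> z1" "z0 \<noteq> z2" "z1 \<noteq> z2" and
        all: "\<forall>al be. let x = params b r al be y1 y2 in
          quads x \<and> K3 x \<noteq> 0 \<and> roots3 (K3 x) (K2 x) (K1 x) (K0 x) z0 z1 z2 \<and>
          spec_at L U V x w 0 z0 \<and> spec_at L U V x w 1 z1 \<and> spec_at L U V x w 2 z2"
        using rep'[OF r] by blast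
      let ?x = "params b r z0 z1 y1 y2"
      have *: "quads ?x \<and> K3 ?x \<noteq> 0 \<and> roots3 (K3 ?x) (K2 ?x) (K1 ?x) (K0 ?x) z0 z1 z2 \<and>
          spec_at L U V ?x w 0 z0 \<and> spec_at L U V ?x w 1 z1 \<and> spec_at L U V ?x w 2 z2"
        using all by (simp add: Let_def)
      have x: "?x 9 = z0" "?x 10 = z1" by (simp_all add: params_def)
      have "symsum 13 Rq ?x z0 z1 z2 = Rq (set3 13 ?x z0 z1 z2)"
        by (simp add: symsum_def Rq_def \<phi>_def set3_def x)
      also have "\<dots> \<noteq> 0"
        using proportional(4)[OF *] z by (simp add: Rq_def \<phi>_def set3_def x)
      finally have "Sq ?x \<noteq> 0" using proportional(2)[OF *] by auto
      then have "Sq (pt (\<lambda>i. if i = 0 then r else if i = 1 then z0 else z1)) \<noteq> 0" by (simp add: pt_def)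
      from polyfun_no_zero_divisors[OF pt[OF S(2)] g this \<open>g \<rho> \<noteq> 0\<close>]
      obtain \<rho>1 where \<rho>1: "Sq (pt \<rho>1) * g \<rho>1 \<noteq> 0" by auto
      have "poly \<omega> ((\<lambda>_::nat. r) 0) \<noteq> 0" using r by simp
      from polyfun_no_zero_divisors[OF polyfun_poly[of 0 3] polyfun.mult[OF pt[OF S(2)] g] this \<rho>1]
      show False using vanish by (auto simp: mult.assoc)
    qed
    moreover have "\<beta>' k b = \<beta> k (pt (\<lambda>i. x0 (8 + i)))" if "k \<le> 4" for k
      unfolding \<beta>'_def pt_def by (rule polyfun_cong[OF \<beta>(1)[OF that]]) (auto simp: params_def)
    ultimately show ?thesis by (simp add: g_def s_def)
  qed
  ultimately show ?thesis
    using k0 by (intro exI[of _ \<beta>'] conjI exI[of _ k0] exI[of _ x0]) auto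
qed

end

text \<open>Division by the highest coefficient that is not identically zero makes the relation
  monic.\<close>

lemma annih_of_relation:
  assumes \<beta>: "\<And>k. k \<le> 4 \<Longrightarrow> \<beta> k \<in> polyfun 8" "k0 \<le> 4" "\<beta> k0 x0 \<noteq> 0"
    and N: "N \<in> polyfun 8" "N x1 \<noteq> 0"
    and rel: "\<And>c a pt. E4 c a pt \<Longrightarrow> N (specB a pt) \<noteq> 0 \<Longrightarrow> q (specF c a pt) \<noteq> 0 \<Longrightarrow>
      (\<Sum>k\<le>(4::nat). \<beta> k (specB a pt) * (p (specF c a pt) / q (specF c a pt)) ^ k) = 0"
  shows "\<exists>m P Q. annih m P Q p q"
proof -
  define A where "A = {k. k \<le> 4 \<and> (\<exists>x. \<beta> k x \<noteq> 0)}"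
  define m where "m = Max A"
  have A: "finite A" "A \<noteq> {}" using \<beta>(2,3) by (auto simp: A_def)
  then have "m \<in> A" unfolding m_def by (rule Max_in)
  then obtain x2 where m: "m \<le> 4" "\<beta> m x2 \<noteq> 0" by (auto simp: A_def)
  have above: "\<beta> k x = 0" if "k \<le> 4" "m < k" for k x
  proof (rule ccontr)
    assume "\<beta> k x \<noteq> 0"
    then have "k \<in> A" using that by (auto simp: A_def)
    then show False using Max_ge[OF A(1)] that by (force simp: m_def)
  qed
  \<comment> \<open>The factor \<open>N\<close> cancels in \<open>P k / Q k\<close>, but makes the
    coefficients count as undefined where \<open>N\<close> vanishes; this is how exceptional
    spectral data are excluded.\<close>
  define Q where "Q = (\<lambda>(k::nat) x. \<beta> m x * N x)"
  define P where "P = (\<lambda>k x. if m = 0 then 0 else \<beta> k x * N x)"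
  \<comment> \<open>If only the constant coefficient is nonzero, the relation contradicts
    \<open>Q 0 b \<noteq> 0\<close>. Degree one is used then, because in degree 0 no denominator
    condition would be available and \<open>hval\<close> would be 1.\<close>
  define m' where "m' = max m 1"
  have Q: "ratfun 8 (P k) (Q k)" if "k < m'" for k
    unfolding ratfun_def
  proof (intro conjI)
    have k: "k \<le> 4" using that m by (simp add: m'_def)
    show "P k \<in> polyfun 8"
      using \<beta>(1)[OF k] N by (cases "m = 0") (auto simp: P_def[abs_def] intro!: polyfun_intros)
    show "Q k \<in> polyfun 8" unfolding Q_def using \<beta>(1)[OF m(1)] N by (intro polyfun_intros)
    show "\<exists>x. Q k x \<noteq> 0"
      using polyfun_no_zero_divisors[OF \<beta>(1)[OF m(1)] N(1) m(2) N(2)] by (simp add: Q_def)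
  qed
  have "hval m' P Q (specB a pt) (p (specF c a pt) / q (specF c a pt)) = 0"
    if e: "E4 c a pt" and nz: "\<forall>k<m'. Q k (specB a pt) \<noteq> 0" and qnz: "q (specF c a pt) \<noteq> 0" for c a pt
  proof -
    define b where "b = specB a pt"
    define s where "s = p (specF c a pt) / q (specF c a pt)"
    have "0 < m'" by (simp add: m'_def)
    then have "Q 0 b \<noteq> 0" using nz by (simp add: b_def)
    then have b: "\<beta> m b \<noteq> 0" "N b \<noteq> 0" by (auto simp: Q_def)
    have "0 = (\<Sum>k\<le>(4::nat). \<beta> k b * s ^ k)"
      using rel[OF e] b qnz by (simp add: b_def s_def)
    also have "\<dots> = (\<Sum>k\<le>m. \<beta> k b * s ^ k)"
      using above m by (intro sum.mono_neutral_right) auto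
    also have "\<dots> = (\<Sum>k<m. \<beta> k b * s ^ k) + \<beta> m b * s ^ m"
      by (simp add: lessThan_Suc_atMost[symmetric])
    finally have sum: "(\<Sum>k<m. \<beta> k b * s ^ k) + \<beta> m b * s ^ m = 0" by simp
    have "m \<noteq> 0" using sum b by (intro notI) simp
    then have m': "m' = m" by (simp add: m'_def)
    with \<open>m \<noteq> 0\<close> have "hval m' P Q b s = s ^ m + (\<Sum>k<m. \<beta> k b * s ^ k) / \<beta> m b"
      using b by (simp add: hval_def m' P_def Q_def sum_divide_distrib)
    also have "\<dots> = 0" using sum b by (simp add: field_simps add_eq_0_iff)
    finally show ?thesis by (simp add: b_def s_def)
  qed
  then have "annih m' P Q p q"
    using Q m unfolding annih_def by (auto simp: m'_def)
  then show ?thesis by blast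
qed

subsection \<open>Linear algebra in dimension three\<close>

lemma all3: "(\<forall>i<3. P i) \<longleftrightarrow> P 0 \<and> P 1 \<and> P (2::nat)"
  by (auto simp: eval_nat_numeral less_Suc_eq)

lemma ex3: "(\<exists>i<3. P i) \<longleftrightarrow> P 0 \<or> P 1 \<or> P (2::nat)"
  by (auto simp: eval_nat_numeral less_Suc_eq)

definition mv :: "(nat \<Rightarrow> nat \<Rightarrow> complex) \<Rightarrow> vec3 \<Rightarrow> vec3" where
  "mv M x = (\<lambda>i. \<Sum>j<3. M i j * x j)"

definition dt :: "vec3 \<Rightarrow> vec3 \<Rightarrow> vec3 \<Rightarrow> complex" where
  "dt x y z = det3 (\<lambda>i j. if j = 0 then x i else if j = 1 then y i else z i)"

lemma dt_expand: "dt x y z = x 0 * (y 1 * z 2 - z 1 * y 2) - y 0 * (x 1 * z 2 - z 1 * x 2)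
    + z 0 * (x 1 * y 2 - y 1 * x 2)"
  by (simp add: dt_def det3_def)

text \<open>The derivative of \<open>dt_mv\<close> at the identity; it lets the trace be read off in
  any basis.\<close>

lemma dt_trace:
  "dt (mv M x) y z + dt x (mv M y) z + dt x y (mv M z) = tr3 M * dt x y z"
  by (simp add: dt_expand mv_def sum3 tr3_def algebra_simps)

lemma dt_mv: "dt (mv M x) (mv M y) (mv M z) = det3 M * dt x y z"
  unfolding dt_expand mv_def sum3 det3_def by (simp add: algebra_simps)

lemma dt_cramer:
  assumes "i < 3"
  shows "dt x y z * w i = dt w y z * x i + dt x w z * y i + dt x y w * z i"
proof -
  have "i = 0 \<or> i = 1 \<or> i = 2" using assms by linarith
  then show ?thesis by (elim disjE) (simp_all add: dt_expand algebra_simps)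
qed

lemma det3_kernel:
  assumes "\<And>i. i < 3 \<Longrightarrow> mv M y i = 0" "nonzero3 y"
  shows "det3 M = 0"
proof -
  define r where "r = mv M y"
  have r: "r 0 = 0" "r 1 = 0" "r 2 = 0" using assms(1) by (simp_all add: r_def)
  have "y 0 * det3 M = (M 1 1 * M 2 2 - M 1 2 * M 2 1) * r 0 - (M 0 1 * M 2 2 - M 0 2 * M 2 1) * r 1
      + (M 0 1 * M 1 2 - M 0 2 * M 1 1) * r 2"
    "y 1 * det3 M = - (M 1 0 * M 2 2 - M 1 2 * M 2 0) * r 0 + (M 0 0 * M 2 2 - M 0 2 * M 2 0) * r 1
      - (M 0 0 * M 1 2 - M 0 2 * M 1 0) * r 2"
    "y 2 * det3 M = (M 1 0 * M 2 1 - M 1 1 * M 2 0) * r 0 - (M 0 0 * M 2 1 - M 0 1 * M 2 0) * r 1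
      + (M 0 0 * M 1 1 - M 0 1 * M 1 0) * r 2"
    by (simp_all add: r_def mv_def sum3 det3_def algebra_simps)
  then have "y 0 * det3 M = 0" "y 1 * det3 M = 0" "y 2 * det3 M = 0"
    by (simp_all only: r mult_zero_right add_0 diff_0_right)
  then show ?thesis using assms(2) unfolding nonzero3_def ex3 by auto
qed

lemma det3_transpose: "det3 (\<lambda>i j. M j i) = det3 M"
  by (simp add: det3_def algebra_simps)

lemma det3_uminus_divide: "det3 (\<lambda>i j. - N i j / r) = - det3 N / r ^ 3"
proof -
  have "det3 (\<lambda>i j. - s * N i j) = - (s ^ 3) * det3 N" for s
    by (simp add: det3_def power3_eq_cube algebra_simps)
  from this[of "inverse r"] show ?thesis by (simp add: divide_inverse power_inverse mult_ac)
qed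

lemma det3_left_kernel:
  assumes "\<And>j. j < 3 \<Longrightarrow> (\<Sum>i<3. c i * M i j) = 0" "nonzero3 c"
  shows "det3 M = 0"
proof -
  have "det3 (\<lambda>i j. M j i) = 0"
    by (rule det3_kernel[OF _ assms(2)]) (use assms(1) in \<open>simp add: mv_def mult.commute\<close>)
  then show ?thesis by (rule trans[OF det3_transpose[symmetric]])
qed

lemma in_span_if_cross_zero:
  assumes "nonzero3 x" "x 0 * y 1 = x 1 * y 0" "x 0 * y 2 = x 2 * y 0" "x 1 * y 2 = x 2 * y 1"
  shows "in_span y x"
proof -
  consider "x 0 \<noteq> 0" | "x 1 \<noteq> 0" | "x 2 \<noteq> 0" using assms(1) unfolding nonzero3_def ex3 by blast
  then show ?thesis
  proof cases
    case 1
    then show ?thesis using assms unfolding in_span_def all3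
      by (intro exI[of _ "y 0 / x 0"]) (auto simp: field_simps)
  next
    case 2
    then show ?thesis using assms unfolding in_span_def all3
      by (intro exI[of _ "y 1 / x 1"]) (auto simp: field_simps)
  next
    case 3
    then show ?thesis using assms unfolding in_span_def all3
      by (intro exI[of _ "y 2 / x 2"]) (auto simp: field_simps)
  qed
qed

lemma dt_zero_combination:
  assumes "dt x y z = 0" "nonzero3 x" "\<not> in_span y x"
  shows "\<exists>\<alpha> \<beta>. \<forall>i<3. z i = \<alpha> * x i + \<beta> * y i"
proof -
  \<comment> \<open>The cross product of \<open>x\<close> and \<open>y\<close>. The unit vector
    \<open>e\<close> at a nonzero coordinate of it completes \<open>x\<close>, \<open>y\<close> to a
    basis.\<close>
  define n where "n = (\<lambda>i::nat. if i = 0 then x 1 * y 2 - x 2 * y 1 else if i = 1 then x 2 * y 0 - x 0 * y 2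
      else x 0 * y 1 - x 1 * y 0)"
  have "n 0 \<noteq> 0 \<or> n 1 \<noteq> 0 \<or> n 2 \<noteq> 0"
    using in_span_if_cross_zero[OF assms(2), of y] assms(3) by (auto simp: n_def)
  then obtain k where k: "k < 3" "n k \<noteq> 0"
    unfolding ex3[of "\<lambda>k. n k \<noteq> 0", symmetric] by blast
  define e where "e = (\<lambda>i. if i = k then 1 else (0::complex))"
  have D: "dt x y e = n k"
  proof -
    have "k = 0 \<or> k = 1 \<or> k = 2" using k by linarith
    then show ?thesis unfolding dt_expand e_def n_def by (elim disjE) auto
  qed
  have "z i = dt z y e / dt x y e * x i + dt x z e / dt x y e * y i" if "i < 3" for i
    using dt_cramer[OF that, of x y e z] k assms(1) by (simp add: D field_simps)
  then show ?thesis by blast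
qed

definition comb :: "(nat \<Rightarrow> vec3) \<Rightarrow> vec3 \<Rightarrow> vec3" where
  "comb e x = (\<lambda>l. \<Sum>k<3. x k * e k l)"

lemma matrix_in_basis:
  assumes "dt (e 0) (e 1) (e 2) \<noteq> 0"
    and M: "\<And>i k. i < 3 \<Longrightarrow> k < 3 \<Longrightarrow> mv M (e k) i = comb e (\<lambda>j. N j k) i"
  shows "tr3 M = tr3 N" "det3 M = det3 N"
proof -
  have m: "mv M (e k) i = N 0 k * e 0 i + N 1 k * e 1 i + N 2 k * e 2 i" if "i < 3" "k < 3" for i k
    using M[OF that] by (simp add: comb_def sum3)
  have m0: "mv M (e 0) 0 = N 0 0 * e 0 0 + N 1 0 * e 1 0 + N 2 0 * e 2 0"
    "mv M (e 0) 1 = N 0 0 * e 0 1 + N 1 0 * e 1 1 + N 2 0 * e 2 1"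
    "mv M (e 0) 2 = N 0 0 * e 0 2 + N 1 0 * e 1 2 + N 2 0 * e 2 2"
    "mv M (e 1) 0 = N 0 1 * e 0 0 + N 1 1 * e 1 0 + N 2 1 * e 2 0"
    "mv M (e 1) 1 = N 0 1 * e 0 1 + N 1 1 * e 1 1 + N 2 1 * e 2 1"
    "mv M (e 1) 2 = N 0 1 * e 0 2 + N 1 1 * e 1 2 + N 2 1 * e 2 2"
    "mv M (e 2) 0 = N 0 2 * e 0 0 + N 1 2 * e 1 0 + N 2 2 * e 2 0"
    "mv M (e 2) 1 = N 0 2 * e 0 1 + N 1 2 * e 1 1 + N 2 2 * e 2 1"
    "mv M (e 2) 2 = N 0 2 * e 0 2 + N 1 2 * e 1 2 + N 2 2 * e 2 2"
    using m by simp_all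
  have "tr3 M * dt (e 0) (e 1) (e 2)
      = dt (mv M (e 0)) (e 1) (e 2) + dt (e 0) (mv M (e 1)) (e 2) + dt (e 0) (e 1) (mv M (e 2))"
    by (rule dt_trace[symmetric])
  also have "\<dots> = tr3 N * dt (e 0) (e 1) (e 2)"
    unfolding dt_expand m0 tr3_def by (simp add: algebra_simps)
  finally show "tr3 M = tr3 N" using assms(1) by simp
  have "det3 M * dt (e 0) (e 1) (e 2) = dt (mv M (e 0)) (mv M (e 1)) (mv M (e 2))"
    by (rule dt_mv[symmetric])
  also have "\<dots> = det3 N * dt (e 0) (e 1) (e 2)"
    unfolding dt_expand m0 det3_def by (simp add: algebra_simps)
  finally show "det3 M = det3 N" using assms(1) by simp
qed

subsection \<open>Quadratic maps with an invariant line\<close>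

lemma qeval_diff: "qeval a (\<lambda>i. x i - l * n i) i = qeval a x i - l * mv (jac a x) n i + l\<^sup>2 * qeval a n i"
  unfolding qeval_def mv_def jac_def sum3 power2_eq_square by (simp add: algebra_simps)

lemma jac_self: "mv (jac a x) x i = 2 * qeval a x i"
  unfolding qeval_def mv_def jac_def sum3 by (simp add: algebra_simps)

lemma jac_sym: "mv (jac a x) y i = mv (jac a y) x i"
  unfolding mv_def jac_def sum3 by (simp add: algebra_simps)

lemma lin_linear: "lin c (\<lambda>i. x i + l * y i) = lin c x + l * lin c y"
  unfolding lin_def sum3 by (simp add: algebra_simps)

lemma lin_transversal:
  assumes "nonzero3 c"
  obtains n where "lin c n = 1"
proof -
  obtain k where k: "k < 3" "c k \<noteq> 0" using assms by (auto simp: nonzero3_def)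
  then have "k = 0 \<or> k = 1 \<or> k = 2" by linarith
  then have "lin c (\<lambda>i. if i = k then 1 / c k else 0) = 1"
    using k unfolding lin_def sum3 by (elim disjE) auto
  then show ?thesis by (rule that)
qed

text \<open>Split \<open>x\<close> into \<open>x - c(x) n\<close> and \<open>c(x) n\<close> with
  \<open>c(n) = 1\<close>. The first part lies on the line, so every term that survives in
  \<open>c(F(x))\<close> contains the factor \<open>c(x)\<close>.\<close>

lemma invariant_line_cofactor:
  assumes "nonzero3 c" "preserves_line a c"
  shows "\<exists>m. \<forall>x. lin c (qeval a x) = lin c x * lin m x"
proof -
  obtain n where n: "lin c n = 1" using lin_transversal[OF assms(1)] .
  define m where "m = (\<lambda>k. (\<Sum>i<3. \<Sum>j<3. c i * ((a i j k + a i k j) * n j)) - c k * lin c (qeval a n))"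
  have "lin c (qeval a x) = lin c x * lin m x" for x
  proof -
    define l where "l = lin c x"
    have "lin c (\<lambda>i. x i - l * n i) = 0"
      using lin_linear[of c x "- l" n] n by (simp add: l_def)
    then have "lin c (qeval a (\<lambda>i. x i - l * n i)) = 0"
      using assms(2) by (simp add: preserves_line_def)
    then have 1: "lin c (qeval a x) = l * lin c (mv (jac a x) n) - l\<^sup>2 * lin c (qeval a n)"
      unfolding lin_def sum3 qeval_diff by (simp add: algebra_simps)
    have 2: "lin c (mv (jac a x) n) = lin m x + l * lin c (qeval a n)"
      unfolding l_def m_def lin_def[of _ x] sum3 by (simp add: lin_def sum3 mv_def jac_def algebra_simps)
    show ?thesis unfolding 1 2 l_def[symmetric] by (simp add: power2_eq_square algebra_simps)
  qed
  then show ?thesis by (intro exI allI)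
qed

lemma fp_mult_eq:
  assumes "nonzero3 x" "\<And>i. i < 3 \<Longrightarrow> qeval a x i = lam * x i"
  shows "fp_mult a x = lam"
  unfolding fp_mult_def
proof (rule the_equality)
  show "\<forall>i<3. qeval a x i = lam * x i" using assms(2) by blast
  fix l assume "\<forall>i<3. qeval a x i = l * x i"
  then show "l = lam" using assms unfolding nonzero3_def by (metis mult_right_cancel)
qed

locale invariant_line =
  fixes c m :: vec3 and a :: qmap
  assumes c: "nonzero3 c" and no_zero: "no_common_zero a"
    and cofactor: "\<And>x. lin c (qeval a x) = lin c x * lin m x"
begin

lemma cofactor_polar: "lin c (mv (jac a x) y) = lin c x * lin m y + lin c y * lin m x"
proof -
  have "lin c (qeval a (\<lambda>i. x i - (-1) * y i))
      = lin c (qeval a x) + lin c (mv (jac a x) y) + lin c (qeval a y)"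
    unfolding lin_def sum3 qeval_diff by (simp add: algebra_simps)
  moreover have "lin d (\<lambda>i. x i - (-1) * y i) = lin d x + lin d y" for d
    unfolding lin_def sum3 by (simp add: algebra_simps)
  ultimately show ?thesis using cofactor by (simp add: algebra_simps)
qed

lemma fixed_point_mult:
  assumes "fixed_point a x"
  shows "i < 3 \<Longrightarrow> qeval a x i = fp_mult a x * x i" "fp_mult a x \<noteq> 0" "nonzero3 x"
proof -
  obtain lam where l: "nonzero3 x" "\<forall>i<3. qeval a x i = lam * x i"
    using assms by (auto simp: fixed_point_def)
  have e: "fp_mult a x = lam" using l by (intro fp_mult_eq) auto
  show "nonzero3 x" by fact
  show "i < 3 \<Longrightarrow> qeval a x i = fp_mult a x * x i" using l e by simp
  show "fp_mult a x \<noteq> 0"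
  proof
    assume "fp_mult a x = 0"
    then have "\<forall>i<3. qeval a x i = 0" using l e by simp
    then show False using no_zero l by (auto simp: no_common_zero_def)
  qed
qed

lemma fp_mult_off_line:
  assumes "fixed_point a x" "lin c x \<noteq> 0"
  shows "fp_mult a x = lin m x"
proof -
  have "lin c (qeval a x) = fp_mult a x * lin c x"
    using fixed_point_mult(1)[OF assms(1)] by (simp add: lin_def sum3 algebra_simps)
  then show ?thesis using cofactor[of x] assms(2) by simp
qed

lemma mv_dmat: "mv (dmat a x) y i = mv (jac a x) y i / fp_mult a x"
  by (simp add: mv_def dmat_def sum3 add_divide_distrib)

lemma line_basis:
  assumes "nonzero3 x" "lin c x = 0" "lin c y = 0" "\<not> in_span y x" "lin c n = 1"
  shows "dt x y n \<noteq> 0" "dt x y w = dt x y n * lin c w"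
proof -
  have zero: "dt x y w = 0" if "lin c w = 0" for w
    unfolding dt_def
  proof (rule det3_left_kernel[OF _ c])
    fix j :: nat assume "j < 3"
    then have "j = 0 \<or> j = 1 \<or> j = 2" by linarith
    then show "(\<Sum>i<3. c i * (if j = 0 then x i else if j = 1 then y i else w i)) = 0"
      using assms that by (elim disjE) (auto simp: lin_def)
  qed
  show *: "dt x y w = dt x y n * lin c w" for w
  proof -
    have "lin c (\<lambda>i. w i + (- lin c w) * n i) = 0" unfolding lin_linear using assms by simp
    then have "dt x y (\<lambda>i. w i + (- lin c w) * n i) = 0" by (rule zero)
    then show ?thesis unfolding dt_expand by (simp add: algebra_simps)
  qed
  show "dt x y n \<noteq> 0"
  proof
    assume "dt x y n = 0"
    then have d: "dt x y w = 0" for w using *[of w] by (metis mult_zero_left)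
    have "in_span y x"
      using d[of "\<lambda>i. if i = 0 then 1 else 0"] d[of "\<lambda>i. if i = 1 then 1 else 0"]
        d[of "\<lambda>i. if i = 2 then 1 else 0"]
      by (intro in_span_if_cross_zero assms) (auto simp: dt_expand mult.commute)
    with assms(4) show False ..
  qed
qed

lemma line_direction:
  assumes "nonzero3 x"
  obtains y where "lin c y = 0" "\<not> in_span y x"
proof (rule ccontr)
  assume "\<not> thesis"
  with that have all: "in_span y x" if "lin c y = 0" for y using that by blast
  have par: "y i * z j = y j * z i" if "in_span y x" "in_span z x" "i < 3" "j < 3" for y z i j
    using that by (auto simp: in_span_def)
  \<comment> \<open>The cross products of \<open>c\<close> with the unit vectors. If all three were
    multiples of \<open>x\<close>, they would be pairwise parallel, which forces
    \<open>c = 0\<close>.\<close>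
  define y0 where "y0 = (\<lambda>i::nat. if i = 0 then 0 else if i = 1 then c 2 else - c 1)"
  define y1 where "y1 = (\<lambda>i::nat. if i = 0 then - c 2 else if i = 1 then 0 else c 0)"
  define y2 where "y2 = (\<lambda>i::nat. if i = 0 then c 1 else if i = 1 then - c 0 else 0)"
  have "in_span y0 x" "in_span y1 x" "in_span y2 x"
    by (rule all, simp add: lin_def sum3 y0_def y1_def y2_def)+
  then have "c 0 = 0" "c 1 = 0" "c 2 = 0"
    using par[of y1 y2 1 2] par[of y0 y2 0 2] par[of y0 y1 0 1] by (auto simp: y0_def y1_def y2_def)
  then show False using c unfolding nonzero3_def ex3 by auto
qed

text \<open>In a basis \<open>x, y, n\<close> with \<open>y\<close> along the line and
  \<open>n\<close> transversal, \<open>dmat\<close> is triangular with diagonal entries 2 (Euler's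
  identity), the tangent eigenvalue, and \<open>m(x) / lam\<close>, its action modulo the plane of
  the line. The trace gives the tangent eigenvalue.\<close>

lemma tangent_eig_eq:
  assumes fp: "fixed_point a x" and x: "lin c x = 0"
  shows "tangent_eig a c x = tr3 (dmat a x) - 2 - lin m x / fp_mult a x"
proof -
  let ?lam = "fp_mult a x"
  note f = fixed_point_mult[OF fp]
  obtain n where n: "lin c n = 1" using lin_transversal[OF c] .
  have Mx: "mv (dmat a x) x i = 2 * x i" if "i < 3" for i
    using f that by (simp add: mv_dmat jac_self)
  have cM: "lin c (mv (dmat a x) y) = lin c y * (lin m x / ?lam)" for y
  proof -
    have "lin c (mv (dmat a x) y) = lin c (mv (jac a x) y) / ?lam"
      by (simp add: lin_def sum3 mv_dmat add_divide_distrib)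
    then show ?thesis using x by (simp add: cofactor_polar)
  qed
  have unique: "mu = tr3 (dmat a x) - 2 - lin m x / ?lam"
    if y: "lin c y = 0" "\<not> in_span y x"
      and My: "in_span (\<lambda>i. (\<Sum>j<3. dmat a x i j * y j) - mu * y i) x" for mu y
  proof -
    obtain s where s: "\<And>i. i < 3 \<Longrightarrow> mv (dmat a x) y i = mu * y i + s * x i"
      using My by (auto simp: in_span_def mv_def algebra_simps)
    have D: "dt x y n \<noteq> 0" using line_basis(1)[OF f(3) x y n] .
    have "dt (mv (dmat a x) x) y n = 2 * dt x y n"
      unfolding dt_expand using Mx by (simp add: algebra_simps)
    moreover have "dt x (mv (dmat a x) y) n = mu * dt x y n"
      unfolding dt_expand using s by (simp add: algebra_simps)
    moreover have "dt x y (mv (dmat a x) n) = dt x y n * (lin m x / ?lam)"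
      using line_basis(2)[OF f(3) x y n, of "mv (dmat a x) n"] cM[of n] n by simp
    ultimately have "(2 + mu + lin m x / ?lam) * dt x y n = tr3 (dmat a x) * dt x y n"
      using dt_trace[of "dmat a x" x y n] by (simp add: algebra_simps)
    then have "2 + mu + lin m x / ?lam = tr3 (dmat a x)" by (rule mult_right_cancel[OF D, THEN iffD1])
    then show ?thesis by (simp add: algebra_simps)
  qed
  obtain y where y: "lin c y = 0" "\<not> in_span y x" using line_direction[OF f(3)] .
  let ?w = "mv (dmat a x) y"
  have D: "dt x y n \<noteq> 0" using line_basis(1)[OF f(3) x y n] .
  have "dt x y ?w = 0" using line_basis(2)[OF f(3) x y n, of ?w] cM[of y] y by simp
  then have "?w i - dt x ?w n / dt x y n * y i = dt ?w y n / dt x y n * x i" if "i < 3" for i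
    using dt_cramer[OF that, of x y n ?w] D by (simp add: field_simps)
  then have My: "in_span (\<lambda>i. (\<Sum>j<3. dmat a x i j * y j) - dt x ?w n / dt x y n * y i) x"
    unfolding in_span_def mv_def by blast
  show ?thesis
    unfolding tangent_eig_def
  proof (rule the_equality)
    show "\<exists>y. lin c y = 0 \<and> \<not> in_span y x \<and> in_span (\<lambda>i. (\<Sum>j<3. dmat a x i j * y j)
        - (tr3 (dmat a x) - 2 - lin m x / ?lam) * y i) x"
      using y My unfolding unique[OF y My] by blast
  qed (use unique in blast)
qed

lemma spectrum_on_line:
  assumes fp: "fixed_point a x" and x: "lin c x = 0"
  shows "v_val a c x = 1 - lin m x / fp_mult a x"
    "u_val a c x = 3 + lin m x / fp_mult a x - tr3 (jac a x) / fp_mult a x"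
proof -
  have "tr3 (dmat a x) = tr3 (jac a x) / fp_mult a x"
    by (simp add: tr3_def dmat_def add_divide_distrib)
  then show "v_val a c x = 1 - lin m x / fp_mult a x"
    "u_val a c x = 3 + lin m x / fp_mult a x - tr3 (jac a x) / fp_mult a x"
    by (simp_all add: v_val_def u_val_def trace_IDf_def tangent_eig_eq[OF fp x])
qed

text \<open>\<open>c\<close> is a left eigenvector of \<open>dmat\<close> with eigenvalue
  \<open>m(x) / lam\<close>; if this were 1, the identity minus \<open>dmat\<close> would be
  singular.\<close>

lemma nondegenerate_on_line:
  assumes "fixed_point a x" "lin c x = 0" "det_IDf a x \<noteq> 0"
  shows "fp_mult a x \<noteq> lin m x"
proof
  assume eq: "fp_mult a x = lin m x"
  have "det3 (\<lambda>i j. (if i = j then 1 else 0) - dmat a x i j) = 0"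
  proof (rule det3_left_kernel[OF _ c])
    fix j :: nat assume j: "j < 3"
    let ?e = "\<lambda>i. if i = j then 1 else (0::complex)"
    have "(\<Sum>i<3. c i * ((if i = j then 1 else 0) - dmat a x i j)) = lin c ?e - lin c (mv (dmat a x) ?e)"
    proof -
      have "j = 0 \<or> j = 1 \<or> j = 2" using j by linarith
      then show ?thesis by (elim disjE) (simp_all add: lin_def mv_def sum3 algebra_simps)
    qed
    also have "lin c (mv (dmat a x) ?e) = lin c (mv (jac a x) ?e) / fp_mult a x"
      by (simp add: lin_def sum3 mv_dmat add_divide_distrib)
    also have "\<dots> = lin c ?e"
      using fixed_point_mult(2)[OF assms(1)] assms(2) by (simp add: cofactor_polar eq)
    finally show "(\<Sum>i<3. c i * ((if i = j then 1 else 0) - dmat a x i j)) = 0" by simp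
  qed
  then show False using assms(3) by (simp add: det_IDf_def)
qed

text \<open>If the three points were collinear, every point of the line through them would be fixed.\<close>

lemma fixed_points_independent:
  assumes fx: "fixed_point a x" "lin c x \<noteq> 0" "det_IDf a x \<noteq> 0"
    and fy: "fixed_point a y" "lin c y \<noteq> 0" and fz: "fixed_point a z" "lin c z \<noteq> 0"
    and ns: "\<not> in_span y x" "\<not> in_span z x" "\<not> in_span z y"
  shows "dt x y z \<noteq> 0"
proof
  assume dep: "dt x y z = 0"
  obtain \<alpha> \<beta> where z0: "\<forall>i<3. z i = \<alpha> * x i + \<beta> * y i"
    using dt_zero_combination[OF dep fixed_point_mult(3)[OF fx(1)] ns(1)] by blast
  note z = z0[rule_format]
  have "\<alpha> \<noteq> 0" using ns(3) z by (auto simp: in_span_def)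
  have "\<beta> \<noteq> 0" using ns(2) z by (auto simp: in_span_def)
  have q: "qeval a w i = lin m w * w i" if "fixed_point a w" "lin c w \<noteq> 0" "i < 3" for w i
    using fixed_point_mult(1)[OF that(1,3)] fp_mult_off_line[OF that(1,2)] by simp
  have ext: "qeval a z i = qeval a (\<lambda>i. \<alpha> * x i + \<beta> * y i) i" "lin m z = \<alpha> * lin m x + \<beta> * lin m y" for i
    using z by (simp_all add: qeval_def lin_def sum3 algebra_simps)
  have B: "mv (jac a x) y i = lin m x * y i + lin m y * x i" if "i < 3" for i
  proof -
    have "qeval a (\<lambda>i. \<alpha> * x i + \<beta> * y i) i
        = \<alpha>\<^sup>2 * qeval a x i + \<alpha> * \<beta> * mv (jac a x) y i + \<beta>\<^sup>2 * qeval a y i"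
      unfolding qeval_def mv_def jac_def sum3 power2_eq_square by (simp add: algebra_simps)
    then have "(\<alpha> * lin m x + \<beta> * lin m y) * (\<alpha> * x i + \<beta> * y i)
        = \<alpha>\<^sup>2 * (lin m x * x i) + \<alpha> * \<beta> * mv (jac a x) y i + \<beta>\<^sup>2 * (lin m y * y i)"
      using q[OF fx(1,2) that] q[OF fy that] q[OF fz that] ext z[OF that] by simp
    then have "\<alpha> * \<beta> * (mv (jac a x) y i - (lin m x * y i + lin m y * x i)) = 0"
      by (simp add: power2_eq_square algebra_simps)
    then show ?thesis using \<open>\<alpha> \<noteq> 0\<close> \<open>\<beta> \<noteq> 0\<close> by simp
  qed
  let ?I = "\<lambda>i j. (if i = j then 1 else 0) - dmat a x i j"
  let ?y = "\<lambda>i. lin m x * y i - lin m y * x i"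
  have mx: "lin m x \<noteq> 0" "fp_mult a x = lin m x"
    using fixed_point_mult(2)[OF fx(1)] fp_mult_off_line[OF fx(1,2)] by auto
  have I: "mv ?I w i = w i - mv (jac a x) w i / lin m x" if "i < 3" for w i
  proof -
    have "i = 0 \<or> i = 1 \<or> i = 2" using that by linarith
    then show ?thesis unfolding mx(2)[symmetric] mv_dmat[symmetric]
      by (elim disjE) (simp_all add: mv_def sum3 left_diff_distrib)
  qed
  have jy: "mv (jac a x) ?y i = lin m x * mv (jac a x) y i - lin m y * mv (jac a x) x i" for i
    by (simp add: mv_def sum3 algebra_simps)
  have "mv ?I ?y i = 0" if "i < 3" for i
    unfolding I[OF that] jy jac_self B[OF that] q[OF fx(1,2) that] using mx(1)
    by (simp add: field_simps)
  moreover have "nonzero3 ?y"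
  proof (rule ccontr)
    assume "\<not> nonzero3 ?y"
    then have "\<forall>i<3. y i = lin m y / lin m x * x i"
      using mx(1) by (auto simp: nonzero3_def field_simps)
    then have "in_span y x" unfolding in_span_def by blast
    then show False using ns(1) by simp
  qed
  ultimately have "det3 ?I = 0" by (rule det3_kernel)
  then show False using fx(3) by (simp add: det_IDf_def)
qed

end

subsection \<open>Normal form with respect to the four fixed points off the line\<close>

definition sg :: "nat \<Rightarrow> nat \<Rightarrow> complex" where
  "sg i k = (if i = 0 \<or> i = Suc k then 1 else - 1)"

text \<open>If the rows of \<open>g\<close> sum to zero, (1, 1, 1) lies in its kernel, and every row
  of the adjugate of \<open>g\<close> is this vector of principal minors.\<close>

definition minors :: "(nat \<Rightarrow> nat \<Rightarrow> complex) \<Rightarrow> nat \<Rightarrow> complex" where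
  "minors g k = (if k = 0 then g 1 1 * g 2 2 - g 1 2 * g 2 1
     else if k = 1 then g 0 0 * g 2 2 - g 0 2 * g 2 0 else g 0 0 * g 1 1 - g 0 1 * g 1 0)"

definition qf :: "(nat \<Rightarrow> nat \<Rightarrow> complex) \<Rightarrow> vec3 \<Rightarrow> vec3" where
  "qf g x = (\<lambda>i. \<Sum>k<3. g i k * (x k)\<^sup>2)"

text \<open>In the coordinates where the four fixed points off the line are the sign vectors
  \<open>sg 0, \<dots>, sg 3\<close>, the map is \<open>x \<mapsto> (m x) x + qf g x\<close> and the line is \<open>minors g = 0\<close>.\<close>

definition normal_form :: "(nat \<Rightarrow> nat \<Rightarrow> complex) \<Rightarrow> vec3 \<Rightarrow> (nat \<Rightarrow> vec3) \<Rightarrow> (nat \<Rightarrow> complex)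
    \<Rightarrow> (nat \<Rightarrow> complex) \<Rightarrow> (nat \<Rightarrow> complex) \<Rightarrow> bool" where
  "normal_form g m X \<nu> b w \<longleftrightarrow>
     (\<forall>i<3. g i 0 + g i 1 + g i 2 = 0) \<and>
     (\<forall>i<4. lin m (sg i) \<noteq> 0 \<and> b (2 * i) * lin m (sg i) = - 2 * lin (\<lambda>k. g k k) (sg i) \<and>
        b (2 * i + 1) * (lin m (sg i))\<^sup>2 = 4 * lin (minors g) (sg i) \<and> b (2 * i + 1) \<noteq> 0) \<and>
     (\<forall>j<3. nonzero3 (X j) \<and> (\<forall>i<3. qf g (X j) i = \<nu> j * X j i) \<and> \<nu> j \<noteq> 0 \<and> lin m (X j) + \<nu> j \<noteq> 0 \<and>
        w (2 * j) = (3 * \<nu> j - 2 * lin (\<lambda>k. g k k) (X j)) / (lin m (X j) + \<nu> j) \<and>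
        w (2 * j + 1) = \<nu> j / (lin m (X j) + \<nu> j)) \<and>
     (\<forall>j<3. \<forall>k<3. j \<noteq> k \<longrightarrow> \<not> in_span (X j) (X k)) \<and>
     (\<forall>y n. nonzero3 y \<and> lin (minors g) y = 0 \<and> (\<forall>i<3. qf g y i = n * y i) \<longrightarrow> (\<exists>j<3. in_span y (X j)))"

lemma sg_simps [simp]:
  "sg 0 k = 1" "sg (Suc 0) 0 = 1" "sg (Suc 0) (Suc 0) = -1" "sg (Suc 0) 2 = -1" "sg 2 0 = -1" "sg 2 (Suc 0) = 1"
  "sg 2 2 = -1" "sg 3 0 = -1" "sg 3 (Suc 0) = -1" "sg 3 2 = 1"
  by (simp_all add: sg_def)

text \<open>With \<open>D\<close> the diagonal matrix of \<open>sg i\<close>, the matrix is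
  \<open>2 g D\<close> plus a rank-one term, and \<open>g D\<close> is singular. Its determinant is
  thus \<open>m\<close> applied to the adjugate of \<open>2 g D\<close> applied to
  \<open>sg i\<close>; since \<open>det D = 1\<close>, this adjugate is 4 times the column
  \<open>sg i\<close> times the row \<open>minors g\<close>.\<close>

lemma det3_sg:
  assumes "\<forall>i<3. g i 0 + g i 1 + g i 2 = 0" "i < 4"
  shows "det3 (\<lambda>l k. 2 * sg i k * g l k + m k * sg i l) = 4 * lin m (sg i) * lin (minors g) (sg i)"
proof -
  have g: "g 0 2 = - (g 0 0 + g 0 1)" "g 1 2 = - (g 1 0 + g 1 1)" "g 2 2 = - (g 2 0 + g 2 1)"
    using assms(1) by (simp_all add: all3 eq_neg_iff_add_eq_0 algebra_simps)
  have "i = 0 \<or> i = 1 \<or> i = 2 \<or> i = 3" using assms(2) by linarith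
  then show ?thesis
    by (elim disjE) (simp_all add: det3_def lin_def sum3 minors_def g[simplified] algebra_simps)
qed

lemma comb_zero:
  assumes "dt (e 0) (e 1) (e 2) \<noteq> 0" "\<And>l. l < 3 \<Longrightarrow> comb e h l = 0" "k < 3"
  shows "h k = 0"
proof -
  have z: "comb e h 0 = 0" "comb e h 1 = 0" "comb e h 2 = 0" using assms(2) by simp_all
  have "h 0 * dt (e 0) (e 1) (e 2) = dt (comb e h) (e 1) (e 2)"
    "h 1 * dt (e 0) (e 1) (e 2) = dt (e 0) (comb e h) (e 2)"
    "h 2 * dt (e 0) (e 1) (e 2) = dt (e 0) (e 1) (comb e h)"
    by (simp_all add: dt_expand comb_def sum3 algebra_simps)
  then have "h 0 = 0" "h 1 = 0" "h 2 = 0"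
    using assms(1) z by (simp_all add: dt_expand[of "comb e h"] dt_expand[of _ "comb e h"] dt_expand[of _ _ "comb e h"])
  then show ?thesis using assms(3) by (auto simp: eval_nat_numeral less_Suc_eq)
qed

definition coords :: "(nat \<Rightarrow> vec3) \<Rightarrow> vec3 \<Rightarrow> vec3" where
  "coords e x = (\<lambda>k. (if k = 0 then dt x (e 1) (e 2) else if k = 1 then dt (e 0) x (e 2)
     else dt (e 0) (e 1) x) / dt (e 0) (e 1) (e 2))"

lemma comb_coords:
  assumes "dt (e 0) (e 1) (e 2) \<noteq> 0" "l < 3"
  shows "comb e (coords e x) l = x l"
proof -
  have "dt (e 0) (e 1) (e 2) * comb e (coords e x) l
      = dt x (e 1) (e 2) * e 0 l + dt (e 0) x (e 2) * e 1 l + dt (e 0) (e 1) x * e 2 l"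
    using assms(1) by (simp add: comb_def coords_def sum3 distrib_left)
  also have "\<dots> = dt (e 0) (e 1) (e 2) * x l" by (rule dt_cramer[OF assms(2), symmetric])
  finally show ?thesis using assms(1) by simp
qed

lemma comb_linear: "comb e (\<lambda>k. x k + s * y k) l = comb e x l + s * comb e y l"
  by (simp add: comb_def sum3 algebra_simps)

lemma comb_inject:
  assumes "dt (e 0) (e 1) (e 2) \<noteq> 0" "\<And>l. l < 3 \<Longrightarrow> comb e x l = s * comb e y l" "k < 3"
  shows "x k = s * y k"
proof -
  have "comb e (\<lambda>k. x k + (- s) * y k) l = 0" if "l < 3" for l
    unfolding comb_linear using assms(2)[OF that] by simp
  from comb_zero[OF assms(1) this assms(3)] show ?thesis by simp
qed

lemma vec3_cong:
  assumes "\<And>l. l < 3 \<Longrightarrow> x l = y l"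
  shows "qeval a x = qeval a y" "lin c x = lin c y" "jac a x = jac a y"
  using assms by (simp_all add: qeval_def lin_def jac_def sum3)

lemma vec3_scale:
  "qeval a (\<lambda>l. s * x l) i = s\<^sup>2 * qeval a x i" "lin c (\<lambda>l. s * x l) = s * lin c x"
  "jac a (\<lambda>l. s * x l) i j = s * jac a x i j"
  by (simp_all add: qeval_def lin_def jac_def sum3 power2_eq_square algebra_simps)

context invariant_line
begin

lemma four_points_basis:
  assumes p: "\<And>i. i < 4 \<Longrightarrow> fixed_point a (p i)" "\<And>i. i < 4 \<Longrightarrow> lin c (p i) \<noteq> 0"
      "\<And>i. i < 4 \<Longrightarrow> det_IDf a (p i) \<noteq> 0"
    and ns: "\<And>i j. i < 4 \<Longrightarrow> j < 4 \<Longrightarrow> i \<noteq> j \<Longrightarrow> \<not> in_span (p i) (p j)"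
  shows "\<exists>s e. (\<forall>i<4::nat. s i \<noteq> (0::complex)) \<and> dt (e 0) (e 1) (e 2) \<noteq> 0 \<and>
    (\<forall>i<4. \<forall>l<3. s i * p i l = comb e (sg i) l)"
proof -
  have ind: "dt (p i) (p j) (p k) \<noteq> 0" if "i < 4" "j < 4" "k < 4" "i \<noteq> j" "i \<noteq> k" "j \<noteq> k" for i j k
    using that by (intro fixed_points_independent p ns) auto
  \<comment> \<open>Cramer coefficients of the linear relation between the four points: the rescaled
    points \<open>P i\<close> add up to zero, as the sign vectors do.\<close>
  define s where "s = (\<lambda>i::nat. if i = 0 then dt (p 3) (p 1) (p 2) else if i = 1 then dt (p 0) (p 3) (p 2)
    else if i = 2 then dt (p 0) (p 1) (p 3) else - dt (p 0) (p 1) (p 2))"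
  define P where "P = (\<lambda>i l. s i * p i l)"
  have sum: "P 3 l = - (P 0 l + P 1 l + P 2 l)" if "l < 3" for l
    using dt_cramer[OF that, of "p 0" "p 1" "p 2" "p 3"] by (simp add: P_def s_def)
  \<comment> \<open>Dictated by the fact that \<open>sg 0 + sg (Suc k)\<close> is twice the unit
    vector with index \<open>k\<close>.\<close>
  define e where "e = (\<lambda>k l. (P 0 l + P (Suc k) l) / 2)"
  have s: "s i \<noteq> 0" if "i < 4" for i
    using that ind[of 3 1 2] ind[of 0 3 2] ind[of 0 1 3] ind[of 0 1 2] by (auto simp: s_def)
  have "4 * dt (e 0) (e 1) (e 2) = dt (P 0) (P 1) (P 2)"
  proof -
    have e: "e 0 l = (P 0 l + P 1 l) / 2" "e 1 l = (P 0 l + P 2 l) / 2" for l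
      by (simp_all add: e_def eval_nat_numeral)
    have e2: "e 2 l = - (P 1 l + P 2 l) / 2" if "l < 3" for l
      using sum[OF that] by (simp add: e_def eval_nat_numeral)
    have e2': "e 2 0 = - (P 1 0 + P 2 0) / 2" "e 2 1 = - (P 1 1 + P 2 1) / 2" "e 2 2 = - (P 1 2 + P 2 2) / 2"
      using e2 by simp_all
    show ?thesis unfolding dt_expand e e2'
      by (simp add: field_simps)
  qed
  also have "dt (P 0) (P 1) (P 2) = s 0 * s 1 * s 2 * dt (p 0) (p 1) (p 2)"
    by (simp add: P_def dt_expand algebra_simps)
  finally have "dt (e 0) (e 1) (e 2) \<noteq> 0" using s[of 0] s[of 1] s[of 2] ind[of 0 1 2] by auto
  moreover have "s i * p i l = comb e (sg i) l" if "i < 4" "l < 3" for i l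
  proof -
    have e: "e 0 l = (P 0 l + P (Suc 0) l) / 2" "e (Suc 0) l = (P 0 l + P 2 l) / 2"
        "e 2 l = - (P (Suc 0) l + P 2 l) / 2"
      using sum[OF that(2)] by (simp_all add: e_def eval_nat_numeral)
    have "i = 0 \<or> i = 1 \<or> i = 2 \<or> i = 3" using that by linarith
    then have "P i l = comb e (sg i) l"
      by (elim disjE) (simp_all add: comb_def sum3 e sum[OF that(2), unfolded One_nat_def] field_simps)
    then show ?thesis by (simp add: P_def)
  qed
  ultimately show ?thesis using s by blast
qed

text \<open>On the monomials \<open>x0 x1\<close>, \<open>x0 x2\<close>, \<open>x1 x2\<close> and a
  constant, the four sign vectors take the values of a 4 x 4 Hadamard matrix. Vanishing at all of
  them therefore kills each mixed coefficient and the sum of the square coefficients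
  separately.\<close>

lemma diagonal_form:
  assumes D: "dt (e 0) (e 1) (e 2) \<noteq> 0"
    and z: "\<And>i l. i < 4 \<Longrightarrow> l < 3 \<Longrightarrow> qeval a (comb e (sg i)) l = lin m (comb e (sg i)) * comb e (sg i) l"
  shows "\<exists>g. (\<forall>i<3. g i 0 + g i 1 + g i 2 = 0) \<and>
    (\<forall>x. \<forall>l<3. qeval a (comb e x) l = lin m (comb e x) * comb e x l + comb e (qf g x) l) \<and>
    (\<forall>x. \<forall>l<3. \<forall>k<3. mv (jac a (comb e x)) (e k) l = comb e (\<lambda>i. 2 * x k * g i k
        + (if i = k then lin m (comb e x) else 0) + lin m (e k) * x i) l)"
proof -
  define G where "G = (\<lambda>k l. qeval a (e k) l - lin m (e k) * e k l)"
  define B where "B = (\<lambda>j k l. mv (jac a (e j)) (e k) l - lin m (e j) * e k l - lin m (e k) * e j l)"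
  have linc: "lin m (comb e x) = x 0 * lin m (e 0) + x 1 * lin m (e 1) + x 2 * lin m (e 2)" for x
    by (simp add: comb_def lin_def sum3 algebra_simps)
  have expand: "qeval a (comb e x) l - lin m (comb e x) * comb e x l
      = (x 0)\<^sup>2 * G 0 l + (x 1)\<^sup>2 * G 1 l + (x 2)\<^sup>2 * G 2 l
        + x 0 * x 1 * B 0 1 l + x 0 * x 2 * B 0 2 l + x 1 * x 2 * B 1 2 l" for x l
  proof -
    have "qeval a (comb e x) l = (x 0)\<^sup>2 * qeval a (e 0) l + (x 1)\<^sup>2 * qeval a (e 1) l + (x 2)\<^sup>2 * qeval a (e 2) l
        + x 0 * x 1 * mv (jac a (e 0)) (e 1) l + x 0 * x 2 * mv (jac a (e 0)) (e 2) l
        + x 1 * x 2 * mv (jac a (e 1)) (e 2) l"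
      by (simp add: comb_def qeval_def mv_def jac_def sum3 power2_eq_square algebra_simps)
    moreover have "comb e x l = x 0 * e 0 l + x 1 * e 1 l + x 2 * e 2 l" by (simp add: comb_def sum3)
    ultimately show ?thesis unfolding linc G_def B_def by (simp add: power2_eq_square algebra_simps)
  qed
  have eqs: "G 0 l + G 1 l + G 2 l = 0" "B 0 1 l = 0" "B 0 2 l = 0" "B 1 2 l = 0" if l: "l < 3" for l
  proof -
    have E: "G 0 l + G 1 l + G 2 l + B 0 1 l + B 0 2 l + B 1 2 l = 0"
      "G 0 l + G 1 l + G 2 l - B 0 1 l - B 0 2 l + B 1 2 l = 0"
      "G 0 l + G 1 l + G 2 l - B 0 1 l + B 0 2 l - B 1 2 l = 0"
      "G 0 l + G 1 l + G 2 l + B 0 1 l - B 0 2 l - B 1 2 l = 0"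
      using expand[of "sg 0" l] expand[of "sg 1" l] expand[of "sg 2" l] expand[of "sg 3" l]
        z[OF _ l, of 0] z[OF _ l, of 1] z[OF _ l, of 2] z[OF _ l, of 3] by simp_all
    have "4 * (G 0 l + G 1 l + G 2 l) = 0" "4 * B 0 1 l = 0" "4 * B 0 2 l = 0" "4 * B 1 2 l = 0"
      using E by algebra+
    then show "G 0 l + G 1 l + G 2 l = 0" "B 0 1 l = 0" "B 0 2 l = 0" "B 1 2 l = 0"
      by (simp_all only: mult_eq_0_iff numeral_neq_zero simp_thms)
  qed
  define g where "g = (\<lambda>i k. coords e (G k) i)"
  have Gg: "comb e (\<lambda>i. g i k) l = G k l" if "l < 3" for k l
    unfolding g_def using comb_coords[OF D that] by simp
  have "g i 0 + g i 1 + g i 2 = 0" if "i < 3" for i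
  proof -
    have "comb e (\<lambda>i. g i 0 + g i 1 + g i 2) l = 0" if "l < 3" for l
    proof -
      have "comb e (\<lambda>i. g i 0 + g i 1 + g i 2) l = comb e (\<lambda>i. g i 0) l + comb e (\<lambda>i. g i 1) l + comb e (\<lambda>i. g i 2) l"
        by (simp add: comb_def sum3 algebra_simps)
      then show ?thesis using eqs(1)[OF that] Gg[OF that] by simp
    qed
    from comb_zero[OF D this that] show ?thesis .
  qed
  moreover have "qeval a (comb e x) l = lin m (comb e x) * comb e x l + comb e (qf g x) l" if "l < 3" for x l
  proof -
    have "comb e (qf g x) l = (x 0)\<^sup>2 * comb e (\<lambda>i. g i 0) l + (x 1)\<^sup>2 * comb e (\<lambda>i. g i 1) l + (x 2)\<^sup>2 * comb e (\<lambda>i. g i 2) l"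
      by (simp add: comb_def qf_def sum3 algebra_simps)
    then show ?thesis using expand[of x l] eqs[OF that] Gg[OF that] by (simp add: algebra_simps)
  qed
  moreover have "mv (jac a (comb e x)) (e k) l = comb e (\<lambda>i. 2 * x k * g i k
        + (if i = k then lin m (comb e x) else 0) + lin m (e k) * x i) l" if l: "l < 3" and k: "k < 3" for x l k
  proof -
    have mix: "mv (jac a (e i)) (e j) l = lin m (e i) * e j l + lin m (e j) * e i l"
      if "i < 3" "j < 3" "i \<noteq> j" for i j
    proof -
      have "B 0 1 l = 0" "B 0 2 l = 0" "B 1 2 l = 0" using eqs[OF l] by simp_all
      moreover have "B j i l = B i j l" by (simp add: B_def jac_sym)
      ultimately show ?thesis using that unfolding B_def
        by (auto simp: eval_nat_numeral less_Suc_eq algebra_simps)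
    qed
    have self: "mv (jac a (e k)) (e k) l = 2 * G k l + 2 * lin m (e k) * e k l"
      by (simp add: jac_self G_def)
    have "mv (jac a (comb e x)) (e k) l = x 0 * mv (jac a (e 0)) (e k) l + x 1 * mv (jac a (e 1)) (e k) l
        + x 2 * mv (jac a (e 2)) (e k) l"
      by (simp add: comb_def mv_def jac_def sum3 algebra_simps)
    moreover have "comb e (\<lambda>i. 2 * x k * g i k + (if i = k then lin m (comb e x) else 0) + lin m (e k) * x i) l
        = 2 * x k * G k l + lin m (comb e x) * e k l + lin m (e k) * comb e x l"
    proof -
      have "k = 0 \<or> k = 1 \<or> k = 2" using k by linarith
      then show ?thesis unfolding Gg[OF l, symmetric]
        by (elim disjE) (simp_all add: comb_def sum3 algebra_simps)
    qed
    moreover have "comb e x l = x 0 * e 0 l + x 1 * e 1 l + x 2 * e 2 l" by (simp add: comb_def sum3)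
    moreover have "k = 0 \<or> k = 1 \<or> k = 2" using k by linarith
    ultimately show ?thesis unfolding linc using self mix[of 0 1] mix[of 0 2] mix[of 1 0] mix[of 1 2]
      mix[of 2 0] mix[of 2 1]
      by (elim disjE) (simp_all add: algebra_simps)
  qed
  ultimately show ?thesis by blast
qed

lemma normal_form_exists:
  assumes fp: "\<And>i. i < 7 \<Longrightarrow> fixed_point a (p i)"
    and nd: "\<And>x. fixed_point a x \<Longrightarrow> det_IDf a x \<noteq> 0"
    and ns: "\<And>i j. i < 7 \<Longrightarrow> j < 7 \<Longrightarrow> i \<noteq> j \<Longrightarrow> \<not> in_span (p i) (p j)"
    and off: "\<And>i. i < 4 \<Longrightarrow> lin c (p i) \<noteq> 0" and on: "\<And>j. j < 3 \<Longrightarrow> lin c (p (4 + j)) = 0"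
    and all: "\<And>x. fixed_point a x \<Longrightarrow> \<exists>i<7. in_span x (p i)"
    and b: "\<And>i. i < 4 \<Longrightarrow> b (2 * i) = trace_IDf a (p i) \<and> b (2 * i + 1) = det_IDf a (p i)"
    and w: "\<And>j. j < 3 \<Longrightarrow> w (2 * j) = u_val a c (p (4 + j)) \<and> w (2 * j + 1) = v_val a c (p (4 + j))"
  shows "\<exists>g m' X \<nu>. normal_form g m' X \<nu> b w"
proof -
  have "\<exists>s e. (\<forall>i<4::nat. s i \<noteq> (0::complex)) \<and> dt (e 0) (e 1) (e 2) \<noteq> 0 \<and>
      (\<forall>i<4. \<forall>l<3. s i * p i l = comb e (sg i) l)"
    by (rule four_points_basis) (use fp nd ns off in auto)
  then obtain s e where s': "\<forall>i<4::nat. s i \<noteq> (0::complex)" and D: "dt (e 0) (e 1) (e 2) \<noteq> 0"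
    and P': "\<forall>i<4. \<forall>l<3. s i * p i l = comb e (sg i) l" by blast
  note s = s'[rule_format] and P = P'[rule_format, symmetric]
  have PP: "qeval a (comb e (sg i)) l = (s i)\<^sup>2 * qeval a (p i) l" "lin d (comb e (sg i)) = s i * lin d (p i)"
    "jac a (comb e (sg i)) l k = s i * jac a (p i) l k" if "i < 4" for i l k d
    using vec3_cong[of "comb e (sg i)" "\<lambda>l. s i * p i l"] P[OF that] by (simp_all add: vec3_scale)
  have mult: "fp_mult a (p i) = lin m (p i)" "lin m (p i) \<noteq> 0" if "i < 4" for i
    using fp_mult_off_line[of "p i"] fixed_point_mult(2)[of "p i"] fp off that by auto
  have "qeval a (comb e (sg i)) l = lin m (comb e (sg i)) * comb e (sg i) l" if "i < 4" "l < 3" for i l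
    using fixed_point_mult(1)[of "p i" l] fp[of i] mult(1)[OF that(1)] that
    by (simp add: PP[OF that(1)] P[OF that] power2_eq_square)
  from diagonal_form[OF D this] obtain g where rows: "\<forall>i<3. g i 0 + g i 1 + g i 2 = 0"
    and F: "\<And>x l. l < 3 \<Longrightarrow> qeval a (comb e x) l = lin m (comb e x) * comb e x l + comb e (qf g x) l"
    and J: "\<And>x l k. l < 3 \<Longrightarrow> k < 3 \<Longrightarrow> mv (jac a (comb e x)) (e k) l = comb e (\<lambda>i. 2 * x k * g i k
        + (if i = k then lin m (comb e x) else 0) + lin m (e k) * x i) l"
    by blast
  define m' where "m' = (\<lambda>k. lin m (e k))"
  have lm: "lin m (comb e x) = lin m' x" for x
    by (simp add: m'_def comb_def lin_def sum3 algebra_simps)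
  have tr: "tr3 (jac a (comb e x)) = 2 * lin (\<lambda>k. g k k) x + 4 * lin m' x" for x
  proof -
    have "tr3 (jac a (comb e x)) = tr3 (\<lambda>i k. 2 * x k * g i k + (if i = k then lin m (comb e x) else 0) + m' k * x i)"
      by (rule matrix_in_basis(1)[OF D]) (unfold m'_def, rule J)
    then show ?thesis unfolding lm by (simp add: tr3_def lin_def sum3 algebra_simps)
  qed
  have spec: "lin m' (sg i) \<noteq> 0" "b (2 * i) * lin m' (sg i) = - 2 * lin (\<lambda>k. g k k) (sg i)"
    "b (2 * i + 1) * (lin m' (sg i))\<^sup>2 = 4 * lin (minors g) (sg i)" "b (2 * i + 1) \<noteq> 0" if i: "i < 4" for i
  proof -
    show mu: "lin m' (sg i) \<noteq> 0"
      using PP(2)[OF i, of m] s[OF i] mult(2)[OF i] by (simp add: lm)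
    have d: "dmat a (p i) l k = jac a (comb e (sg i)) l k / lin m' (sg i)" for l k
      using s[OF i] mult[OF i] by (simp add: dmat_def PP(3)[OF i] lm[symmetric] PP(2)[OF i])
    have "trace_IDf a (p i) = 4 - tr3 (jac a (comb e (sg i))) / lin m' (sg i)"
      by (simp add: trace_IDf_def tr3_def d add_divide_distrib)
    then show "b (2 * i) * lin m' (sg i) = - 2 * lin (\<lambda>k. g k k) (sg i)"
      using mu b[OF i] by (simp add: tr field_simps)
    let ?N = "\<lambda>l k. 2 * sg i k * g l k + m' k * sg i l"
    have "det3 (\<lambda>l k. (if l = k then 1 else 0) - dmat a (p i) l k) = det3 (\<lambda>l k. - ?N l k / lin m' (sg i))"
    proof (rule matrix_in_basis(2)[OF D])
      fix l k :: nat assume lk: "l < 3" "k < 3"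
      have "mv (\<lambda>l k. (if l = k then 1 else 0) - dmat a (p i) l k) (e k) l
          = e k l - mv (jac a (comb e (sg i))) (e k) l / lin m' (sg i)"
      proof -
        have "l = 0 \<or> l = 1 \<or> l = 2" using lk by linarith
        then show ?thesis by (elim disjE) (simp_all add: mv_def sum3 d left_diff_distrib add_divide_distrib)
      qed
      also have "\<dots> = comb e (\<lambda>j. - ?N j k / lin m' (sg i)) l"
      proof -
        have "k = 0 \<or> k = 1 \<or> k = 2" using lk by linarith
        moreover have "lin m (e k) = m' k" by (simp add: m'_def)
        ultimately show ?thesis using mu unfolding J[OF lk] lm
          by (elim disjE) (simp_all add: comb_def sum3 field_simps)
      qed
      finally show "mv (\<lambda>l k. (if l = k then 1 else 0) - dmat a (p i) l k) (e k) l
          = comb e (\<lambda>j. - ?N j k / lin m' (sg i)) l" .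
    qed
    also have "\<dots> = - det3 ?N / lin m' (sg i) ^ 3"
      by (rule det3_uminus_divide)
    also have "det3 ?N = 4 * lin m' (sg i) * lin (minors g) (sg i)" by (rule det3_sg[OF rows i])
    finally have "det_IDf a (p i) * (lin m' (sg i))\<^sup>2 = 4 * lin (minors g) (sg i)"
      using mu by (simp add: det_IDf_def power2_eq_square power3_eq_cube field_simps)
    then show "b (2 * i + 1) * (lin m' (sg i))\<^sup>2 = 4 * lin (minors g) (sg i)" using b[OF i] by simp
    show "b (2 * i + 1) \<noteq> 0" using b[OF i] nd fp i by simp
  qed
  define X where "X = (\<lambda>j. coords e (p (4 + j)))"
  define \<nu> where "\<nu> = (\<lambda>j. fp_mult a (p (4 + j)) - lin m (p (4 + j)))"
  have X: "comb e (X j) l = p (4 + j) l" if "l < 3" for j l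
    unfolding X_def by (rule comb_coords[OF D that])
  have XX: "qeval a (comb e (X j)) = qeval a (p (4 + j))" "lin d (comb e (X j)) = lin d (p (4 + j))"
    "jac a (comb e (X j)) = jac a (p (4 + j))" for j d
    using vec3_cong[of "comb e (X j)" "p (4 + j)"] X by simp_all
  have nz: "nonzero3 x \<longleftrightarrow> nonzero3 (comb e x)" for x
  proof
    assume x: "nonzero3 x"
    show "nonzero3 (comb e x)"
    proof (rule ccontr)
      assume "\<not> nonzero3 (comb e x)"
      then have "comb e x l = 0" if "l < 3" for l using that by (auto simp: nonzero3_def)
      from comb_zero[OF D this] show False using x by (auto simp: nonzero3_def)
    qed
  next
    assume "nonzero3 (comb e x)"
    then show "nonzero3 x" unfolding nonzero3_def ex3 comb_def sum3 by auto
  qed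
  have span: "in_span x y \<longleftrightarrow> in_span (comb e x) (comb e y)" for x y
  proof
    assume "in_span x y"
    then obtain r where "\<forall>i<3. x i = r * y i" by (auto simp: in_span_def)
    then show "in_span (comb e x) (comb e y)"
      unfolding in_span_def by (intro exI[of _ r]) (simp add: comb_def sum3 algebra_simps)
  next
    assume "in_span (comb e x) (comb e y)"
    then obtain r where r: "\<forall>i<3. comb e x i = r * comb e y i" by (auto simp: in_span_def)
    have "x k = r * y k" if "k < 3" for k by (rule comb_inject[OF D r[rule_format] that])
    then show "in_span x y" unfolding in_span_def by blast
  qed
  have spanX: "in_span y (X j) \<longleftrightarrow> in_span (comb e y) (p (4 + j))" for y j
    unfolding span[of y "X j"] using X by (simp add: in_span_def)
  have line: "nonzero3 (X j)" "\<And>i. i < 3 \<Longrightarrow> qf g (X j) i = \<nu> j * X j i" "\<nu> j \<noteq> 0" "lin m' (X j) + \<nu> j \<noteq> 0"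
    "w (2 * j) = (3 * \<nu> j - 2 * lin (\<lambda>k. g k k) (X j)) / (lin m' (X j) + \<nu> j)"
    "w (2 * j + 1) = \<nu> j / (lin m' (X j) + \<nu> j)" if j: "j < 3" for j
  proof -
    let ?p = "p (4 + j)"
    have fj: "fixed_point a ?p" using fp j by simp
    note f = fixed_point_mult[OF fj]
    have lam: "lin m' (X j) + \<nu> j = fp_mult a ?p" by (simp add: \<nu>_def lm[symmetric] XX)
    have "nonzero3 (comb e (X j))" using f(3) X unfolding nonzero3_def ex3 by simp
    then show "nonzero3 (X j)" using nz by simp
    show "qf g (X j) i = \<nu> j * X j i" if "i < 3" for i
    proof (rule comb_inject[OF D _ that])
      fix l :: nat assume l: "l < 3"
      show "comb e (qf g (X j)) l = \<nu> j * comb e (X j) l"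
        using F[OF l, of "X j"] f(1)[OF l] X[OF l] by (simp add: XX \<nu>_def algebra_simps)
    qed
    show "\<nu> j \<noteq> 0" using nondegenerate_on_line[OF fj on[OF j] nd[OF fj]] by (simp add: \<nu>_def)
    show "lin m' (X j) + \<nu> j \<noteq> 0" using lam f(2) by simp
    note sp = spectrum_on_line[OF fj on[OF j]]
    have mx: "lin m ?p = lin m' (X j)" by (simp add: lm[symmetric] XX)
    have trx: "tr3 (jac a ?p) = 2 * lin (\<lambda>k. g k k) (X j) + 4 * lin m' (X j)"
      using tr[of "X j"] by (simp add: XX)
    have nux: "\<nu> j = fp_mult a ?p - lin m' (X j)" by (simp add: \<nu>_def mx)
    show "w (2 * j + 1) = \<nu> j / (lin m' (X j) + \<nu> j)"
      unfolding lam conjunct2[OF w[OF j]] sp(1) mx nux using f(2) by (simp add: field_simps)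
    show "w (2 * j) = (3 * \<nu> j - 2 * lin (\<lambda>k. g k k) (X j)) / (lin m' (X j) + \<nu> j)"
      unfolding lam conjunct1[OF w[OF j]] sp(2) mx trx nux using f(2) by (simp add: field_simps)
  qed
  have indep: "\<not> in_span (X j) (X k)" if "j < 3" "k < 3" "j \<noteq> k" for j k
    unfolding spanX using ns[of "4 + j" "4 + k"] that X by (simp add: in_span_def)
  have complete: "\<exists>j<3. in_span y (X j)"
    if y: "nonzero3 y" "lin (minors g) y = 0" "\<forall>i<3. qf g y i = n * y i" for y n
  proof -
    have "qeval a (comb e y) l = (lin m (comb e y) + n) * comb e y l" if l: "l < 3" for l
    proof -
      have "comb e (qf g y) l = n * comb e y l" using y(3) by (simp add: comb_def sum3 algebra_simps)
      then show ?thesis using F[OF l, of y] by (simp add: algebra_simps)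
    qed
    then have "\<forall>l<3. qeval a (comb e y) l = (lin m (comb e y) + n) * comb e y l" by blast
    moreover have "nonzero3 (comb e y)" using nz[of y] y(1) by simp
    ultimately have "fixed_point a (comb e y)" unfolding fixed_point_def by blast
    then obtain i where i: "i < 7" "in_span (comb e y) (p i)" using all by blast
    show ?thesis
    proof (cases "i < 4")
      \<comment> \<open>A point with \<open>minors g = 0\<close> proportional to \<open>sg i\<close>
        would make the determinant \<open>d i\<close> vanish, against nondegeneracy.\<close>
      case True
      obtain r where r: "\<forall>l<3. comb e y l = r * p i l" using i(2) by (auto simp: in_span_def)
      have "comb e y l = r / s i * comb e (sg i) l" if "l < 3" for l
        using r that s[OF True] P[OF True that] by simp
      then have "y k = r / s i * sg i k" if "k < 3" for k by (rule comb_inject[OF D _ that])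
      then have yk: "y 0 = r / s i * sg i 0" "y 1 = r / s i * sg i 1" "y 2 = r / s i * sg i 2" by simp_all
      then have "lin d y = r / s i * lin d (sg i)" for d
        unfolding lin_def sum3 yk by (simp add: distrib_left mult_ac)
      moreover have "r \<noteq> 0" using y(1) yk unfolding nonzero3_def ex3 by auto
      ultimately have "lin (minors g) (sg i) = 0" using y s[OF True] by auto
      then show ?thesis using spec[OF True] by simp
    next
      case False
      then obtain j where j: "i = 4 + j" using le_Suc_ex[of 4 i] by auto
      then show ?thesis using i by (intro exI[of _ j]) (simp add: spanX)
    qed
  qed
  have "normal_form g m' X \<nu> b w"
    unfolding normal_form_def
  proof (intro conjI)
    show "\<forall>i<4. lin m' (sg i) \<noteq> 0 \<and> b (2 * i) * lin m' (sg i) = - 2 * lin (\<lambda>k. g k k) (sg i) \<and>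
        b (2 * i + 1) * (lin m' (sg i))\<^sup>2 = 4 * lin (minors g) (sg i) \<and> b (2 * i + 1) \<noteq> 0"
      by (intro allI impI conjI spec)
    show "\<forall>j<3. nonzero3 (X j) \<and> (\<forall>i<3. qf g (X j) i = \<nu> j * X j i) \<and> \<nu> j \<noteq> 0 \<and>
        lin m' (X j) + \<nu> j \<noteq> 0 \<and>
        w (2 * j) = (3 * \<nu> j - 2 * lin (\<lambda>k. g k k) (X j)) / (lin m' (X j) + \<nu> j) \<and>
        w (2 * j + 1) = \<nu> j / (lin m' (X j) + \<nu> j)"
      by (intro allI impI conjI line)
    show "\<forall>j<3. \<forall>k<3. j \<noteq> k \<longrightarrow> \<not> in_span (X j) (X k)"
      by (intro allI impI indep)
    show "\<forall>y n. nonzero3 y \<and> lin (minors g) y = 0 \<and> (\<forall>i<3. qf g y i = n * y i) \<longrightarrow>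
        (\<exists>j<3. in_span y (X j))"
      by (intro allI impI, elim conjE, rule complete)
  qed (rule rows)
  then show ?thesis by (intro exI)
qed

end

lemma E4_normal_form:
  assumes "E4 c a pt"
  shows "\<exists>g m X \<nu>. normal_form g m X \<nu> (specB a pt) (specF c a pt)"
proof -
  note E = assms[unfolded E4_def]
  note E1 = conjunct2[OF E] and E2 = conjunct2[OF conjunct2[OF E]]
  note E3 = conjunct2[OF E2]
  note E4 = conjunct2[OF E3]
  note E5 = conjunct2[OF E4]
  note E6 = conjunct2[OF E5]
  note E7 = conjunct2[OF E6]
  note fixed = conjunct1[OF E4, rule_format] and nondeg = conjunct1[OF E3, rule_format]
    and distinct = conjunct1[OF E5, rule_format] and off = conjunct1[OF E6, rule_format]
    and on = conjunct1[OF E7, rule_format] and all = conjunct2[OF E7, rule_format]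
  from invariant_line_cofactor[OF conjunct1[OF E] conjunct1[OF E2]]
  obtain m where m: "\<forall>x. lin c (qeval a x) = lin c x * lin m x" ..
  interpret invariant_line c m a
    by unfold_locales (rule conjunct1[OF E] conjunct1[OF E1] m[rule_format])+
  have i7: "Suc i \<in> {1..7}" if "i < 7" for i using that by auto
  show ?thesis
  proof (rule normal_form_exists[where p = "\<lambda>i. pt (Suc i)"])
    show "fixed_point a (pt (Suc i))" if "i < 7" for i by (rule fixed[OF i7[OF that]])
    show "det_IDf a x \<noteq> 0" if "fixed_point a x" for x by (rule nondeg[OF that])
    show "\<not> in_span (pt (Suc i)) (pt (Suc j))" if "i < 7" "j < 7" "i \<noteq> j" for i j
      using that(3) by (intro distinct i7 that(1,2)) simp
    show "lin c (pt (Suc i)) \<noteq> 0" if "i < 4" for i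
      using that by (intro off) auto
    show "lin c (pt (Suc (4 + j))) = 0" if "j < 3" for j
      using that by (intro on) auto
    show "\<exists>i<7. in_span x (pt (Suc i))" if "fixed_point a x" for x
    proof -
      from all[OF that] obtain i where "i \<in> {1..7}" "in_span x (pt i)" ..
      then show ?thesis by (intro exI[of _ "i - 1"]) auto
    qed
    show "specB a pt (2 * i) = trace_IDf a (pt (Suc i)) \<and> specB a pt (2 * i + 1) = det_IDf a (pt (Suc i))"
      for i by (simp add: specB_def)
    show "specF c a pt (2 * j) = u_val a c (pt (Suc (4 + j))) \<and>
        specF c a pt (2 * j + 1) = v_val a c (pt (Suc (4 + j)))" for j
      by (simp add: specF_def add.commute)
  qed
qed

subsection \<open>A chart of the invariant line\<close>

text \<open>\<open>chart_l1 r\<close> and \<open>chart_l2 r\<close> are linear forms; on the line \<open>C = 0\<close> their dual basis is, up to the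
  factor \<open>chart_det C r\<close>, formed by \<open>chart_e C r\<close> and \<open>chart_f C r\<close>. The parameter \<open>r\<close> is only there to
  make all nondegeneracy conditions hold for all but finitely many \<open>r\<close>.\<close>

definition chart_l1 :: "complex \<Rightarrow> vec3 \<Rightarrow> complex" where
  "chart_l1 r v = v 1 + 2 * r * v 2"

text \<open>A polynomial in \<open>r\<close> whose coefficients are the coordinates of
  \<open>v\<close>, hence nonzero for almost all \<open>r\<close> as soon as \<open>v\<close> is
  nonzero; \<open>chart_l1\<close> is its derivative in \<open>r\<close>.\<close>

definition chart_l2 :: "complex \<Rightarrow> vec3 \<Rightarrow> complex" where
  "chart_l2 r v = v 0 + r * v 1 + r\<^sup>2 * v 2"

text \<open>Up to sign, the cross product of \<open>C\<close> with the coefficient vector of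
  \<open>chart_l2\<close>; \<open>chart_f\<close> is that of \<open>C\<close> with the coefficient
  vector of \<open>chart_l1\<close>.\<close>

definition chart_e :: "vec3 \<Rightarrow> complex \<Rightarrow> vec3" where
  "chart_e C r k = (if k = 0 then r * C 2 - r\<^sup>2 * C 1 else if k = 1 then r\<^sup>2 * C 0 - C 2 else C 1 - r * C 0)"

definition chart_f :: "vec3 \<Rightarrow> complex \<Rightarrow> vec3" where
  "chart_f C r k = (if k = 0 then 2 * r * C 1 - C 2 else if k = 1 then - 2 * r * C 0 else C 0)"

definition chart_det :: "vec3 \<Rightarrow> complex \<Rightarrow> complex" where
  "chart_det C r = - C 2 + 2 * r * C 1 - r\<^sup>2 * C 0"

definition chart_pt :: "vec3 \<Rightarrow> complex \<Rightarrow> complex \<Rightarrow> vec3" where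
  "chart_pt C r z k = z * chart_e C r k + chart_f C r k"

definition qbil :: "(nat \<Rightarrow> nat \<Rightarrow> complex) \<Rightarrow> vec3 \<Rightarrow> vec3 \<Rightarrow> vec3" where
  "qbil g x y i = (\<Sum>k<3. g i k * (x k * y k))"

lemma chart_decompose:
  assumes "lin C x = 0" "k < 3"
  shows "chart_det C r * x k = chart_l1 r x * chart_e C r k + chart_l2 r x * chart_f C r k"
proof -
  have z: "C 0 * x 0 + C 1 * x 1 + C 2 * x 2 = 0" using assms(1) by (simp add: lin_def sum3)
  have "chart_l1 r x * chart_e C r 0 + chart_l2 r x * chart_f C r 0 - chart_det C r * x 0
      = 2 * r * (C 0 * x 0 + C 1 * x 1 + C 2 * x 2) * 0 + (r\<^sup>2 * (C 0 * x 0 + C 1 * x 1 + C 2 * x 2))"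
    "chart_l1 r x * chart_e C r 1 + chart_l2 r x * chart_f C r 1 - chart_det C r * x 1
      = - 2 * r * (C 0 * x 0 + C 1 * x 1 + C 2 * x 2)"
    "chart_l1 r x * chart_e C r 2 + chart_l2 r x * chart_f C r 2 - chart_det C r * x 2
      = C 0 * x 0 + C 1 * x 1 + C 2 * x 2"
    by (simp_all add: chart_l1_def chart_l2_def chart_e_def chart_f_def chart_det_def
      power2_eq_square algebra_simps)
  moreover have "k = 0 \<or> k = 1 \<or> k = 2" using assms(2) by linarith
  ultimately show ?thesis unfolding z by auto
qed

lemma chart_e_props: "lin C (chart_e C r) = 0" "chart_l1 r (chart_e C r) = chart_det C r"
  "chart_l2 r (chart_e C r) = 0"
  by (simp_all add: lin_def sum3 chart_l1_def chart_l2_def chart_e_def chart_det_def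
    power2_eq_square algebra_simps)

lemma qf_chart_pt:
  "qf g (chart_pt C r z) i = z\<^sup>2 * qf g (chart_e C r) i + 2 * z * qbil g (chart_e C r) (chart_f C r) i
    + qf g (chart_f C r) i"
  by (simp add: qf_def qbil_def sum3 chart_pt_def power2_eq_square algebra_simps)

lemma qf_scale: "qf g (\<lambda>k. s * x k) i = s\<^sup>2 * qf g x i"
  by (simp add: qf_def sum3 power_mult_distrib algebra_simps)

lemma qf_cong: "(\<And>k. k < 3 \<Longrightarrow> x k = y k) \<Longrightarrow> qf g x = qf g y"
  by (simp add: qf_def sum3)

text \<open>The product of the adjugate with the singular matrix \<open>g\<close> is zero, and
  \<open>minors g\<close> is a row of that adjugate.\<close>

lemma minors_left_kernel:
  assumes "\<forall>i<3. g i 0 + g i 1 + g i 2 = 0" "k < 3"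
  shows "minors g 0 * g 0 k + minors g 1 * g 1 k + minors g 2 * g 2 k = 0"
proof -
  have g: "g 0 2 = - (g 0 0 + g 0 1)" "g 1 2 = - (g 1 0 + g 1 1)" "g 2 2 = - (g 2 0 + g 2 1)"
    using assms(1) by (simp_all add: all3 eq_neg_iff_add_eq_0 algebra_simps)
  have "k = 0 \<or> k = 1 \<or> k = 2" using assms(2) by linarith
  then show ?thesis unfolding minors_def
    by (elim disjE) (simp_all add: g[unfolded One_nat_def] algebra_simps)
qed

lemma lin_minors_qf:
  assumes "\<forall>i<3. g i 0 + g i 1 + g i 2 = 0"
  shows "lin (minors g) (qf g x) = 0"
proof -
  have "lin (minors g) (qf g x) = (\<Sum>k<3. (minors g 0 * g 0 k + minors g 1 * g 1 k + minors g 2 * g 2 k) * (x k)\<^sup>2)"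
    by (simp add: lin_def qf_def sum3 algebra_simps)
  then show ?thesis using minors_left_kernel[OF assms] by simp
qed

text \<open>Subtracting \<open>k3 * (z - z0) * (z - z1) * (z - z2)\<close> leaves a polynomial of
  degree at most two with three zeros.\<close>

lemma cubic_roots3:
  fixes k3 k2 k1 k0 z0 z1 z2 :: complex
  assumes "z0 \<noteq> z1" "z0 \<noteq> z2" "z1 \<noteq> z2"
    and z: "\<And>z. z \<in> {z0, z1, z2} \<Longrightarrow> k3 * z ^ 3 + k2 * z\<^sup>2 + k1 * z + k0 = 0"
  shows "roots3 k3 k2 k1 k0 z0 z1 z2"
proof -
  define P where "P = [:k0 + k3 * (z0 * z1 * z2), k1 - k3 * (z0 * z1 + z0 * z2 + z1 * z2), k2 + k3 * (z0 + z1 + z2):]"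
  have P: "poly P z = k3 * z ^ 3 + k2 * z\<^sup>2 + k1 * z + k0 - k3 * ((z - z0) * (z - z1) * (z - z2))" for z
    by (simp add: P_def power2_eq_square power3_eq_cube algebra_simps)
  have "{z0, z1, z2} \<subseteq> {z. poly P z = 0}" using z unfolding P by auto
  moreover have "card {z0, z1, z2} = 3" using assms(1-3) by simp
  moreover have "degree P \<le> 2" by (simp add: P_def)
  ultimately have "P = 0"
    using card_poly_roots_bound[of P] poly_roots_finite[of P] card_mono[of "{z. poly P z = 0}" "{z0, z1, z2}"]
    by (cases "P = 0") auto
  then show ?thesis by (simp add: P_def roots3_def eq_neg_iff_add_eq_0 algebra_simps)
qed

text \<open>\<open>chart_l2\<close> takes the value \<open>chart_det C r\<close> at every chart
  point, so at a fixed point this is \<open>chart_det C r\<close> times the eigenvalue of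
  \<open>qf g\<close>. The next two definitions carry the same factor, which cancels in the
  quotients.\<close>

definition chart_nu where "chart_nu g C r z = chart_l2 r (qf g (chart_pt C r z))"
definition chart_den where
  "chart_den g m C r z = chart_det C r * lin m (chart_pt C r z) + chart_nu g C r z"
definition chart_num where
  "chart_num g C r z = 3 * chart_nu g C r z - 2 * chart_det C r * lin (\<lambda>k. g k k) (chart_pt C r z)"

text \<open>\<open>qf g\<close> takes values in the plane of the line, so a chart point is fixed
  when the ratio of \<open>chart_l1\<close> to \<open>chart_l2\<close> of its image is again
  \<open>z\<close>; clearing the denominator yields the cubic.\<close>

lemma chart_fixed_points:
  assumes nf: "normal_form g m X \<nu> b w"
    and C: "\<And>k. k < 3 \<Longrightarrow> minors g k = \<kappa> * C k" "\<kappa> \<noteq> 0"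
    and r: "chart_det C r \<noteq> 0" "\<And>j. j < 3 \<Longrightarrow> chart_l2 r (X j) \<noteq> 0"
  defines "z \<equiv> \<lambda>j. chart_l1 r (X j) / chart_l2 r (X j)"
  shows "chart_l2 r (qf g (chart_e C r)) \<noteq> 0"
    and "roots3 (- chart_l2 r (qf g (chart_e C r)))
      (chart_l1 r (qf g (chart_e C r)) - 2 * chart_l2 r (qbil g (chart_e C r) (chart_f C r)))
      (2 * chart_l1 r (qbil g (chart_e C r) (chart_f C r)) - chart_l2 r (qf g (chart_f C r)))
      (chart_l1 r (qf g (chart_f C r))) (z 0) (z 1) (z 2)"
    and "z 0 \<noteq> z 1" "z 0 \<noteq> z 2" "z 1 \<noteq> z 2"
    and "j < 3 \<Longrightarrow> chart_den g m C r (z j) \<noteq> 0"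
    and "j < 3 \<Longrightarrow> w (2 * j) = chart_num g C r (z j) / chart_den g m C r (z j)"
    and "j < 3 \<Longrightarrow> w (2 * j + 1) = chart_nu g C r (z j) / chart_den g m C r (z j)"
proof -
  note N = nf[unfolded normal_form_def]
  note rows = conjunct1[OF N]
  note pts = conjunct1[OF conjunct2[OF conjunct2[OF N]], rule_format]
  note indep = conjunct1[OF conjunct2[OF conjunct2[OF conjunct2[OF N]]], rule_format]
  note complete = conjunct2[OF conjunct2[OF conjunct2[OF conjunct2[OF N]]], rule_format]
  have linC: "lin (minors g) x = \<kappa> * lin C x" for x
    using C(1) by (simp add: lin_def sum3 algebra_simps)
  have qC: "lin C (qf g x) = 0" for x
    using lin_minors_qf[OF rows, of x] C(2) by (simp add: linC)
  define \<rho> where "\<rho> = (\<lambda>j. chart_det C r / chart_l2 r (X j))"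
  have \<rho>: "\<rho> j \<noteq> 0" if "j < 3" for j using r that by (simp add: \<rho>_def)
  have nuX: "\<nu> j \<noteq> 0" "lin m (X j) + \<nu> j \<noteq> 0" and qX: "\<And>i. i < 3 \<Longrightarrow> qf g (X j) i = \<nu> j * X j i" if "j < 3" for j
    using pts[OF that] by auto
  have X: "chart_pt C r (z j) k = \<rho> j * X j k" if "j < 3" "k < 3" for j k
  proof -
    have "lin C (qf g (X j)) = \<nu> j * lin C (X j)"
      using qX[OF that(1)] by (simp add: lin_def sum3 algebra_simps)
    then have "lin C (X j) = 0" using qC[of "X j"] nuX[OF that(1)] by simp
    from chart_decompose[OF this that(2), of r] show ?thesis
      using r(2)[OF that(1)] by (simp add: chart_pt_def z_def \<rho>_def field_simps)
  qed
  have lin_pt: "lin d (chart_pt C r (z j)) = \<rho> j * lin d (X j)" if "j < 3" for d j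
    using X[OF that] by (simp add: lin_def sum3 algebra_simps)
  have qpt: "qf g (chart_pt C r (z j)) i = (\<rho> j)\<^sup>2 * (\<nu> j * X j i)" if "j < 3" "i < 3" for i j
    using qf_cong[of "chart_pt C r (z j)" "\<lambda>k. \<rho> j * X j k" g] X[OF that(1)] qX[OF that]
    by (simp add: qf_scale)
  have l: "chart_l1 r (qf g (chart_pt C r (z j))) = (\<rho> j)\<^sup>2 * \<nu> j * chart_l1 r (X j)"
    "chart_l2 r (qf g (chart_pt C r (z j))) = (\<rho> j)\<^sup>2 * \<nu> j * chart_l2 r (X j)" if "j < 3" for j
    using qpt[OF that] by (simp_all add: chart_l1_def chart_l2_def algebra_simps)
  have nu: "chart_nu g C r (z j) = chart_det C r * \<rho> j * \<nu> j" if "j < 3" for j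
    using r(2)[OF that] unfolding chart_nu_def l(2)[OF that]
    by (simp add: \<rho>_def power2_eq_square)
  have den: "chart_den g m C r (z j) = chart_det C r * \<rho> j * (lin m (X j) + \<nu> j)" if "j < 3" for j
    unfolding chart_den_def nu[OF that] lin_pt[OF that] by (simp add: algebra_simps)
  have num: "chart_num g C r (z j) = chart_det C r * \<rho> j * (3 * \<nu> j - 2 * lin (\<lambda>k. g k k) (X j))" if "j < 3" for j
    unfolding chart_num_def nu[OF that] lin_pt[OF that] by (simp add: algebra_simps)
  show "j < 3 \<Longrightarrow> chart_den g m C r (z j) \<noteq> 0"
    using den r(1) \<rho> nuX by simp
  show "j < 3 \<Longrightarrow> w (2 * j) = chart_num g C r (z j) / chart_den g m C r (z j)"
    "j < 3 \<Longrightarrow> w (2 * j + 1) = chart_nu g C r (z j) / chart_den g m C r (z j)"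
    using num den nu r(1) \<rho> pts[of j] by simp_all
  have distinct: "z j \<noteq> z k" if "j < 3" "k < 3" "j \<noteq> k" for j k
  proof
    assume "z j = z k"
    then have "\<forall>i<3. X j i = \<rho> k / \<rho> j * X k i"
      using X[OF that(1)] X[OF that(2)] \<rho>[OF that(1)] by (simp add: field_simps)
    then have "in_span (X j) (X k)" unfolding in_span_def by blast
    then show False using indep[OF that] by simp
  qed
  show d: "z 0 \<noteq> z 1" "z 0 \<noteq> z 2" "z 1 \<noteq> z 2"
    using distinct[of 0 1] distinct[of 0 2] distinct[of 1 2] by simp_all
  have root: "- chart_l2 r (qf g (chart_e C r)) * z j ^ 3
      + (chart_l1 r (qf g (chart_e C r)) - 2 * chart_l2 r (qbil g (chart_e C r) (chart_f C r))) * (z j)\<^sup>2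
      + (2 * chart_l1 r (qbil g (chart_e C r) (chart_f C r)) - chart_l2 r (qf g (chart_f C r))) * z j
      + chart_l1 r (qf g (chart_f C r)) = 0" if "j < 3" for j
  proof -
    let ?q = "qf g (chart_pt C r (z j))"
    have "chart_l1 r ?q - z j * chart_l2 r ?q = 0"
      unfolding l[OF that] using r(2)[OF that] by (simp add: z_def)
    moreover have "chart_l1 r ?q - z j * chart_l2 r ?q = - chart_l2 r (qf g (chart_e C r)) * z j ^ 3
      + (chart_l1 r (qf g (chart_e C r)) - 2 * chart_l2 r (qbil g (chart_e C r) (chart_f C r))) * (z j)\<^sup>2
      + (2 * chart_l1 r (qbil g (chart_e C r) (chart_f C r)) - chart_l2 r (qf g (chart_f C r))) * z j
      + chart_l1 r (qf g (chart_f C r))"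
      unfolding chart_l1_def chart_l2_def qf_chart_pt by (simp add: power2_eq_square power3_eq_cube algebra_simps)
    ultimately show ?thesis by simp
  qed
  show "roots3 (- chart_l2 r (qf g (chart_e C r)))
      (chart_l1 r (qf g (chart_e C r)) - 2 * chart_l2 r (qbil g (chart_e C r) (chart_f C r)))
      (2 * chart_l1 r (qbil g (chart_e C r) (chart_f C r)) - chart_l2 r (qf g (chart_f C r)))
      (chart_l1 r (qf g (chart_f C r))) (z 0) (z 1) (z 2)"
    by (rule cubic_roots3[OF d]) (use root[of 0] root[of 1] root[of 2] in auto)
  \<comment> \<open>Were the leading coefficient zero, the point \<open>chart_e\<close> at infinity
    of the chart would be fixed, hence by completeness one of the \<open>X j\<close>, although
    \<open>chart_l2\<close> vanishes there and not at any \<open>X j\<close>.\<close>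
  show "chart_l2 r (qf g (chart_e C r)) \<noteq> 0"
  proof
    let ?q = "qf g (chart_e C r)"
    assume 0: "chart_l2 r ?q = 0"
    have q: "\<forall>i<3. ?q i = chart_l1 r ?q / chart_det C r * chart_e C r i"
      using chart_decompose[OF qC[of "chart_e C r"], of _ r] r(1) by (simp add: 0 field_simps)
    have ne: "nonzero3 (chart_e C r)"
      using r(1) chart_e_props(2)[of r C] unfolding nonzero3_def ex3 by (auto simp: chart_l1_def)
    have "lin (minors g) (chart_e C r) = 0" by (simp add: linC chart_e_props)
    then have "\<exists>j<3. in_span (chart_e C r) (X j)" using complete ne q by blast
    then obtain j s where j: "j < 3" "\<forall>i<3. chart_e C r i = s * X j i" by (auto simp: in_span_def)
    then have "chart_l2 r (chart_e C r) = s * chart_l2 r (X j)"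
      by (simp add: chart_l2_def algebra_simps)
    then have "s = 0" using r(2)[OF j(1)] by (simp add: chart_e_props)
    then show False using ne j unfolding nonzero3_def by auto
  qed
qed

text \<open>Multiples of \<open>F\<close> define the same map of the plane. The freedom is used
  twice: to normalise \<open>\<mu> 3\<close>, and to avoid dividing by the components of
  \<open>C\<close>.\<close>

lemma normal_form_scale:
  assumes "normal_form g m X \<nu> b w" "s \<noteq> 0"
  shows "normal_form (\<lambda>i k. s * g i k) (\<lambda>k. s * m k) X (\<lambda>j. s * \<nu> j) b w"
proof -
  have 1: "lin (\<lambda>k. s * d k) x = s * lin d x" "qf (\<lambda>i k. s * g i k) x i = s * qf g x i" for d x i
    by (simp_all add: lin_def qf_def sum3 algebra_simps)
  have "minors (\<lambda>i k. s * g i k) = (\<lambda>k. s\<^sup>2 * minors g k)"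
    by (auto simp: minors_def fun_eq_iff power2_eq_square algebra_simps)
  then have 2: "lin (minors (\<lambda>i k. s * g i k)) x = s\<^sup>2 * lin (minors g) x" for x
    by (simp add: lin_def sum3 algebra_simps)
  note N = assms(1)[unfolded normal_form_def]
  note rows = conjunct1[OF N]
  note spec = conjunct1[OF conjunct2[OF N], rule_format]
  note pts = conjunct1[OF conjunct2[OF conjunct2[OF N]], rule_format]
  note indep = conjunct1[OF conjunct2[OF conjunct2[OF conjunct2[OF N]]]]
  note complete = conjunct2[OF conjunct2[OF conjunct2[OF conjunct2[OF N]]], rule_format]
  show ?thesis
    unfolding normal_form_def 1 2
  proof (intro conjI)
    show "\<forall>i<3. s * g i 0 + s * g i 1 + s * g i 2 = 0"
      using rows by (simp add: distrib_left[symmetric])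
    show "\<forall>i<4. s * lin m (sg i) \<noteq> 0 \<and> b (2 * i) * (s * lin m (sg i)) = - 2 * (s * lin (\<lambda>k. g k k) (sg i)) \<and>
        b (2 * i + 1) * (s * lin m (sg i))\<^sup>2 = 4 * (s\<^sup>2 * lin (minors g) (sg i)) \<and> b (2 * i + 1) \<noteq> 0"
    proof (intro allI impI)
      fix i :: nat assume i: "i < 4"
      have "b (2 * i) * (s * lin m (sg i)) = s * (b (2 * i) * lin m (sg i))"
        "b (2 * i + 1) * (s * lin m (sg i))\<^sup>2 = s\<^sup>2 * (b (2 * i + 1) * (lin m (sg i))\<^sup>2)"
        by (simp_all add: power_mult_distrib mult_ac)
      then show "s * lin m (sg i) \<noteq> 0 \<and> b (2 * i) * (s * lin m (sg i)) = - 2 * (s * lin (\<lambda>k. g k k) (sg i)) \<and>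
        b (2 * i + 1) * (s * lin m (sg i))\<^sup>2 = 4 * (s\<^sup>2 * lin (minors g) (sg i)) \<and> b (2 * i + 1) \<noteq> 0"
        using spec[OF i] assms(2) by simp
    qed
    show "\<forall>j<3. nonzero3 (X j) \<and> (\<forall>i<3. s * qf g (X j) i = s * \<nu> j * X j i) \<and> s * \<nu> j \<noteq> 0 \<and>
        s * lin m (X j) + s * \<nu> j \<noteq> 0 \<and>
        w (2 * j) = (3 * (s * \<nu> j) - 2 * (s * lin (\<lambda>k. g k k) (X j))) / (s * lin m (X j) + s * \<nu> j) \<and>
        w (2 * j + 1) = s * \<nu> j / (s * lin m (X j) + s * \<nu> j)"
    proof (intro allI impI)
      fix j :: nat assume j: "j < 3"
      have e: "s * lin m (X j) + s * \<nu> j = s * (lin m (X j) + \<nu> j)"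
        "3 * (s * \<nu> j) - 2 * (s * lin (\<lambda>k. g k k) (X j)) = s * (3 * \<nu> j - 2 * lin (\<lambda>k. g k k) (X j))"
        by (simp_all add: algebra_simps)
      show "nonzero3 (X j) \<and> (\<forall>i<3. s * qf g (X j) i = s * \<nu> j * X j i) \<and> s * \<nu> j \<noteq> 0 \<and>
        s * lin m (X j) + s * \<nu> j \<noteq> 0 \<and>
        w (2 * j) = (3 * (s * \<nu> j) - 2 * (s * lin (\<lambda>k. g k k) (X j))) / (s * lin m (X j) + s * \<nu> j) \<and>
        w (2 * j + 1) = s * \<nu> j / (s * lin m (X j) + s * \<nu> j)"
        unfolding e using pts[OF j] assms(2) by simp
    qed
    show "\<forall>y n. nonzero3 y \<and> s\<^sup>2 * lin (minors g) y = 0 \<and> (\<forall>i<3. s * qf g y i = n * y i) \<longrightarrow> (\<exists>j<3. in_span y (X j))"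
    proof (intro allI impI, elim conjE)
      fix y n assume y: "nonzero3 y" "s\<^sup>2 * lin (minors g) y = 0" "\<forall>i<3. s * qf g y i = n * y i"
      show "\<exists>j<3. in_span y (X j)"
        by (rule complete[where n = "n / s"]) (use y assms(2) in \<open>auto simp: field_simps\<close>)
    qed
  qed (rule indep)
qed

subsection \<open>Solving for the normal form in terms of the spectral data\<close>

text \<open>The multipliers \<open>\<mu> i = m (sg i)\<close> satisfy \<open>\<Sum> \<mu> i = \<Sum> t i \<mu> i = \<Sum> d i (\<mu> i)^2 = 0\<close>. The solutions of
  the two linear equations are spanned by \<open>coefA\<close> and \<open>coefB\<close>, and the normalisation
  \<open>\<mu> 3 = qA x * coefB x 3\<close> makes the quadratic equation for \<open>y1 = x 11\<close> monic. The second unknown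
  \<open>y2 = x 12\<close> is \<open>C 0 * g 0 1\<close>.\<close>

definition coefA :: "(nat \<Rightarrow> complex) \<Rightarrow> nat \<Rightarrow> complex" where
  "coefA x i = (if i = 0 then x 2 - x 4 else if i = 1 then x 4 - x 0 else if i = 2 then x 0 - x 2 else 0)"

definition coefB :: "(nat \<Rightarrow> complex) \<Rightarrow> nat \<Rightarrow> complex" where
  "coefB x i = (if i = 0 then x 2 - x 6 else if i = 1 then x 6 - x 0 else if i = 2 then 0 else x 0 - x 2)"

definition qA where "qA x = (\<Sum>i<4::nat. x (2 * i + 1) * (coefA x i)\<^sup>2)"
definition qB where "qB x = (\<Sum>i<4::nat. x (2 * i + 1) * (coefA x i * coefB x i))"
definition qC where "qC x = (\<Sum>i<4::nat. x (2 * i + 1) * (coefB x i)\<^sup>2)"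

definition mult :: "(nat \<Rightarrow> complex) \<Rightarrow> nat \<Rightarrow> complex" where
  "mult x i = x 11 * coefA x i + qA x * coefB x i"

text \<open>These three invert the values at the sign vectors by the orthogonality
  \<open>sg_dual\<close>: its factor 4 combines with the constants -2 and 4 of
  \<open>normal_form\<close> to give 4, -8 and 16.\<close>

definition vecM :: "(nat \<Rightarrow> complex) \<Rightarrow> vec3" where
  "vecM x k = (\<Sum>i<4::nat. sg i k * mult x i) / 4"
definition vecG :: "(nat \<Rightarrow> complex) \<Rightarrow> vec3" where
  "vecG x k = - (\<Sum>i<4::nat. sg i k * (x (2 * i) * mult x i)) / 8"
definition vecC :: "(nat \<Rightarrow> complex) \<Rightarrow> vec3" where
  "vecC x k = (\<Sum>i<4::nat. sg i k * (x (2 * i + 1) * (mult x i)\<^sup>2)) / 16"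

text \<open>The intended entries are \<open>minors g i * g i k\<close>. All rows and columns of that
  matrix sum to zero, so the diagonal and the single entry \<open>x 12\<close> determine the
  rest.\<close>

definition matH :: "(nat \<Rightarrow> complex) \<Rightarrow> nat \<Rightarrow> nat \<Rightarrow> complex" where
  "matH x i k = (let h = (\<lambda>k. vecC x k * vecG x k) in
     if i = 0 then (if k = 0 then h 0 else if k = 1 then x 12 else - h 0 - x 12)
     else if i = 1 then (if k = 0 then - h 1 - (x 12 + h 0 - h 2) else if k = 1 then h 1 else x 12 + h 0 - h 2)
     else (if k = 0 then x 12 + h 1 - h 2 else if k = 1 then - h 2 - (x 12 + h 1 - h 2) else h 2))"

definition vecC_prod where "vecC_prod x = vecC x 0 * vecC x 1 * vecC x 2"

text \<open>Instead of dividing row \<open>i\<close> by its factor \<open>vecC x i\<close>, it is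
  multiplied by the other two components; the result is \<open>vecC_prod x\<close> times
  \<open>g\<close>.\<close>

definition matG :: "(nat \<Rightarrow> complex) \<Rightarrow> nat \<Rightarrow> nat \<Rightarrow> complex" where
  "matG x i k = matH x i k * (if i = 0 then vecC x 1 * vecC x 2 else if i = 1 then vecC x 0 * vecC x 2
     else vecC x 0 * vecC x 1)"

definition vecM' :: "(nat \<Rightarrow> complex) \<Rightarrow> vec3" where
  "vecM' x k = vecC_prod x * vecM x k"

text \<open>The resultant of the quadratic equation for \<open>y1\<close> with \<open>d j (\<mu> j)^2 + d 3 (\<mu> 3)^2\<close>; the latter is
  \<open>\<plusminus> 8\<close> times a component of \<open>C\<close>.\<close>

definition resC :: "nat \<Rightarrow> (nat \<Rightarrow> complex) \<Rightarrow> complex" where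
  "resC j x = (let l = x (2 * j + 1) * (coefA x j)\<^sup>2; m = 2 * (qA x * (x (2 * j + 1) * (coefA x j * coefB x j)));
      n = (qA x)\<^sup>2 * (x (2 * j + 1) * (coefB x j)\<^sup>2 + x 7 * (coefB x 3)\<^sup>2);
      \<beta> = 2 * qB x; \<gamma> = qA x * qC x
    in (n - l * \<gamma>)\<^sup>2 - (n - l * \<gamma>) * (m - l * \<beta>) * \<beta> + (m - l * \<beta>)\<^sup>2 * \<gamma>)"

definition generic :: "(nat \<Rightarrow> complex) \<Rightarrow> complex" where
  "generic x = (x 0 - x 2) * qA x * (resC 0 x * (resC 1 x * resC 2 x))"

definition polE1 where "polE1 x = 2 * qB x"
definition polE0 where "polE0 x = qA x * qC x"
definition polF1 where "polF1 x = vecC x 0 * vecG x 0 + vecC x 1 * vecG x 1 - vecC x 2 * vecG x 2"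
definition polF0 where "polF0 x = vecC x 0 * vecC x 1 * (vecG x 0 * vecG x 1 - vecC x 2)"
definition polK3 where "polK3 x = - chart_l2 (x 8) (qf (matG x) (chart_e (vecC x) (x 8)))"
definition polK2 where "polK2 x = chart_l1 (x 8) (qf (matG x) (chart_e (vecC x) (x 8)))
  - 2 * chart_l2 (x 8) (qbil (matG x) (chart_e (vecC x) (x 8)) (chart_f (vecC x) (x 8)))"
definition polK1 where "polK1 x = 2 * chart_l1 (x 8) (qbil (matG x) (chart_e (vecC x) (x 8)) (chart_f (vecC x) (x 8)))
  - chart_l2 (x 8) (qf (matG x) (chart_f (vecC x) (x 8)))"
definition polK0 where "polK0 x = chart_l1 (x 8) (qf (matG x) (chart_f (vecC x) (x 8)))"
definition polL where "polL x = chart_den (matG x) (vecM' x) (vecC x) (x 8) (x 13)"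
definition polU where "polU x = chart_num (matG x) (vecC x) (x 8) (x 13)"
definition polV where "polV x = chart_nu (matG x) (vecC x) (x 8) (x 13)"

section \<open>Polynomiality of the reconstructed data\<close>

lemma polyfun_coef: "i < 4 \<Longrightarrow> (\<lambda>x. coefA x i) \<in> polyfun 8" "i < 4 \<Longrightarrow> (\<lambda>x. coefB x i) \<in> polyfun 8"
  unfolding coefA_def coefB_def by (cases "i = 0"; cases "i = 1"; cases "i = 2"; auto intro!: polyfun_intros)+

lemma polyfun_q: "qA \<in> polyfun 8" "qB \<in> polyfun 8" "qC \<in> polyfun 8"
  unfolding qA_def[abs_def] qB_def[abs_def] qC_def[abs_def]
  by (auto intro!: polyfun_sum polyfun_intros polyfun_coef)

lemma polyfun_mult: "i < 4 \<Longrightarrow> (\<lambda>x. mult x i) \<in> polyfun 12"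
  unfolding mult_def
  by (intro polyfun_intros polyfun_mono[OF polyfun_coef(1)] polyfun_mono[OF polyfun_coef(2)]
      polyfun_mono[OF polyfun_q(1)]) auto

lemma polyfun_vec: "(\<lambda>x. vecM x k) \<in> polyfun 12" "(\<lambda>x. vecG x k) \<in> polyfun 12" "(\<lambda>x. vecC x k) \<in> polyfun 12"
  unfolding vecM_def vecG_def vecC_def
  by (intro polyfun_divide_const polyfun_uminus polyfun_sum polyfun.mult polyfun.const polyfun_mult
      polyfun_power polyfun.var; simp)+

lemma polyfun_matH: "(\<lambda>x. matH x i k) \<in> polyfun 13"
proof -
  have v: "(\<lambda>x. vecG x k) \<in> polyfun 13" "(\<lambda>x. vecC x k) \<in> polyfun 13" for k
    using polyfun_mono[of _ 12 13] polyfun_vec by simp_all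
  show ?thesis unfolding matH_def Let_def
    by (cases "i = 0"; cases "i = 1"; cases "k = 0"; cases "k = 1"; simp; intro polyfun_intros v; simp)
qed

lemma polyfun_data:
  assumes "n \<ge> 13"
  shows "(\<lambda>x. matG x i k) \<in> polyfun n" "(\<lambda>x. vecM' x k) \<in> polyfun n" "(\<lambda>x. vecC x k) \<in> polyfun n"
proof -
  have v: "(\<lambda>x. vecM x k) \<in> polyfun n" "(\<lambda>x. vecC x k) \<in> polyfun n" "(\<lambda>x. matH x i k) \<in> polyfun n" for i k
    using assms by (auto intro!: polyfun_mono[OF polyfun_vec(1)] polyfun_mono[OF polyfun_vec(3)]
      polyfun_mono[OF polyfun_matH])
  show "(\<lambda>x. vecC x k) \<in> polyfun n" by (rule v)
  show "(\<lambda>x. vecM' x k) \<in> polyfun n" unfolding vecM'_def vecC_prod_def by (intro polyfun_intros v)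
  show "(\<lambda>x. matG x i k) \<in> polyfun n" unfolding matG_def
    by (cases "i = 0"; cases "i = 1"; simp; intro polyfun_intros v)
qed

lemma polyfun_chart:
  assumes "n \<ge> 13"
  shows "(\<lambda>x. chart_e (vecC x) (x 8) k) \<in> polyfun n" "(\<lambda>x. chart_f (vecC x) (x 8) k) \<in> polyfun n"
    "(\<lambda>x. chart_det (vecC x) (x 8)) \<in> polyfun n"
  unfolding chart_e_def chart_f_def chart_det_def using assms
  by (cases "k = 0"; cases "k = 1"; simp; intro polyfun_intros polyfun_data; simp)+

lemma polyfun_chart_forms:
  assumes "n \<ge> 13" "\<And>k. (\<lambda>x. v x k) \<in> polyfun n"
  shows "(\<lambda>x. chart_l1 (x 8) (v x)) \<in> polyfun n" "(\<lambda>x. chart_l2 (x 8) (v x)) \<in> polyfun n"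
  unfolding chart_l1_def chart_l2_def using assms(1) by (intro polyfun_intros assms(2); simp)+

lemma polyfun_qf:
  assumes "n \<ge> 13" "\<And>k. (\<lambda>x. v x k) \<in> polyfun n"
  shows "(\<lambda>x. qf (matG x) (v x) i) \<in> polyfun n"
  unfolding qf_def using assms(1) by (intro polyfun_sum polyfun_intros assms(2) polyfun_data; simp)

lemma polyfun_qbil:
  assumes "n \<ge> 13" "\<And>k. (\<lambda>x. v x k) \<in> polyfun n" "\<And>k. (\<lambda>x. v' x k) \<in> polyfun n"
  shows "(\<lambda>x. qbil (matG x) (v x) (v' x) i) \<in> polyfun n"
  unfolding qbil_def using assms(1) by (intro polyfun_sum polyfun_intros assms(2,3) polyfun_data; simp)

lemma polyfun_lin:
  assumes "\<And>k. (\<lambda>x. d x k) \<in> polyfun n" "\<And>k. (\<lambda>x. v x k) \<in> polyfun n"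
  shows "(\<lambda>x. lin (d x) (v x)) \<in> polyfun n"
  unfolding lin_def by (intro polyfun_sum polyfun_intros assms; simp)

lemma polyfun_polK: "polK3 \<in> polyfun 13" "polK2 \<in> polyfun 13" "polK1 \<in> polyfun 13" "polK0 \<in> polyfun 13"
  unfolding polK3_def[abs_def] polK2_def[abs_def] polK1_def[abs_def] polK0_def[abs_def]
  by (intro polyfun_uminus polyfun_diff polyfun.mult polyfun.const polyfun_chart_forms polyfun_qf
      polyfun_qbil polyfun_chart; simp)+

lemma polyfun_pol: "polL \<in> polyfun 14" "polU \<in> polyfun 14" "polV \<in> polyfun 14"
proof -
  have p: "(\<lambda>x. chart_pt (vecC x) (x 8) (x 13) k) \<in> polyfun 14" for k
    unfolding chart_pt_def by (intro polyfun_intros polyfun_chart; simp)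
  have n: "(\<lambda>x. chart_nu (matG x) (vecC x) (x 8) (x 13)) \<in> polyfun 14"
    unfolding chart_nu_def by (intro polyfun_chart_forms polyfun_qf p; simp)
  show "polL \<in> polyfun 14" "polU \<in> polyfun 14" "polV \<in> polyfun 14"
    unfolding polL_def[abs_def] polU_def[abs_def] polV_def[abs_def] chart_den_def chart_num_def
    by (intro n polyfun_intros polyfun_lin polyfun_data polyfun_chart p; simp)+
qed

lemma polyfun_polEF: "polE1 \<in> polyfun 8" "polE0 \<in> polyfun 8" "polF1 \<in> polyfun 12" "polF0 \<in> polyfun 12"
  unfolding polE1_def[abs_def] polE0_def[abs_def] polF1_def[abs_def] polF0_def[abs_def]
  by (intro polyfun_intros polyfun_q polyfun_vec)+

interpretation tower: root_tower polE1 polE0 polF1 polF0 polK3 polK2 polK1 polK0 polL polU polV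
  by unfold_locales (rule polyfun_mono[OF polyfun_polEF(1)] polyfun_mono[OF polyfun_polEF(2)]
    polyfun_polEF(3,4) polyfun_polK polyfun_pol; simp)+

lemma polyfun_generic: "generic \<in> polyfun 8"
proof -
  have "resC j \<in> polyfun 8" if "j < 3" for j
    unfolding resC_def[abs_def] Let_def using that by (intro polyfun_intros polyfun_q polyfun_coef; simp)
  then show ?thesis unfolding generic_def[abs_def] by (intro polyfun_intros polyfun_q; simp)
qed

lemma generic_nonzero: "generic (\<lambda>i. if odd i then 1 else of_nat (i div 2)) \<noteq> 0"
  by (simp add: generic_def resC_def qA_def qB_def qC_def sum4 coefA_def coefB_def Let_def)

section \<open>Recovery of the normal form for generic spectral data\<close>

lemma sg_dual:
  assumes "k < 3"
  shows "(\<Sum>i<4::nat. sg i k * lin d (sg i)) = 4 * d k"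
proof -
  have "k = 0 \<or> k = 1 \<or> k = 2" using assms by linarith
  then show ?thesis by (elim disjE) (simp_all add: sum4 lin_def sum3)
qed

lemma sg_sum: "(\<Sum>i<4::nat. lin d (sg i)) = 0"
  by (simp add: sum4 lin_def sum3)

lemma resultant_quadratics:
  fixes y :: complex
  assumes "y\<^sup>2 + \<beta> * y + \<gamma> = 0" "l * y\<^sup>2 + m * y + n = 0"
  shows "(n - l * \<gamma>)\<^sup>2 - (n - l * \<gamma>) * (m - l * \<beta>) * \<beta> + (m - l * \<beta>)\<^sup>2 * \<gamma> = 0"
proof -
  define p where "p = m - l * \<beta>"
  have y: "y\<^sup>2 = - (\<beta> * y) - \<gamma>" using assms(1) by (simp add: algebra_simps eq_neg_iff_add_eq_0)
  have n: "n - l * \<gamma> = - (p * y)"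
    using assms(2) unfolding y by (simp add: p_def algebra_simps eq_neg_iff_add_eq_0)
  have "(n - l * \<gamma>)\<^sup>2 - (n - l * \<gamma>) * (m - l * \<beta>) * \<beta> + (m - l * \<beta>)\<^sup>2 * \<gamma>
      = p\<^sup>2 * (y\<^sup>2 + \<beta> * y + \<gamma>)"
    unfolding n p_def[symmetric] by (simp add: power2_eq_square algebra_simps)
  then show ?thesis using assms(1) by simp
qed

lemma normal_form_solution:
  assumes nf: "normal_form g m X \<nu> b w" and gen: "generic b \<noteq> 0"
    and norm: "lin m (sg 3) = qA b * (b 0 - b 2)"
    and y1_def: "y1 = lin m (sg 2) / (b 0 - b 2)" and y2_def: "y2 = minors g 0 * g 0 1"
    and x_def: "x = params b r al be y1 y2"
  shows "tower.quads x" "vecC_prod x \<noteq> 0" "k < 3 \<Longrightarrow> vecC x k = minors g k"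
    "k < 3 \<Longrightarrow> vecM' x k = vecC_prod x * m k"
    "i < 3 \<Longrightarrow> k < 3 \<Longrightarrow> matG x i k = vecC_prod x * g i k"
proof -
  note N = nf[unfolded normal_form_def]
  note rows = conjunct1[OF N]
  note spec = conjunct1[OF conjunct2[OF N], rule_format]
  have gen': "b 0 - b 2 \<noteq> 0" "qA b \<noteq> 0" "resC 0 b \<noteq> 0" "resC 1 b \<noteq> 0" "resC 2 b \<noteq> 0"
    using gen by (auto simp: generic_def)
  have xb: "x i = b i" if "i < 8" for i using that by (simp add: x_def params_def)
  have xy: "x 11 = y1" "x 12 = y2" by (simp_all add: x_def params_def)
  have ext: "p x = p b" if "p \<in> polyfun 8" for p by (rule polyfun_cong[OF that xb])
  note q = polyfun_q[THEN ext]
  have co: "coefA x i = coefA b i" "coefB x i = coefB b i" if "i < 4" for i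
    using polyfun_coef[OF that, THEN ext] by simp_all
  define \<mu> where "\<mu> = (\<lambda>i. lin m (sg i))"
  have s1: "\<mu> 0 + \<mu> 1 + \<mu> 2 + \<mu> 3 = 0" using sg_sum[of m] by (simp add: \<mu>_def sum4)
  have tmu: "b (2 * i) * \<mu> i = - 2 * lin (\<lambda>k. g k k) (sg i)"
    and dmu: "b (2 * i + 1) * (\<mu> i)\<^sup>2 = 4 * lin (minors g) (sg i)" if "i < 4" for i
    using spec[OF that] by (simp_all add: \<mu>_def)
  have s2: "b 0 * \<mu> 0 + b 2 * \<mu> 1 + b 4 * \<mu> 2 + b 6 * \<mu> 3 = 0"
  proof -
    have "b 0 * \<mu> 0 + b 2 * \<mu> 1 + b 4 * \<mu> 2 + b 6 * \<mu> 3 = (\<Sum>i<4::nat. - 2 * lin (\<lambda>k. g k k) (sg i))"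
      using tmu[of 0] tmu[of 1] tmu[of 2] tmu[of 3] by (simp add: sum4)
    then show ?thesis unfolding sum_distrib_left[symmetric] sg_sum by simp
  qed
  have s3: "b 1 * (\<mu> 0)\<^sup>2 + b 3 * (\<mu> 1)\<^sup>2 + b 5 * (\<mu> 2)\<^sup>2 + b 7 * (\<mu> 3)\<^sup>2 = 0"
  proof -
    have "b 1 * (\<mu> 0)\<^sup>2 + b 3 * (\<mu> 1)\<^sup>2 + b 5 * (\<mu> 2)\<^sup>2 + b 7 * (\<mu> 3)\<^sup>2 = (\<Sum>i<4::nat. 4 * lin (minors g) (sg i))"
      using dmu[of 0] dmu[of 1] dmu[of 2] dmu[of 3] by (simp add: sum4)
    then show ?thesis unfolding sum_distrib_left[symmetric] sg_sum by simp
  qed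
  have mu2: "\<mu> 2 = y1 * (b 0 - b 2)" using gen'(1) by (simp add: y1_def \<mu>_def)
  have mu3: "\<mu> 3 = qA b * (b 0 - b 2)" using norm by (simp add: \<mu>_def)
  have "(b 0 - b 2) * \<mu> 0 = (b 0 - b 2) * (y1 * (b 2 - b 4) + qA b * (b 2 - b 6))"
    "(b 0 - b 2) * \<mu> 1 = (b 0 - b 2) * (y1 * (b 4 - b 0) + qA b * (b 6 - b 0))"
    using s1 s2 unfolding mu2 mu3 by algebra+
  then have mu01: "\<mu> 0 = y1 * (b 2 - b 4) + qA b * (b 2 - b 6)" "\<mu> 1 = y1 * (b 4 - b 0) + qA b * (b 6 - b 0)"
    using gen'(1) by simp_all
  have mu: "mult x i = \<mu> i" if "i < 4" for i
  proof -
    have "i = 0 \<or> i = 1 \<or> i = 2 \<or> i = 3" using that by linarith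
    then show ?thesis unfolding mult_def co[OF that] q xy
      by (elim disjE) (simp_all add: coefA_def coefB_def mu01[unfolded One_nat_def] mu2 mu3)
  qed
  have muy: "\<mu> i = y1 * coefA b i + qA b * coefB b i" if "i < 4" for i
    using mu[OF that] co[OF that] by (simp add: mult_def xy q)
  have M: "vecM x k = m k" if "k < 3" for k
    using sg_dual[OF that, of m] by (simp add: vecM_def mu \<mu>_def)
  have G: "vecG x k = g k k" if "k < 3" for k
  proof -
    have "(\<Sum>i<4::nat. sg i k * (x (2 * i) * mult x i)) = (\<Sum>i<4::nat. - 2 * (sg i k * lin (\<lambda>k. g k k) (sg i)))"
      using tmu by (intro sum.cong) (simp_all add: mu xb)
    also have "\<dots> = - 2 * (4 * g k k)" unfolding sum_distrib_left[symmetric] sg_dual[OF that] ..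
    finally show ?thesis by (simp add: vecG_def)
  qed
  show C: "vecC x k = minors g k" if "k < 3" for k
  proof -
    have "(\<Sum>i<4::nat. sg i k * (x (2 * i + 1) * (mult x i)\<^sup>2)) = (\<Sum>i<4::nat. 4 * (sg i k * lin (minors g) (sg i)))"
      using dmu by (intro sum.cong) (simp_all add: mu xb)
    also have "\<dots> = 4 * (4 * minors g k)" unfolding sum_distrib_left[symmetric] sg_dual[OF that] ..
    finally show ?thesis by (simp add: vecC_def)
  qed
  have quad1: "y1\<^sup>2 + 2 * qB b * y1 + qA b * qC b = 0"
  proof -
    have "qA b * (y1\<^sup>2 + 2 * qB b * y1 + qA b * qC b)
        = (\<Sum>i<4::nat. b (2 * i + 1) * (coefA b i)\<^sup>2) * y1\<^sup>2
          + 2 * qA b * (\<Sum>i<4::nat. b (2 * i + 1) * (coefA b i * coefB b i)) * y1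
          + (qA b)\<^sup>2 * (\<Sum>i<4::nat. b (2 * i + 1) * (coefB b i)\<^sup>2)"
      unfolding qA_def[symmetric] qB_def[symmetric] qC_def[symmetric]
      by (simp add: power2_eq_square algebra_simps)
    also have "\<dots> = (\<Sum>i<4::nat. b (2 * i + 1) * (y1 * coefA b i + qA b * coefB b i)\<^sup>2)"
      unfolding sum4 by (simp add: power2_eq_square algebra_simps)
    also have "\<dots> = (\<Sum>i<4::nat. b (2 * i + 1) * (\<mu> i)\<^sup>2)"
      by (intro sum.cong) (simp_all add: muy)
    also have "\<dots> = 0" using s3 by (simp add: sum4)
    finally show ?thesis using gen'(2) by simp
  qed
  have nonzero: "b (2 * j + 1) * (\<mu> j)\<^sup>2 + b 7 * (\<mu> 3)\<^sup>2 \<noteq> 0" if "j < 3" for j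
  proof
    assume "b (2 * j + 1) * (\<mu> j)\<^sup>2 + b 7 * (\<mu> 3)\<^sup>2 = 0"
    then have 0: "b (2 * j + 1) * (y1 * coefA b j + qA b * coefB b j)\<^sup>2 + b 7 * (qA b * coefB b 3)\<^sup>2 = 0"
      using that muy[of j] muy[of 3] by (simp add: coefA_def[of _ 3])
    have "(b (2 * j + 1) * (coefA b j)\<^sup>2) * y1\<^sup>2 + (2 * (qA b * (b (2 * j + 1) * (coefA b j * coefB b j)))) * y1
        + (qA b)\<^sup>2 * (b (2 * j + 1) * (coefB b j)\<^sup>2 + b 7 * (coefB b 3)\<^sup>2) = 0"
      unfolding 0[symmetric] by (simp add: power2_eq_square algebra_simps)
    from resultant_quadratics[OF quad1 this] have "resC j b = 0" by (simp add: resC_def Let_def)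
    moreover have "j = 0 \<or> j = 1 \<or> j = 2" using that by linarith
    ultimately show False using gen' by auto
  qed
  have Cnz: "minors g k \<noteq> 0" if "k < 3" for k
  proof
    assume 0: "minors g k = 0"
    have k: "k = 0 \<or> k = 1 \<or> k = 2" using that by linarith
    \<comment> \<open>Only coordinate \<open>k\<close> of \<open>sg (2 - k) + sg 3\<close> is
      nonzero, so a vanishing \<open>minors g k\<close> would annihilate the expression excluded by
      \<open>nonzero\<close>.\<close>
    have "2 - k < 3" by arith
    have "b (2 * (2 - k) + 1) * (\<mu> (2 - k))\<^sup>2 + b 7 * (\<mu> 3)\<^sup>2 = 4 * (lin (minors g) (sg (2 - k)) + lin (minors g) (sg 3))"
      using dmu[of "2 - k"] dmu[of 3] by (simp add: distrib_left)
    also have "\<dots> = 0" using k 0 by (elim disjE) (simp_all add: lin_def sum3)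
    finally show False using nonzero[of "2 - k", OF \<open>2 - k < 3\<close>] by (rule notE[rotated])
  qed
  show prod: "vecC_prod x \<noteq> 0" using Cnz by (simp add: vecC_prod_def C)
  show "vecM' x k = vecC_prod x * m k" if "k < 3" for k using M[OF that] by (simp add: vecM'_def)
  have row: "g 0 2 = - g 0 0 - g 0 1" "g 1 0 = - g 1 1 - g 1 2" "g 2 1 = - g 2 2 - g 2 0"
    using rows by (simp_all add: all3 eq_neg_iff_add_eq_0 algebra_simps)
  have col: "minors g 0 * g 0 k + minors g 1 * g 1 k + minors g 2 * g 2 k = 0" if "k < 3" for k
    by (rule minors_left_kernel[OF rows that])
  have h12: "minors g 1 * g 1 2 = y2 + minors g 0 * g 0 0 - minors g 2 * g 2 2"
    using col[of 2] by (simp add: row y2_def algebra_simps eq_neg_iff_add_eq_0)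
  have h20: "minors g 2 * g 2 0 = y2 + minors g 1 * g 1 1 - minors g 2 * g 2 2"
  proof -
    have "minors g 0 * g 0 0 + minors g 1 * (- g 1 1 - g 1 2) + minors g 2 * g 2 0 = 0"
      using col[of 0] unfolding row(2) by simp
    then have "minors g 2 * g 2 0 = minors g 1 * g 1 2 + minors g 1 * g 1 1 - minors g 0 * g 0 0"
      by (simp add: algebra_simps eq_neg_iff_add_eq_0)
    then show ?thesis unfolding h12 by simp
  qed
  have H: "matH x i k = minors g i * g i k" if "i < 3" "k < 3" for i k
  proof -
    have "i = 0 \<or> i = 1 \<or> i = 2" "k = 0 \<or> k = 1 \<or> k = 2" using that by linarith+
    then show ?thesis
      by (elim disjE) (simp_all add: matH_def Let_def C G xy row[unfolded One_nat_def] h12[unfolded One_nat_def]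
        h20[unfolded One_nat_def] y2_def right_diff_distrib)
  qed
  show "matG x i k = vecC_prod x * g i k" if "i < 3" "k < 3" for i k
  proof -
    have "i = 0 \<or> i = 1 \<or> i = 2" using that by linarith
    then show ?thesis unfolding matG_def H[OF that] vecC_prod_def by (elim disjE) (simp_all add: C)
  qed
  \<comment> \<open>The definition of \<open>minors g 2\<close> gives the product of
    \<open>g 0 1\<close> and \<open>g 1 0\<close>; the zero row and column sums express
    \<open>minors g 1 * g 1 0\<close> linearly in \<open>y2\<close>. Together they yield the
    quadratic for \<open>y2\<close>.\<close>
  have e1: "y2 * (minors g 1 * g 1 0) = minors g 0 * minors g 1 * (g 0 0 * g 1 1 - minors g 2)"
    by (simp add: y2_def minors_def algebra_simps)
  have e2: "minors g 1 * g 1 0 = - (minors g 1 * g 1 1) - (y2 + minors g 0 * g 0 0 - minors g 2 * g 2 2)"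
    unfolding row(2) h12[symmetric] by (simp add: algebra_simps)
  have "minors g 0 * minors g 1 * (g 0 0 * g 1 1 - minors g 2)
      = y2 * (- (minors g 1 * g 1 1) - (y2 + minors g 0 * g 0 0 - minors g 2 * g 2 2))"
    by (rule e1[unfolded e2, symmetric])
  then have quad2: "y2\<^sup>2 + (minors g 0 * g 0 0 + minors g 1 * g 1 1 - minors g 2 * g 2 2) * y2
      + minors g 0 * minors g 1 * (g 0 0 * g 1 1 - minors g 2) = 0"
    by (simp only:) (simp add: power2_eq_square algebra_simps)
  show "tower.quads x"
    using quad1 quad2 unfolding tower.quads_def
    by (simp add: polE1_def polE0_def polF1_def polF0_def q xy C G)
qed

lemma represents_if_generic:
  assumes nf0: "normal_form g0 m0 X \<nu>0 b w" and gen: "generic b \<noteq> 0"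
  shows "tower.represents b w"
proof -
  have gen': "b 0 - b 2 \<noteq> 0" "qA b \<noteq> 0" using gen by (auto simp: generic_def)
  have m3: "lin m0 (sg 3) \<noteq> 0"
    using conjunct1[OF conjunct2[OF nf0[unfolded normal_form_def]], rule_format, of 3] by simp
  define s where "s = qA b * (b 0 - b 2) / lin m0 (sg 3)"
  have "s \<noteq> 0" using gen' m3 by (simp add: s_def)
  define g m \<nu> where "g = (\<lambda>i k. s * g0 i k)" and "m = (\<lambda>k. s * m0 k)" and "\<nu> = (\<lambda>j. s * \<nu>0 j)"
  have nf: "normal_form g m X \<nu> b w"
    unfolding g_def m_def \<nu>_def by (rule normal_form_scale[OF nf0 \<open>s \<noteq> 0\<close>])
  have "lin m (sg 3) = s * lin m0 (sg 3)" by (simp add: m_def lin_def sum3 algebra_simps)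
  then have norm: "lin m (sg 3) = qA b * (b 0 - b 2)" using m3 by (simp add: s_def)
  define y1 where "y1 = lin m (sg 2) / (b 0 - b 2)"
  define y2 where "y2 = minors g 0 * g 0 1"
  note sol = normal_form_solution[OF nf gen norm y1_def y2_def]
  define C where "C = minors g"
  define \<omega> where "\<omega> = [:- C 2, 2 * C 1, - C 0:] * ([:X 0 0, X 0 1, X 0 2:] * ([:X 1 0, X 1 1, X 1 2:] * [:X 2 0, X 2 1, X 2 2:]))"
  have ev: "poly \<omega> r = chart_det C r * (chart_l2 r (X 0) * (chart_l2 r (X 1) * chart_l2 r (X 2)))" for r
  proof -
    have 1: "poly [:- C 2, 2 * C 1, - C 0:] r = chart_det C r"
      by (simp add: chart_det_def power2_eq_square algebra_simps)
    have 2: "poly [:X j 0, X j 1, X j 2:] r = chart_l2 r (X j)" for j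
      by (simp add: chart_l2_def power2_eq_square algebra_simps)
    show ?thesis by (simp only: \<omega>_def poly_mult 1 2)
  qed
  have Xnz: "nonzero3 (X j)" if "j < 3" for j
    using conjunct1[OF conjunct2[OF conjunct2[OF nf[unfolded normal_form_def]]], rule_format, OF that] by simp
  define x0 where "x0 = params b 0 0 0 y1 y2"
  have "C 0 \<noteq> 0"
    using sol(2)[OF x0_def] sol(3)[OF x0_def, of 0] unfolding vecC_prod_def C_def by simp
  then have "[:- C 2, 2 * C 1, - C 0:] \<noteq> 0" by simp
  moreover have "[:X j 0, X j 1, X j 2:] \<noteq> 0" if "j < 3" for j
    using Xnz[OF that] unfolding nonzero3_def ex3 by auto
  ultimately have "\<omega> \<noteq> 0" unfolding \<omega>_def by (simp only: mult_eq_0_iff) simp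
  moreover have "\<exists>z0 z1 z2. z0 \<noteq> z1 \<and> z0 \<noteq> z2 \<and> z1 \<noteq> z2 \<and> (\<forall>al be. let x = params b r al be y1 y2 in
      tower.quads x \<and> polK3 x \<noteq> 0 \<and> roots3 (polK3 x) (polK2 x) (polK1 x) (polK0 x) z0 z1 z2 \<and>
      spec_at polL polU polV x w 0 z0 \<and> spec_at polL polU polV x w 1 z1 \<and> spec_at polL polU polV x w 2 z2)"
    if r: "poly \<omega> r \<noteq> 0" for r
  proof -
    have rn1: "chart_det C r \<noteq> 0" using r unfolding ev by simp
    have rn2: "chart_l2 r (X j) \<noteq> 0" if "j < 3" for j
    proof -
      have "j = 0 \<or> j = 1 \<or> j = 2" using that by linarith
      then show ?thesis using r unfolding ev by auto
    qed
    define z where "z = (\<lambda>j. chart_l1 r (X j) / chart_l2 r (X j))"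
    have main: "tower.quads x \<and> polK3 x \<noteq> 0 \<and> roots3 (polK3 x) (polK2 x) (polK1 x) (polK0 x) (z 0) (z 1) (z 2) \<and>
        spec_at polL polU polV x w 0 (z 0) \<and> spec_at polL polU polV x w 1 (z 1) \<and> spec_at polL polU polV x w 2 (z 2)
        \<and> z 0 \<noteq> z 1 \<and> z 0 \<noteq> z 2 \<and> z 1 \<noteq> z 2"
      if x: "x = params b r al be y1 y2" for x al be
    proof -
      note sx = sol[OF x]
      \<comment> \<open>\<open>matG\<close> and \<open>vecM'\<close> reproduce \<open>g\<close> and
        \<open>m\<close> only up to this factor, so the normal form is rescaled by it; the line
        keeps its equation \<open>C\<close>, with \<open>\<kappa> = p^2\<close>.\<close>
      define p where "p = vecC_prod x"
      have p: "p \<noteq> 0" using sx(2) by (simp add: p_def)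
      have x8: "x 8 = r" by (simp add: x params_def)
      have nfp: "normal_form (\<lambda>i k. p * g i k) (\<lambda>k. p * m k) X (\<lambda>j. p * \<nu> j) b w"
        by (rule normal_form_scale[OF nf p])
      have minp: "minors (\<lambda>i k. p * g i k) k = p\<^sup>2 * C k" for k
        by (simp add: minors_def C_def power2_eq_square algebra_simps)
      have p2: "p\<^sup>2 \<noteq> 0" using p by simp
      note ch = chart_fixed_points[OF nfp minp p2 rn1 rn2]
      have Cx: "chart_e (vecC x) r = chart_e C r" "chart_f (vecC x) r = chart_f C r"
        "chart_det (vecC x) r = chart_det C r"
        using sx(3) by (auto simp: chart_e_def chart_f_def chart_det_def C_def fun_eq_iff)
      have pt: "chart_pt (vecC x) r u = chart_pt C r u" for u by (simp add: chart_pt_def Cx fun_eq_iff)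
      have ql: "chart_l1 r (qf (matG x) v) = chart_l1 r (qf (\<lambda>i k. p * g i k) v)"
        "chart_l2 r (qf (matG x) v) = chart_l2 r (qf (\<lambda>i k. p * g i k) v)"
        "chart_l1 r (qbil (matG x) v v') = chart_l1 r (qbil (\<lambda>i k. p * g i k) v v')"
        "chart_l2 r (qbil (matG x) v v') = chart_l2 r (qbil (\<lambda>i k. p * g i k) v v')" for v v'
        using sx(5) by (simp_all add: chart_l1_def chart_l2_def qf_def qbil_def sum3 p_def)
      have lins: "lin (vecM' x) v = lin (\<lambda>k. p * m k) v" "lin (\<lambda>k. matG x k k) v = lin (\<lambda>k. p * g k k) v" for v
        using sx(4,5) by (simp_all add: lin_def sum3 p_def)
      have K: "polK3 x = - chart_l2 r (qf (\<lambda>i k. p * g i k) (chart_e C r))"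
        "polK2 x = chart_l1 r (qf (\<lambda>i k. p * g i k) (chart_e C r))
          - 2 * chart_l2 r (qbil (\<lambda>i k. p * g i k) (chart_e C r) (chart_f C r))"
        "polK1 x = 2 * chart_l1 r (qbil (\<lambda>i k. p * g i k) (chart_e C r) (chart_f C r))
          - chart_l2 r (qf (\<lambda>i k. p * g i k) (chart_f C r))"
        "polK0 x = chart_l1 r (qf (\<lambda>i k. p * g i k) (chart_f C r))"
        by (simp_all only: polK3_def polK2_def polK1_def polK0_def x8 Cx ql)
      have same: "polL (x(13 := u)) = chart_den (\<lambda>i k. p * g i k) (\<lambda>k. p * m k) C r u"
        "polU (x(13 := u)) = chart_num (\<lambda>i k. p * g i k) C r u"
        "polV (x(13 := u)) = chart_nu (\<lambda>i k. p * g i k) C r u" for u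
      proof -
        have up: "q (x(13 := u)) = q x" if "q \<in> polyfun 13" for q
          by (rule polyfun_cong[OF that]) simp
        have d: "matG (x(13 := u)) i k = matG x i k" "vecM' (x(13 := u)) k = vecM' x k" "vecC (x(13 := u)) k = vecC x k" for i k
          using up[OF polyfun_data(1)[OF order_refl]] up[OF polyfun_data(2)[OF order_refl]]
            up[OF polyfun_data(3)[OF order_refl]] by simp_all
        have d': "matG (x(13 := u)) = matG x" "vecM' (x(13 := u)) = vecM' x" "vecC (x(13 := u)) = vecC x"
          by (intro ext d)+
        have u8: "(x(13 := u)) 8 = r" "(x(13 := u)) 13 = u" by (simp_all add: x8)
        have nu: "chart_nu (matG x) (vecC x) r u = chart_nu (\<lambda>i k. p * g i k) C r u"
          by (simp only: chart_nu_def pt ql)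
        show "polL (x(13 := u)) = chart_den (\<lambda>i k. p * g i k) (\<lambda>k. p * m k) C r u"
          "polU (x(13 := u)) = chart_num (\<lambda>i k. p * g i k) C r u"
          "polV (x(13 := u)) = chart_nu (\<lambda>i k. p * g i k) C r u"
          by (simp_all only: polL_def polU_def polV_def d' u8 chart_den_def chart_num_def nu pt lins Cx)
      qed
      have spec: "spec_at polL polU polV x w j (z j)" if "j < 3" for j
        unfolding spec_at_def same z_def using ch(6-8)[OF _ that] by simp
      show ?thesis
        using sx(1) ch(1-5) spec[of 0] spec[of 1] spec[of 2] unfolding K z_def by simp
    qed
    show ?thesis
      using main[OF refl] by (intro exI[of _ "z 0"] exI[of _ "z 1"] exI[of _ "z 2"]) (auto simp: Let_def)
  qed
  ultimately show ?thesis unfolding tower.represents_def by blast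
qed

lemma annih_exists:
  assumes "in_F p q"
  shows "\<exists>m P Q. annih m P Q p q"
proof -
  from tower.quartic_relation[OF assms] obtain \<beta> where
    \<beta>: "\<forall>k\<le>4. \<beta> k \<in> polyfun 8" "\<exists>k\<le>4. \<exists>x. \<beta> k x \<noteq> 0"
      "\<forall>b w. tower.represents b w \<longrightarrow> q w \<noteq> 0 \<longrightarrow> (\<Sum>k\<le>(4::nat). \<beta> k b * (p w / q w) ^ k) = 0"
    by blast
  obtain k0 x0 where k0: "k0 \<le> 4" "\<beta> k0 x0 \<noteq> 0" using \<beta>(2) by blast
  show ?thesis
  proof (rule annih_of_relation[where \<beta> = \<beta> and N = generic, OF _ k0 polyfun_generic generic_nonzero])
    show "\<beta> k \<in> polyfun 8" if "k \<le> 4" for k using \<beta>(1) that by blast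
    fix c a pt
    assume E: "E4 c a pt" and gen: "generic (specB a pt) \<noteq> 0" and q: "q (specF c a pt) \<noteq> 0"
    obtain g m X \<nu> where "normal_form g m X \<nu> (specB a pt) (specF c a pt)"
      using E4_normal_form[OF E] by blast
    then have "tower.represents (specB a pt) (specF c a pt)" by (rule represents_if_generic[OF _ gen])
    then show "(\<Sum>k\<le>(4::nat). \<beta> k (specB a pt) * (p (specF c a pt) / q (specF c a pt)) ^ k) = 0"
      using \<beta>(3) q by blast
  qed
qed

subsection \<open>Independence of the known relations\<close>

text \<open>Cauchy's estimate: if \<open>s\<close> exceeded the bound, its leading power would
  dominate all other terms.\<close>

lemma hval_root_bound:
  assumes "hval m P Q b s = 0"
  shows "norm s \<le> 1 + (\<Sum>k<m. norm (P k b / Q k b))"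
proof (rule ccontr)
  define R where "R = (\<Sum>k<m. norm (P k b / Q k b))"
  assume "\<not> norm s \<le> 1 + (\<Sum>k<m. norm (P k b / Q k b))"
  then have s: "norm s > 1 + R" by (simp add: R_def)
  have "R \<ge> 0" unfolding R_def by (intro sum_nonneg) simp
  then have s1: "norm s > 1" "norm s > R" using s by auto
  have "m \<noteq> 0" using assms by (intro notI) (simp add: hval_def)
  then obtain l where m: "m = Suc l" using not0_implies_Suc by blast
  have "s ^ m = - (\<Sum>k<m. P k b / Q k b * s ^ k)"
    using assms by (simp add: hval_def eq_neg_iff_add_eq_0)
  then have "norm s ^ m = norm (\<Sum>k<m. P k b / Q k b * s ^ k)"
    by (metis norm_minus_cancel norm_power)
  also have "\<dots> \<le> (\<Sum>k<m. norm (P k b / Q k b) * norm s ^ l)"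
  proof (rule sum_norm_le)
    fix k assume "k \<in> {..<m}"
    then have "norm s ^ k \<le> norm s ^ l" using s1 by (intro power_increasing) (auto simp: m)
    then show "norm (P k b / Q k b * s ^ k) \<le> norm (P k b / Q k b) * norm s ^ l"
      unfolding norm_mult norm_power by (rule mult_left_mono) simp
  qed
  also have "\<dots> = R * norm s ^ l" by (simp add: R_def sum_distrib_right)
  also have "\<dots> < norm s * norm s ^ l"
    using s1 by (intro mult_strict_right_mono) (auto intro!: zero_less_power)
  finally show False by (simp add: m)
qed

text \<open>The value at \<open>z\<close> over \<open>a\<close> is the product of the differences
  between \<open>z\<close> and the two roots; the nearer root does the job. This form of continuity
  also covers a double root in the limit, as occurs at the base point.\<close>

lemma quadratic_root_near:
  fixes a b c z :: complex
  assumes "a \<noteq> 0"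
  shows "\<exists>x. a * x\<^sup>2 + b * x + c = 0 \<and> (norm (x - z))\<^sup>2 \<le> norm ((a * z\<^sup>2 + b * z + c) / a)"
proof -
  define d where "d = csqrt (b\<^sup>2 - 4 * a * c)"
  have d: "d\<^sup>2 = b\<^sup>2 - 4 * a * c" by (simp add: d_def)
  define x y where "x = (- b + d) / (2 * a)" and "y = (- b - d) / (2 * a)"
  have fact: "a * w\<^sup>2 + b * w + c = a * ((w - x) * (w - y))" for w
  proof -
    have s: "x + y = - b / a" using assms by (simp add: x_def y_def field_simps)
    have "x * y = (b\<^sup>2 - d\<^sup>2) / (4 * a\<^sup>2)"
      using assms by (simp add: x_def y_def field_simps power2_eq_square)
    then have p: "x * y = c / a" using assms unfolding d by (simp add: field_simps power2_eq_square)
    have "a * ((w - x) * (w - y)) = a * w\<^sup>2 - a * (x + y) * w + a * (x * y)"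
      by (simp add: power2_eq_square algebra_simps)
    then show ?thesis unfolding s p using assms by simp
  qed
  have "(a * z\<^sup>2 + b * z + c) / a = (x - z) * (y - z)"
  proof -
    have "(x - z) * (y - z) = (z - x) * (z - y)" by (simp add: algebra_simps)
    then show ?thesis unfolding fact using assms by simp
  qed
  then have n: "norm ((a * z\<^sup>2 + b * z + c) / a) = norm (x - z) * norm (y - z)" by (simp add: norm_mult)
  show ?thesis
  proof (cases "norm (x - z) \<le> norm (y - z)")
    case True
    then have "(norm (x - z))\<^sup>2 \<le> norm (x - z) * norm (y - z)"
      unfolding power2_eq_square by (intro mult_left_mono) auto
    then show ?thesis unfolding n using fact[of x] by (intro exI[of _ x]) simp
  next
    case False
    then have "(norm (y - z))\<^sup>2 \<le> norm (x - z) * norm (y - z)"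
      unfolding power2_eq_square by (intro mult_right_mono) auto
    then show ?thesis unfolding n using fact[of y] by (intro exI[of _ y]) simp
  qed
qed

lemma tendsto_quadratic_root:
  fixes a b c x :: "nat \<Rightarrow> complex"
  assumes lim: "a \<longlonglongrightarrow> a0" "b \<longlonglongrightarrow> b0" "c \<longlonglongrightarrow> c0" and a0: "a0 \<noteq> 0" and z: "a0 * z\<^sup>2 + b0 * z + c0 = 0"
    and near: "\<And>n. a n \<noteq> 0 \<Longrightarrow> (norm (x n - z))\<^sup>2 \<le> norm ((a n * z\<^sup>2 + b n * z + c n) / a n)"
  shows "x \<longlonglongrightarrow> z"
proof -
  have "(\<lambda>n. norm ((a n * z\<^sup>2 + b n * z + c n) / a n)) \<longlonglongrightarrow> norm ((a0 * z\<^sup>2 + b0 * z + c0) / a0)"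
    using lim a0 by (intro tendsto_intros)
  then have 0: "(\<lambda>n. norm ((a n * z\<^sup>2 + b n * z + c n) / a n)) \<longlonglongrightarrow> 0" by (simp add: z)
  have ev: "eventually (\<lambda>n. (norm (x n - z))\<^sup>2 \<le> norm ((a n * z\<^sup>2 + b n * z + c n) / a n)) sequentially"
    using tendsto_imp_eventually_ne[OF lim(1) a0] by eventually_elim (rule near)
  have "(\<lambda>n. (norm (x n - z))\<^sup>2) \<longlonglongrightarrow> 0"
    by (rule tendsto_sandwich[OF _ ev tendsto_const 0]) simp
  then have "(\<lambda>n. sqrt ((norm (x n - z))\<^sup>2)) \<longlonglongrightarrow> sqrt 0" by (rule tendsto_real_sqrt)
  then have "(\<lambda>n. norm (x n - z)) \<longlonglongrightarrow> 0" by simp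
  then show ?thesis by (simp add: tendsto_norm_zero_iff LIM_zero_iff)
qed

text \<open>The weights are the values, on the Lagrange basis polynomials at \<open>a, b, c\<close>,
  of the linear functional sending \<open>1, y, y^2\<close> to \<open>1, 1, A\<close>.\<close>

lemma lagrange_three:
  fixes a b c A :: complex
  assumes "a \<noteq> b" "a \<noteq> c" "b \<noteq> c"
  defines "ra \<equiv> (A - (b + c) + b * c) / ((a - b) * (a - c))"
    and "rb \<equiv> (A - (a + c) + a * c) / ((b - a) * (b - c))"
    and "rc \<equiv> (A - (a + b) + a * b) / ((c - a) * (c - b))"
  shows "ra + rb + rc = 1" "ra * a + rb * b + rc * c = 1" "ra * a\<^sup>2 + rb * b\<^sup>2 + rc * c\<^sup>2 = A"
proof -
  have V: "(a - b) * (a - c) * (b - c) \<noteq> 0" using assms(1-3) by simp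
  have r: "ra = (A - (b + c) + b * c) * (b - c) / ((a - b) * (a - c) * (b - c))"
    "rb = - (A - (a + c) + a * c) * (a - c) / ((a - b) * (a - c) * (b - c))"
    "rc = (A - (a + b) + a * b) * (a - b) / ((a - b) * (a - c) * (b - c))"
    using assms(1-3) unfolding ra_def rb_def rc_def by (simp_all add: divide_simps) (simp_all add: algebra_simps)
  show "ra + rb + rc = 1" "ra * a + rb * b + rc * c = 1" "ra * a\<^sup>2 + rb * b\<^sup>2 + rc * c\<^sup>2 = A"
    unfolding r times_divide_eq_left add_divide_distrib[symmetric] using V
    by (simp_all only: divide_eq_eq if_False) (simp_all add: power2_eq_square algebra_simps)
qed

text \<open>With \<open>y j = 1 / v j\<close> and \<open>\<rho> j = v j / u j\<close> the known relations read \<open>\<Sum> \<rho> j = \<Sum> \<rho> j y j = 1\<close>,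
  \<open>\<Sum> \<rho> j (y j)^2 = A\<close>, \<open>\<Sum> y j = B\<close>, \<open>\<Sum> 1 / \<rho> j = C\<close> with the constants below; the first three
  determine \<open>\<rho>\<close> in terms of \<open>y\<close>.\<close>

definition constA :: "(nat \<Rightarrow> complex) \<Rightarrow> complex" where
  "constA b = 1 - (\<Sum>i<4. 1 / b (2 * i + 1))"
text \<open>Here 3 is \<open>4 - 1\<close>, after subtracting the sum of
  \<open>\<rho> j * y j\<close>; the 9 in \<open>constC\<close> is \<open>16 - 7\<close>, since
  \<open>(u + v)^2 / (u v)\<close> is \<open>1 / \<rho> + 2 + \<rho>\<close>.\<close>

definition constB :: "(nat \<Rightarrow> complex) \<Rightarrow> complex" where
  "constB b = 3 - (\<Sum>i<4. b (2 * i) / b (2 * i + 1))"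
definition constC :: "(nat \<Rightarrow> complex) \<Rightarrow> complex" where
  "constC b = 9 - (\<Sum>i<4. b (2 * i) ^ 2 / b (2 * i + 1))"

text \<open>\<open>u = 1 / (\<rho> y)\<close> and \<open>v = 1 / y\<close>, with the weights of
  \<open>lagrange_three\<close> inserted for \<open>\<rho>\<close>.\<close>

definition uv_of :: "complex \<Rightarrow> complex \<Rightarrow> complex \<Rightarrow> complex \<Rightarrow> nat \<Rightarrow> complex" where
  "uv_of A y1 y2 y3 i = (if i = 0 then (y1 - y2) * (y1 - y3) / (y1 * (A - (y2 + y3) + y2 * y3)) else if i = 1 then 1 / y1
     else if i = 2 then (y2 - y1) * (y2 - y3) / (y2 * (A - (y1 + y3) + y1 * y3)) else if i = 3 then 1 / y2
     else if i = 4 then (y3 - y1) * (y3 - y2) / (y3 * (A - (y1 + y2) + y1 * y2)) else 1 / y3)"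

lemma known_rel_uv_of:
  assumes d: "\<And>i. i < 4 \<Longrightarrow> b (2 * i + 1) \<noteq> 0"
    and ne: "y1 \<noteq> 0" "y2 \<noteq> 0" "y3 \<noteq> 0" "y1 \<noteq> y2" "y1 \<noteq> y3" "y2 \<noteq> y3"
    and n: "A - (y2 + y3) + y2 * y3 \<noteq> 0" "A - (y1 + y3) + y1 * y3 \<noteq> 0" "A - (y1 + y2) + y1 * y2 \<noteq> 0"
    and A: "A = constA b" and B: "y1 + y2 + y3 = constB b"
    and C: "(y1 - y2) * (y1 - y3) / (A - (y2 + y3) + y2 * y3) + (y2 - y1) * (y2 - y3) / (A - (y1 + y3) + y1 * y3)
      + (y3 - y1) * (y3 - y2) / (A - (y1 + y2) + y1 * y2) = constC b"
  shows "known_rel b (uv_of A y1 y2 y3)"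
proof -
  define r1 where "r1 = (A - (y2 + y3) + y2 * y3) / ((y1 - y2) * (y1 - y3))"
  define r2 where "r2 = (A - (y1 + y3) + y1 * y3) / ((y2 - y1) * (y2 - y3))"
  define r3 where "r3 = (A - (y1 + y2) + y1 * y2) / ((y3 - y1) * (y3 - y2))"
  note L = lagrange_three[OF ne(4-6), of A, folded r1_def r2_def r3_def]
  have r: "r1 \<noteq> 0" "r2 \<noteq> 0" "r3 \<noteq> 0" using ne n by (auto simp: r1_def r2_def r3_def)
  define w where "w = uv_of A y1 y2 y3"
  have w: "w 0 = 1 / (y1 * r1)" "w 1 = 1 / y1" "w 2 = 1 / (y2 * r2)" "w 3 = 1 / y2"
      "w 4 = 1 / (y3 * r3)" "w 5 = 1 / y3"
    using ne by (simp_all add: w_def uv_of_def r1_def r2_def r3_def)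
  have C': "1 / r1 + 1 / r2 + 1 / r3 = constC b" using C by (simp add: r1_def r2_def r3_def)
  have quot: "1 / (1 / (y * r) * (1 / y)) = r * y\<^sup>2" "(1 / (y * r) + 1 / y) / (1 / (y * r) * (1 / y)) = y + r * y"
    "(1 / (y * r) + 1 / y)\<^sup>2 / (1 / (y * r) * (1 / y)) = 1 / r + 2 + r" "1 / (1 / (y * r)) = r * y"
    "1 / y / (1 / (y * r)) = r" if "y \<noteq> 0" "r \<noteq> 0" for y r :: complex
    using that by (simp_all add: field_simps power2_eq_square)
  note t1 = quot[OF ne(1) r(1)] and t2 = quot[OF ne(2) r(2)] and t3 = quot[OF ne(3) r(3)]
  have s: "(\<Sum>j<3. f (w (2 * j)) (w (2 * j + 1))) = f (1 / (y1 * r1)) (1 / y1) + f (1 / (y2 * r2)) (1 / y2)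
      + f (1 / (y3 * r3)) (1 / y3)" for f :: "complex \<Rightarrow> complex \<Rightarrow> complex"
    using w by (simp add: sum3)
  have "(\<Sum>j<3. 1 / (w (2 * j) * w (2 * j + 1))) = A"
    using s[of "\<lambda>u v. 1 / (u * v)"] unfolding t1 t2 t3 using L(3) by simp
  moreover have "(\<Sum>j<3. (w (2 * j) + w (2 * j + 1)) / (w (2 * j) * w (2 * j + 1))) = constB b + 1"
  proof -
    have "(\<Sum>j<3. (w (2 * j) + w (2 * j + 1)) / (w (2 * j) * w (2 * j + 1)))
        = (y1 + y2 + y3) + (r1 * y1 + r2 * y2 + r3 * y3)"
      using s[of "\<lambda>u v. (u + v) / (u * v)"] unfolding t1 t2 t3 by simp
    then show ?thesis unfolding B L(2) .
  qed
  moreover have "(\<Sum>j<3. (w (2 * j) + w (2 * j + 1)) ^ 2 / (w (2 * j) * w (2 * j + 1))) = constC b + 7"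
  proof -
    have "(\<Sum>j<3. (w (2 * j) + w (2 * j + 1)) ^ 2 / (w (2 * j) * w (2 * j + 1)))
        = (1 / r1 + 1 / r2 + 1 / r3) + 6 + (r1 + r2 + r3)"
      using s[of "\<lambda>u v. (u + v)\<^sup>2 / (u * v)"] unfolding t1 t2 t3 by simp
    then show ?thesis unfolding C' L(1) by simp
  qed
  moreover have "(\<Sum>j<3. 1 / w (2 * j)) = 1"
    using s[of "\<lambda>u v. 1 / u"] unfolding t1 t2 t3 using L(2) by simp
  moreover have "(\<Sum>j<3. w (2 * j + 1) / w (2 * j)) = 1"
    using s[of "\<lambda>u v. v / u"] unfolding t1 t2 t3 using L(1) by simp
  moreover have "w (2 * j) \<noteq> 0 \<and> w (2 * j + 1) \<noteq> 0" if "j < 3" for j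
  proof -
    have "j = 0 \<or> j = 1 \<or> j = 2" using that by linarith
    then show ?thesis using w ne r by (elim disjE) simp_all
  qed
  ultimately show ?thesis
    using d unfolding known_rel_def w_def[symmetric] by (simp add: A constA_def constB_def constC_def)
qed

text \<open>On the curve \<open>y1 = \<epsilon>\<close>, with \<open>S = y2 + y3\<close> and \<open>\<pi> = y2 y3\<close>, the last relation is quadratic in \<open>\<pi>\<close>.\<close>

lemma last_relation_quadratic:
  fixes A C \<epsilon> S y2 y3 :: complex
  defines "p \<equiv> y2 * y3"
    and "K \<equiv> A - \<epsilon> + (\<epsilon> - 1) * (S - \<epsilon>)" and "N \<equiv> (A - \<epsilon>)\<^sup>2 + (A - \<epsilon>) * (\<epsilon> - 1) * S"
    and "d \<equiv> \<epsilon>\<^sup>2 - \<epsilon> * S" and "e \<equiv> (\<epsilon> - 1)\<^sup>2"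
  assumes S: "S = y2 + y3"
    and n: "A - (y2 + y3) + y2 * y3 \<noteq> 0" "A - (\<epsilon> + y3) + \<epsilon> * y3 \<noteq> 0" "A - (\<epsilon> + y2) + \<epsilon> * y2 \<noteq> 0"
    and q: "(e - 4 * K - C * e) * p\<^sup>2 + (N + d * e + K * (S\<^sup>2 - 4 * (A - S)) - C * (N + (A - S) * e)) * p
      + (d * N + (A - S) * S\<^sup>2 * K - C * (A - S) * N) = 0"
  shows "(\<epsilon> - y2) * (\<epsilon> - y3) / (A - (y2 + y3) + y2 * y3) + (y2 - \<epsilon>) * (y2 - y3) / (A - (\<epsilon> + y3) + \<epsilon> * y3)
      + (y3 - \<epsilon>) * (y3 - y2) / (A - (\<epsilon> + y2) + \<epsilon> * y2) = C"
proof -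
  define n1 n2 n3 where "n1 = A - (y2 + y3) + y2 * y3" and "n2 = A - (\<epsilon> + y3) + \<epsilon> * y3"
    and "n3 = A - (\<epsilon> + y2) + \<epsilon> * y2"
  define D1 D2 D3 where "D1 = (\<epsilon> - y2) * (\<epsilon> - y3)" and "D2 = (y2 - \<epsilon>) * (y2 - y3)" and "D3 = (y3 - \<epsilon>) * (y3 - y2)"
  \<comment> \<open>Both combinations are symmetric in \<open>y2\<close> and \<open>y3\<close>,
    hence polynomials in \<open>S\<close> and \<open>p\<close>.\<close>
  have a: "n2 * n3 = N + e * p"
    unfolding n2_def n3_def N_def e_def p_def S by (simp add: power2_eq_square algebra_simps)
  have b: "D2 * n3 + D3 * n2 = (S\<^sup>2 - 4 * p) * K"
    unfolding D2_def D3_def n2_def n3_def K_def p_def S by (simp add: power2_eq_square algebra_simps)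
  have c: "D1 = d + p" "n1 = A - S + p"
    unfolding D1_def n1_def d_def p_def S by (simp_all add: power2_eq_square algebra_simps)
  have "D1 * (n2 * n3) + n1 * (D2 * n3 + D3 * n2) - C * (n1 * (n2 * n3)) = 0"
    unfolding a b c q[symmetric] by (simp add: power2_eq_square algebra_simps)
  moreover have "n1 \<noteq> 0" "n2 \<noteq> 0" "n3 \<noteq> 0" using n by (simp_all add: n1_def n2_def n3_def)
  ultimately have "D1 / n1 + D2 / n2 + D3 / n3 = C"
    by (simp add: divide_simps) (simp add: algebra_simps)
  then show ?thesis by (simp only: D1_def D2_def D3_def n1_def n2_def n3_def)
qed

text \<open>The base point: \<open>A = -1\<close>, \<open>B = 0\<close>, \<open>C = 1/2\<close>, where at \<open>y1 = 0\<close> the quadratic equation has the double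
  root \<open>\<pi> = 1/3\<close>.\<close>

definition base :: "nat \<Rightarrow> complex" where
  "base i = (if i = 0 then 0 else if i = 1 then 4 / 5 else if i = 2 then 1 else if i = 3 then - 1
     else if i = 4 then 2 else if i = 5 then 4 / 5 else if i = 6 then 3 else 2)"

lemma base_consts: "constA base = - 1" "constB base = 0" "constC base = 1 / 2"
  by (simp_all add: constA_def constB_def constC_def sum4 base_def)

lemma dense_nonzero:
  assumes "p \<in> polyfun n" "p y \<noteq> 0"
  shows "\<exists>b. (\<forall>k. p (b k) \<noteq> 0) \<and> (\<forall>i. (\<lambda>k. b k i) \<longlonglongrightarrow> x i)"
proof -
  obtain P where P: "\<And>s. p (\<lambda>i. x i + s * (y i - x i)) = poly P s"
    using polyfun_line[OF assms(1)] by blast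
  have "poly P 1 \<noteq> 0" using P[of 1] assms(2) by simp
  then have "finite {s. poly P s = 0}" by (intro poly_roots_finite) auto
  then have "finite (complex_of_real ` {t. poly P (of_real t) = 0})"
    by (rule finite_subset[rotated]) auto
  then have fin: "finite {t::real. poly P (of_real t) = 0}"
    by (rule finite_imageD) (simp add: inj_on_def)
  have "\<exists>t. 0 < t \<and> t < 1 / (real k + 1) \<and> poly P (of_real t) \<noteq> 0" for k
  proof -
    have "infinite {0<..<1 / (real k + 1)}" by (simp add: infinite_Ioo)
    then have "\<not> {0<..<1 / (real k + 1)} \<subseteq> {t. poly P (of_real t) = 0}"
      using fin finite_subset by blast
    then show ?thesis by (auto simp: add.commute)
  qed
  then have "\<forall>k. \<exists>t. 0 < t \<and> t < 1 / (real k + 1) \<and> poly P (of_real t) \<noteq> 0" ..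
  from choice[OF this] obtain t where t: "\<And>k. 0 < t k" "\<And>k. t k < 1 / (real k + 1)"
    "\<And>k. poly P (of_real (t k)) \<noteq> 0" by blast
  have "(\<lambda>k. 1 / real (Suc k)) \<longlonglongrightarrow> 0" by (rule lim_1_over_n[THEN LIMSEQ_Suc])
  then have "t \<longlonglongrightarrow> 0"
  proof (rule tendsto_sandwich[OF _ _ tendsto_const, rotated 2])
    show "eventually (\<lambda>k. 0 \<le> t k) sequentially"
      using t(1) by (intro always_eventually allI less_imp_le)
    show "eventually (\<lambda>k. t k \<le> 1 / real (Suc k)) sequentially"
      using t(2) by (intro always_eventually allI less_imp_le) (simp add: add.commute)
  qed
  then have t0: "(\<lambda>k. complex_of_real (t k)) \<longlonglongrightarrow> 0" using tendsto_of_real by fastforce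
  define b where "b = (\<lambda>k i. x i + of_real (t k) * (y i - x i))"
  have "p (b k) \<noteq> 0" for k unfolding b_def P by (rule t(3))
  moreover have "(\<lambda>k. b k i) \<longlonglongrightarrow> x i" for i
  proof -
    have "(\<lambda>k. b k i) \<longlonglongrightarrow> x i + 0 * (y i - x i)" unfolding b_def by (intro tendsto_intros t0)
    then show ?thesis by simp
  qed
  ultimately show ?thesis by blast
qed

text \<open>As \<open>y1\<close> tends to 0, the first pair \<open>(u, v)\<close> has simple poles
  in \<open>y1\<close> and the other two pairs stay finite, so each function has at most a simple
  pole. For \<open>e11\<close> the pole of the first \<open>u\<close> meets the sum of the other two
  \<open>v\<close>, which tends to 0; the leading term comes from the sum of the other two
  \<open>u\<close>, whose limit is nonzero.\<close>

lemma uv_of_sigma_limit: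
  assumes lim: "A \<longlonglongrightarrow> - 1" "y1 \<longlonglongrightarrow> 0" "y2 \<longlonglongrightarrow> \<eta>" "y3 \<longlonglongrightarrow> - \<eta>" and \<eta>: "\<eta>\<^sup>2 = - (1 / 3)"
    and ne: "eventually (\<lambda>k. y1 k \<noteq> 0) sequentially" and \<sigma>: "\<sigma> \<in> {e10, e30, e01, e11}"
  shows "\<exists>l. l \<noteq> 0 \<and> (\<lambda>k. y1 k * \<sigma> (uv_of (A k) (y1 k) (y2 k) (y3 k))) \<longlonglongrightarrow> l"
proof -
  define n1 n2 n3 where "n1 = (\<lambda>k. A k - (y2 k + y3 k) + y2 k * y3 k)" and "n2 = (\<lambda>k. A k - (y1 k + y3 k) + y1 k * y3 k)"
    and "n3 = (\<lambda>k. A k - (y1 k + y2 k) + y1 k * y2 k)"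
  define D1 D2 D3 where "D1 = (\<lambda>k. (y1 k - y2 k) * (y1 k - y3 k))" and "D2 = (\<lambda>k. (y2 k - y1 k) * (y2 k - y3 k))"
    and "D3 = (\<lambda>k. (y3 k - y1 k) * (y3 k - y2 k))"
  define u1 u2 u3 where "u1 = (\<lambda>k. D1 k / n1 k)" and "u2 = (\<lambda>k. D2 k / (y2 k * n2 k))" and "u3 = (\<lambda>k. D3 k / (y3 k * n3 k))"
  have \<eta>\<eta>: "\<eta> * \<eta> = - (1 / 3)" using \<eta> by (simp add: power2_eq_square)
  have \<eta>0: "\<eta> \<noteq> 0" using \<eta>\<eta> by auto
  have \<eta>1: "1 + \<eta> \<noteq> 0" "\<eta> - 1 \<noteq> 0"
  proof -
    have "(1 + \<eta>) * (\<eta> - 1) \<noteq> 0" using \<eta>\<eta> by (simp add: algebra_simps)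
    then show "1 + \<eta> \<noteq> 0" "\<eta> - 1 \<noteq> 0" by auto
  qed
  have "n1 \<longlonglongrightarrow> - 1 - (\<eta> + - \<eta>) + \<eta> * - \<eta>" "n2 \<longlonglongrightarrow> - 1 - (0 + - \<eta>) + 0 * - \<eta>" "n3 \<longlonglongrightarrow> - 1 - (0 + \<eta>) + 0 * \<eta>"
    "D1 \<longlonglongrightarrow> (0 - \<eta>) * (0 - - \<eta>)" "D2 \<longlonglongrightarrow> (\<eta> - 0) * (\<eta> - - \<eta>)" "D3 \<longlonglongrightarrow> (- \<eta> - 0) * (- \<eta> - \<eta>)"
    unfolding n1_def n2_def n3_def D1_def D2_def D3_def by (intro tendsto_intros lim)+
  moreover have "(\<eta> - 0) * (\<eta> - - \<eta>) = 2 * (\<eta> * \<eta>)" "(- \<eta> - 0) * (- \<eta> - \<eta>) = 2 * (\<eta> * \<eta>)" by simp_all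
  ultimately have n: "n1 \<longlonglongrightarrow> - (2 / 3)" "n2 \<longlonglongrightarrow> \<eta> - 1" "n3 \<longlonglongrightarrow> - (1 + \<eta>)"
    and D: "D1 \<longlonglongrightarrow> 1 / 3" "D2 \<longlonglongrightarrow> - (2 / 3)" "D3 \<longlonglongrightarrow> - (2 / 3)"
    by (simp_all add: \<eta>\<eta>)
  have u: "u1 \<longlonglongrightarrow> (1 / 3) / - (2 / 3)" "u2 \<longlonglongrightarrow> - (2 / 3) / (\<eta> * (\<eta> - 1))" "u3 \<longlonglongrightarrow> - (2 / 3) / (- \<eta> * - (1 + \<eta>))"
    unfolding u1_def u2_def u3_def using \<eta>0 \<eta>1 by (intro tendsto_intros n D lim; simp add: add_eq_0_iff)+
  have v: "(\<lambda>k. 1 / y2 k) \<longlonglongrightarrow> 1 / \<eta>" "(\<lambda>k. 1 / y3 k) \<longlonglongrightarrow> 1 / - \<eta>"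
    using \<eta>0 by (intro tendsto_intros lim; simp)+
  have w: "uv_of (A k) (y1 k) (y2 k) (y3 k) 0 = u1 k / y1 k" "uv_of (A k) (y1 k) (y2 k) (y3 k) 1 = 1 / y1 k"
    "uv_of (A k) (y1 k) (y2 k) (y3 k) 2 = u2 k" "uv_of (A k) (y1 k) (y2 k) (y3 k) 3 = 1 / y2 k"
    "uv_of (A k) (y1 k) (y2 k) (y3 k) 4 = u3 k" "uv_of (A k) (y1 k) (y2 k) (y3 k) 5 = 1 / y3 k" for k
    by (simp_all add: uv_of_def u1_def u2_def u3_def D1_def D2_def D3_def n1_def n2_def n3_def)
  have *: "\<exists>l. l \<noteq> 0 \<and> (\<lambda>k. y1 k * \<sigma> (uv_of (A k) (y1 k) (y2 k) (y3 k))) \<longlonglongrightarrow> l"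
    if "\<And>k. y1 k \<noteq> 0 \<Longrightarrow> y1 k * \<sigma> (uv_of (A k) (y1 k) (y2 k) (y3 k)) = f k" "f \<longlonglongrightarrow> l" "l \<noteq> 0" for f l
  proof -
    have "eventually (\<lambda>k. f k = y1 k * \<sigma> (uv_of (A k) (y1 k) (y2 k) (y3 k))) sequentially"
      using ne by eventually_elim (rule that(1)[symmetric])
    then have "(\<lambda>k. y1 k * \<sigma> (uv_of (A k) (y1 k) (y2 k) (y3 k))) \<longlonglongrightarrow> l"
      by (rule Lim_transform_eventually[OF that(2)])
    then show ?thesis using that(3) by blast
  qed
  consider "\<sigma> = e10" | "\<sigma> = e30" | "\<sigma> = e01" | "\<sigma> = e11" using \<sigma> by blast
  then show ?thesis
  proof cases
    case 1
    show ?thesis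
    proof (rule *)
      show "y1 k * \<sigma> (uv_of (A k) (y1 k) (y2 k) (y3 k)) = u1 k + y1 k * (u2 k + u3 k)" if "y1 k \<noteq> 0" for k
        using that unfolding 1 e10_def w by (simp add: field_simps)
      show "(\<lambda>k. u1 k + y1 k * (u2 k + u3 k)) \<longlonglongrightarrow> (1 / 3) / - (2 / 3)
          + 0 * (- (2 / 3) / (\<eta> * (\<eta> - 1)) + - (2 / 3) / (- \<eta> * - (1 + \<eta>)))"
        by (intro tendsto_intros u lim)
    qed simp
  next
    case 2
    show ?thesis
    proof (rule *)
      show "y1 k * \<sigma> (uv_of (A k) (y1 k) (y2 k) (y3 k)) = u1 k * u2 k * u3 k" if "y1 k \<noteq> 0" for k
        using that unfolding 2 e30_def w by (simp add: field_simps)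
      show "(\<lambda>k. u1 k * u2 k * u3 k) \<longlonglongrightarrow> (1 / 3) / - (2 / 3) * (- (2 / 3) / (\<eta> * (\<eta> - 1)))
          * (- (2 / 3) / (- \<eta> * - (1 + \<eta>)))"
        by (intro tendsto_intros u lim)
    qed (use \<eta>0 \<eta>1 in \<open>simp add: add_eq_0_iff\<close>)
  next
    case 3
    show ?thesis
    proof (rule *)
      show "y1 k * \<sigma> (uv_of (A k) (y1 k) (y2 k) (y3 k)) = 1 + y1 k * (1 / y2 k + 1 / y3 k)" if "y1 k \<noteq> 0" for k
        using that unfolding 3 e01_def w by (simp add: distrib_left add.assoc)
      show "(\<lambda>k. 1 + y1 k * (1 / y2 k + 1 / y3 k)) \<longlonglongrightarrow> 1 + 0 * (1 / \<eta> + 1 / - \<eta>)"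
        by (intro tendsto_intros v lim)
    qed simp
  next
    case 4
    show ?thesis
    proof (rule *)
      show "y1 k * \<sigma> (uv_of (A k) (y1 k) (y2 k) (y3 k)) = u1 k * (1 / y2 k + 1 / y3 k) + (u2 k + u3 k)
          + y1 k * (u2 k * (1 / y3 k) + u3 k * (1 / y2 k))" if "y1 k \<noteq> 0" for k
        using that unfolding 4 e11_def w by (simp add: distrib_left distrib_right add_ac)
      show "(\<lambda>k. u1 k * (1 / y2 k + 1 / y3 k) + (u2 k + u3 k) + y1 k * (u2 k * (1 / y3 k) + u3 k * (1 / y2 k)))
        \<longlonglongrightarrow> (1 / 3) / - (2 / 3) * (1 / \<eta> + 1 / - \<eta>) + (- (2 / 3) / (\<eta> * (\<eta> - 1)) + - (2 / 3) / (- \<eta> * - (1 + \<eta>)))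
          + 0 * (- (2 / 3) / (\<eta> * (\<eta> - 1)) * (1 / - \<eta>) + - (2 / 3) / (- \<eta> * - (1 + \<eta>)) * (1 / \<eta>))"
        by (intro tendsto_intros u v lim)
      have "- (2 / 3) / (\<eta> * (\<eta> - 1)) + - (2 / 3) / (- \<eta> * - (1 + \<eta>)) = - (4 / 3) / ((\<eta> - 1) * (1 + \<eta>))"
      proof -
        have "r / (\<eta> * p) + r / (- \<eta> * - q) = r * (p + q) / (\<eta> * (p * q))" if "p \<noteq> 0" "q \<noteq> 0" for r p q
          using that \<eta>0 by (simp add: field_simps)
        from this[OF \<eta>1(2,1), of "- (2 / 3)"] show ?thesis using \<eta>0 by simp
      qed
      then show "(1 / 3) / - (2 / 3) * (1 / \<eta> + 1 / - \<eta>) + (- (2 / 3) / (\<eta> * (\<eta> - 1)) + - (2 / 3) / (- \<eta> * - (1 + \<eta>)))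
          + 0 * (- (2 / 3) / (\<eta> * (\<eta> - 1)) * (1 / - \<eta>) + - (2 / 3) / (- \<eta> * - (1 + \<eta>)) * (1 / \<eta>)) \<noteq> 0"
        using \<eta>1 by simp
    qed
  qed
qed

text \<open>The sequences \<open>b\<close> and \<open>\<epsilon>\<close> are left free because
  \<open>b\<close> will have to avoid zeros of unknown denominators, and \<open>\<epsilon>\<close>
  to shrink faster than the resulting coefficients grow.\<close>

lemma known_rel_sequence:
  assumes b: "\<And>i. (\<lambda>k. b k i) \<longlonglongrightarrow> base i" and \<epsilon>: "\<epsilon> \<longlonglongrightarrow> 0" "\<And>k. \<epsilon> k \<noteq> 0" and \<sigma>: "\<sigma> \<in> {e10, e30, e01, e11}"
  shows "\<exists>w l. eventually (\<lambda>k. known_rel (b k) (w k)) sequentially \<and> l \<noteq> 0 \<and> (\<lambda>k. \<epsilon> k * \<sigma> (w k)) \<longlonglongrightarrow> l"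
proof -
  have base0: "base (2 * i + 1) \<noteq> 0" if "i < 4" for i
  proof -
    have "i = 0 \<or> i = 1 \<or> i = 2 \<or> i = 3" using that by linarith
    then show ?thesis by (elim disjE) (simp_all add: base_def)
  qed
  define A where "A = (\<lambda>k. constA (b k))"
  define S where "S = (\<lambda>k. constB (b k) - \<epsilon> k)"
  define C where "C = (\<lambda>k. constC (b k))"
  have "A \<longlonglongrightarrow> constA base" "S \<longlonglongrightarrow> constB base - 0" "C \<longlonglongrightarrow> constC base"
    unfolding A_def S_def C_def constA_def constB_def constC_def using base0
    by (intro tendsto_intros b \<epsilon>(1); simp)+
  then have lim: "A \<longlonglongrightarrow> - 1" "S \<longlonglongrightarrow> 0" "C \<longlonglongrightarrow> 1 / 2" by (simp_all add: base_consts)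
  define K where "K = (\<lambda>k. A k - \<epsilon> k + (\<epsilon> k - 1) * (S k - \<epsilon> k))"
  define N where "N = (\<lambda>k. (A k - \<epsilon> k)\<^sup>2 + (A k - \<epsilon> k) * (\<epsilon> k - 1) * S k)"
  define d where "d = (\<lambda>k. (\<epsilon> k)\<^sup>2 - \<epsilon> k * S k)"
  define e where "e = (\<lambda>k. (\<epsilon> k - 1)\<^sup>2)"
  have "K \<longlonglongrightarrow> - 1 - 0 + (0 - 1) * (0 - 0)" "N \<longlonglongrightarrow> (- 1 - 0)\<^sup>2 + (- 1 - 0) * (0 - 1) * 0" "d \<longlonglongrightarrow> 0\<^sup>2 - 0 * 0"
    "e \<longlonglongrightarrow> (0 - 1)\<^sup>2"
    unfolding K_def N_def d_def e_def by (intro tendsto_intros lim \<epsilon>(1))+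
  then have lim2: "K \<longlonglongrightarrow> - 1" "N \<longlonglongrightarrow> 1" "d \<longlonglongrightarrow> 0" "e \<longlonglongrightarrow> 1" by simp_all
  define q2 where "q2 = (\<lambda>k. e k - 4 * K k - C k * e k)"
  define q1 where "q1 = (\<lambda>k. N k + d k * e k + K k * ((S k)\<^sup>2 - 4 * (A k - S k)) - C k * (N k + (A k - S k) * e k))"
  define q0 where "q0 = (\<lambda>k. d k * N k + (A k - S k) * (S k)\<^sup>2 * K k - C k * (A k - S k) * N k)"
  have "q2 \<longlonglongrightarrow> 1 - 4 * - 1 - 1 / 2 * 1"
    "q1 \<longlonglongrightarrow> 1 + 0 * 1 + - 1 * (0\<^sup>2 - 4 * (- 1 - 0)) - 1 / 2 * (1 + (- 1 - 0) * 1)"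
    "q0 \<longlonglongrightarrow> 0 * 1 + (- 1 - 0) * 0\<^sup>2 * - 1 - 1 / 2 * (- 1 - 0) * 1"
    unfolding q2_def q1_def q0_def by (intro tendsto_intros lim lim2)+
  then have q: "q2 \<longlonglongrightarrow> 9 / 2" "q1 \<longlonglongrightarrow> - 3" "q0 \<longlonglongrightarrow> 1 / 2" by simp_all
  have "\<exists>x. q2 k \<noteq> 0 \<longrightarrow> q2 k * x\<^sup>2 + q1 k * x + q0 k = 0 \<and>
      (norm (x - 1 / 3))\<^sup>2 \<le> norm ((q2 k * (1 / 3)\<^sup>2 + q1 k * (1 / 3) + q0 k) / q2 k)" for k
    using quadratic_root_near[of "q2 k" "q1 k" "q0 k" "1 / 3"] by blast
  then obtain p where p: "\<And>k. q2 k \<noteq> 0 \<Longrightarrow> q2 k * (p k)\<^sup>2 + q1 k * p k + q0 k = 0"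
    "\<And>k. q2 k \<noteq> 0 \<Longrightarrow> (norm (p k - 1 / 3))\<^sup>2 \<le> norm ((q2 k * (1 / 3)\<^sup>2 + q1 k * (1 / 3) + q0 k) / q2 k)"
    by metis
  have plim: "p \<longlonglongrightarrow> 1 / 3"
    by (rule tendsto_quadratic_root[OF q]) (use p(2) in \<open>auto simp: power2_eq_square\<close>)
  \<comment> \<open>In the limit \<open>y2 + y3 = 0\<close> and \<open>y2 * y3 = 1 / 3\<close>, so
    \<open>y2\<close> and \<open>y3\<close> tend to the two square roots of -1/3.\<close>
  define \<eta> where "\<eta> = csqrt (- (1 / 3))"
  have \<eta>: "\<eta>\<^sup>2 = - (1 / 3)" unfolding \<eta>_def by (rule power2_csqrt)
  have "\<exists>x. 1 * x\<^sup>2 + - S k * x + p k = 0 \<and> (norm (x - \<eta>))\<^sup>2 \<le> norm ((1 * \<eta>\<^sup>2 + - S k * \<eta> + p k) / 1)" for k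
    by (rule quadratic_root_near) simp
  then obtain y2 where y2: "\<And>k. 1 * (y2 k)\<^sup>2 + - S k * y2 k + p k = 0"
    "\<And>k. (norm (y2 k - \<eta>))\<^sup>2 \<le> norm ((1 * \<eta>\<^sup>2 + - S k * \<eta> + p k) / 1)" by metis
  have y2lim: "y2 \<longlonglongrightarrow> \<eta>"
  proof (rule tendsto_quadratic_root)
    show "(\<lambda>k. 1::complex) \<longlonglongrightarrow> 1" "(\<lambda>k. - S k) \<longlonglongrightarrow> - 0" "p \<longlonglongrightarrow> 1 / 3"
      by (intro tendsto_intros lim plim)+
    show "1 * \<eta>\<^sup>2 + - 0 * \<eta> + 1 / 3 = 0" using \<eta> by simp
  qed (use y2(2) in simp_all)
  define y3 where "y3 = (\<lambda>k. S k - y2 k)"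
  have "y3 \<longlonglongrightarrow> 0 - \<eta>" unfolding y3_def by (intro tendsto_intros lim y2lim)
  then have y3lim: "y3 \<longlonglongrightarrow> - \<eta>" by simp
  have py: "p k = y2 k * y3 k" for k
    using y2(1)[of k] by (simp add: y3_def power2_eq_square algebra_simps eq_neg_iff_add_eq_0)
  define w where "w = (\<lambda>k. uv_of (A k) (\<epsilon> k) (y2 k) (y3 k))"
  have \<eta>0: "\<eta> \<noteq> 0" using \<eta> by auto
  have "3 * \<eta>\<^sup>2 = - 1" using \<eta> by simp
  then have \<eta>1: "\<eta> \<noteq> 1" "\<eta> \<noteq> - 1" by auto
  have ev0: "eventually (\<lambda>k. f k \<noteq> 0) sequentially" if "f \<longlonglongrightarrow> l" "l \<noteq> 0" for f and l :: complex
    by (rule tendsto_imp_eventually_ne[OF that])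
  have "eventually (\<lambda>k. \<forall>i\<in>{..<4}. b k (2 * i + 1) \<noteq> 0) sequentially"
    by (intro eventually_ball_finite) (auto intro!: ev0[OF b] base0[simplified])
  moreover have "eventually (\<lambda>k. q2 k \<noteq> 0) sequentially" by (rule ev0[OF q(1)]) simp
  moreover have "eventually (\<lambda>k. y2 k \<noteq> 0) sequentially" "eventually (\<lambda>k. y3 k \<noteq> 0) sequentially"
    using ev0[OF y2lim] ev0[OF y3lim] \<eta>0 by auto
  moreover have "eventually (\<lambda>k. y2 k - \<epsilon> k \<noteq> 0) sequentially" "eventually (\<lambda>k. y3 k - \<epsilon> k \<noteq> 0) sequentially"
      "eventually (\<lambda>k. y2 k - y3 k \<noteq> 0) sequentially"
    using ev0[OF tendsto_diff[OF y2lim \<epsilon>(1)]] ev0[OF tendsto_diff[OF y3lim \<epsilon>(1)]]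
      ev0[OF tendsto_diff[OF y2lim y3lim]] \<eta>0 by auto
  moreover have "eventually (\<lambda>k. A k - (y2 k + y3 k) + y2 k * y3 k \<noteq> 0) sequentially"
  proof (rule ev0)
    show "(\<lambda>k. A k - (y2 k + y3 k) + y2 k * y3 k) \<longlonglongrightarrow> - 1 - (\<eta> + - \<eta>) + \<eta> * - \<eta>"
      by (intro tendsto_intros lim y2lim y3lim)
  qed (use \<eta> in \<open>simp add: power2_eq_square\<close>)
  moreover have "eventually (\<lambda>k. A k - (\<epsilon> k + y3 k) + \<epsilon> k * y3 k \<noteq> 0) sequentially"
  proof (rule ev0)
    show "(\<lambda>k. A k - (\<epsilon> k + y3 k) + \<epsilon> k * y3 k) \<longlonglongrightarrow> - 1 - (0 + - \<eta>) + 0 * - \<eta>"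
      by (intro tendsto_intros lim \<epsilon>(1) y3lim)
  qed (use \<eta>1 in simp)
  moreover have "eventually (\<lambda>k. A k - (\<epsilon> k + y2 k) + \<epsilon> k * y2 k \<noteq> 0) sequentially"
  proof (rule ev0)
    show "(\<lambda>k. A k - (\<epsilon> k + y2 k) + \<epsilon> k * y2 k) \<longlonglongrightarrow> - 1 - (0 + \<eta>) + 0 * \<eta>"
      by (intro tendsto_intros lim \<epsilon>(1) y2lim)
  qed (use \<eta>1 in \<open>auto simp: eq_neg_iff_add_eq_0\<close>)
  ultimately have "eventually (\<lambda>k. known_rel (b k) (w k)) sequentially"
  proof eventually_elim
    case (elim k)
    have n: "A k - (y2 k + y3 k) + y2 k * y3 k \<noteq> 0" "A k - (\<epsilon> k + y3 k) + \<epsilon> k * y3 k \<noteq> 0"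
      "A k - (\<epsilon> k + y2 k) + \<epsilon> k * y2 k \<noteq> 0" using elim by auto
    have S: "S k = y2 k + y3 k" by (simp add: y3_def)
    have "q2 k * (y2 k * y3 k)\<^sup>2 + q1 k * (y2 k * y3 k) + q0 k = 0" using p(1)[of k] elim by (simp add: py)
    note C = last_relation_quadratic[OF S n this[unfolded q2_def q1_def q0_def K_def N_def d_def e_def]]
    show ?case unfolding w_def
    proof (rule known_rel_uv_of[OF _ _ _ _ _ _ _ n])
      show "\<epsilon> k + y2 k + y3 k = constB (b k)" by (simp add: y3_def S_def)
      show "A k = constA (b k)" by (simp add: A_def)
      show "(\<epsilon> k - y2 k) * (\<epsilon> k - y3 k) / (A k - (y2 k + y3 k) + y2 k * y3 k)
        + (y2 k - \<epsilon> k) * (y2 k - y3 k) / (A k - (\<epsilon> k + y3 k) + \<epsilon> k * y3 k)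
        + (y3 k - \<epsilon> k) * (y3 k - y2 k) / (A k - (\<epsilon> k + y2 k) + \<epsilon> k * y2 k) = constC (b k)"
        using C by (simp add: C_def)
    qed (use elim \<epsilon>(2)[of k] in auto)
  qed
  moreover obtain l where "l \<noteq> 0" "(\<lambda>k. \<epsilon> k * \<sigma> (w k)) \<longlonglongrightarrow> l"
    using uv_of_sigma_limit[OF lim(1) \<epsilon>(1) y2lim y3lim \<eta> _ \<sigma>] \<epsilon>(2) unfolding w_def by auto
  ultimately show ?thesis by blast
qed

text \<open>If the relation followed from the known ones, \<open>\<sigma>\<close> would be bounded
  in terms of \<open>b\<close> alone, whereas along \<open>known_rel_sequence\<close> it grows like
  a multiple of \<open>1 / \<epsilon>\<close>.\<close>

lemma not_implied_by_known_rel: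
  assumes Q: "\<And>k. k < m \<Longrightarrow> Q k \<in> polyfun 8" "\<And>k. k < m \<Longrightarrow> \<exists>x. Q k x \<noteq> 0"
    and \<sigma>: "\<sigma> \<in> {e10, e30, e01, e11}"
  shows "\<exists>b w. known_rel b w \<and> (\<forall>k<m. Q k b \<noteq> 0) \<and> hval m P Q b (\<sigma> w) \<noteq> 0"
proof (rule ccontr)
  assume contr: "\<not> (\<exists>b w. known_rel b w \<and> (\<forall>k<m. Q k b \<noteq> 0) \<and> hval m P Q b (\<sigma> w) \<noteq> 0)"
  have "(\<lambda>x. \<Prod>k\<in>{..<m}. Q k x) \<in> polyfun 8" using Q by (intro polyfun_prod) auto
  moreover obtain y where "(\<Prod>k\<in>{..<m}. Q k y) \<noteq> 0"
    using polyfun_prod_nonzero[of "{..<m}" Q 8] Q by auto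
  ultimately obtain b where b: "\<And>n. (\<Prod>k\<in>{..<m}. Q k (b n)) \<noteq> 0" "\<And>i. (\<lambda>n. b n i) \<longlonglongrightarrow> base i"
    using dense_nonzero[of "\<lambda>x. \<Prod>k\<in>{..<m}. Q k x" 8 y base] by blast
  define R where "R = (\<lambda>n. 1 + (\<Sum>k<m. norm (P k (b n) / Q k (b n))))"
  have R: "R n \<ge> 1" for n unfolding R_def by (simp add: sum_nonneg)
  \<comment> \<open>Small against the root bound \<open>R n\<close> at \<open>b n\<close>: then
    \<open>\<epsilon> n * R n\<close> tends to 0, although
    \<open>\<epsilon> n * \<sigma> (w n)\<close> has a nonzero limit.\<close>
  define \<epsilon> where "\<epsilon> = (\<lambda>n. 1 / (real (Suc n) * R n))"
  have pos: "0 < \<epsilon> n" "\<epsilon> n * R n = 1 / real (Suc n)" for n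
    using R[of n] by (simp_all add: \<epsilon>_def)
  have zero: "(\<lambda>n. 1 / real (Suc n)) \<longlonglongrightarrow> 0" by (rule lim_1_over_n[THEN LIMSEQ_Suc])
  have "\<epsilon> n \<le> 1 / real (Suc n)" for n
    using mult_left_mono[OF R[of n], of "\<epsilon> n"] pos[of n] by simp
  then have "\<epsilon> \<longlonglongrightarrow> 0"
    using pos(1) by (intro tendsto_sandwich[OF _ _ tendsto_const zero]) (auto intro!: always_eventually less_imp_le)
  then have \<epsilon>0: "(\<lambda>n. complex_of_real (\<epsilon> n)) \<longlonglongrightarrow> 0" using tendsto_of_real by fastforce
  have \<epsilon>nz: "complex_of_real (\<epsilon> n) \<noteq> 0" for n using pos(1)[of n] by simp
  obtain w l where w: "eventually (\<lambda>n. known_rel (b n) (w n)) sequentially" and l: "l \<noteq> 0"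
    "(\<lambda>n. complex_of_real (\<epsilon> n) * \<sigma> (w n)) \<longlonglongrightarrow> l"
    using known_rel_sequence[OF b(2) \<epsilon>0 \<epsilon>nz \<sigma>] by blast
  have "eventually (\<lambda>n. norm (complex_of_real (\<epsilon> n) * \<sigma> (w n)) \<le> 1 / real (Suc n)) sequentially"
    using w
  proof eventually_elim
    case (elim n)
    have "\<forall>k<m. Q k (b n) \<noteq> 0" using b(1)[of n] by auto
    then have "hval m P Q (b n) (\<sigma> (w n)) = 0" using contr elim by blast
    then have "norm (\<sigma> (w n)) \<le> R n" unfolding R_def by (rule hval_root_bound)
    then have "\<epsilon> n * norm (\<sigma> (w n)) \<le> \<epsilon> n * R n" using pos(1)[of n] by (intro mult_left_mono) auto
    then show ?case using pos[of n] by (simp add: norm_mult)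
  qed
  then have "(\<lambda>n. complex_of_real (\<epsilon> n) * \<sigma> (w n)) \<longlonglongrightarrow> 0"
    by (intro tendsto_0_le[OF zero, where K = 1]) simp
  then show False using LIMSEQ_unique[OF l(2)] l(1) by simp
qed

lemma in_F_symmetric:
  assumes "\<sigma> \<in> {e10, e30, e01, e11}"
  shows "in_F \<sigma> (\<lambda>_. 1)"
proof -
  define S where "S = (\<lambda>f (w::nat \<Rightarrow> complex). \<Sum>j<3. f (w (2 * j)) (w (2 * j + 1)) :: complex)"
  have S: "S f (pair_perm \<pi> w) = S f w" if \<pi>: "bij_betw \<pi> {..<3} {..<3}" for f \<pi> w
  proof -
    have "S f (pair_perm \<pi> w) = (\<Sum>j<3. f (w (2 * \<pi> j)) (w (2 * \<pi> j + 1)))"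
      unfolding S_def by (intro sum.cong) (auto simp: pair_perm_def)
    also have "\<dots> = S f w"
      unfolding S_def using sum.reindex_bij_betw[OF \<pi>, of "\<lambda>j. f (w (2 * j)) (w (2 * j + 1))"] .
    finally show ?thesis .
  qed
  have prod3: "(\<Prod>j<3. f j) = f 0 * f 1 * f (2::nat)" for f :: "nat \<Rightarrow> complex"
    by (simp add: eval_nat_numeral mult_ac)
  have e10: "e10 w = S (\<lambda>u v. u) w" and e01: "e01 w = S (\<lambda>u v. v) w"
    and e11: "e11 w = S (\<lambda>u v. u) w * S (\<lambda>u v. v) w - S (\<lambda>u v. u * v) w"
    and e30: "e30 w = (\<Prod>j<3. w (2 * j))" for w
    unfolding e10_def e01_def e11_def e30_def S_def sum3 prod3
    by (simp_all add: eval_nat_numeral algebra_simps)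
  have "\<sigma> (pair_perm \<pi> w) = \<sigma> w" if \<pi>: "bij_betw \<pi> {..<3} {..<3}" for \<pi> w
  proof -
    have "(\<Prod>j<3. pair_perm \<pi> w (2 * j)) = (\<Prod>j<3. w (2 * \<pi> j))"
      by (intro prod.cong) (auto simp: pair_perm_def)
    also have "\<dots> = (\<Prod>j<3. w (2 * j))"
      using prod.reindex_bij_betw[OF \<pi>, of "\<lambda>j. w (2 * j)"] .
    finally show ?thesis using assms unfolding e10[abs_def] e01[abs_def] e11[abs_def] e30[abs_def]
      by (auto simp: S[OF \<pi>])
  qed
  moreover have "\<sigma> \<in> polyfun 6"
    using assms by (auto simp: e10_def[abs_def] e30_def[abs_def] e01_def[abs_def] e11_def[abs_def]
      intro!: polyfun.intros)
  ultimately show ?thesis by (auto simp: in_F_def ratfun_def intro: polyfun.const)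
qed

theorem theorem1:
  shows "(\<forall>p q. in_F p q \<longrightarrow> (\<exists>m P Q. annih m P Q p q)) \<and>
         (\<forall>\<sigma>\<in>{e10, e30, e01, e11}. \<exists>m P Q. annih m P Q \<sigma> (\<lambda>_. 1) \<and>
            (\<exists>b w. known_rel b w \<and> (\<forall>k<m. Q k b \<noteq> 0) \<and> hval m P Q b (\<sigma> w) \<noteq> 0))"
proof (intro conjI allI impI ballI)
  show "\<exists>m P Q. annih m P Q p q" if "in_F p q" for p q
    by (rule annih_exists[OF that])
  fix \<sigma> assume \<sigma>: "\<sigma> \<in> {e10, e30, e01, e11}"
  obtain m P Q where a: "annih m P Q \<sigma> (\<lambda>_. 1)"
    using annih_exists[OF in_F_symmetric[OF \<sigma>]] by blast
  have "\<exists>b w. known_rel b w \<and> (\<forall>k<m. Q k b \<noteq> 0) \<and> hval m P Q b (\<sigma> w) \<noteq> 0"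
    by (rule not_implied_by_known_rel[OF _ _ \<sigma>]) (use a in \<open>auto simp: annih_def ratfun_def\<close>)
  with a show "\<exists>m P Q. annih m P Q \<sigma> (\<lambda>_. 1) \<and>
      (\<exists>b w. known_rel b w \<and> (\<forall>k<m. Q k b \<noteq> 0) \<and> hval m P Q b (\<sigma> w) \<noteq> 0)" by blast
qed

end
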